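(* Let $\Gamma$ be a finitely generated group with a finite symmetric generating set $S$ containing the identity, acting by quasi-symmetric homeomorphisms with bounded measure distortion on a compact Riemannian manifold $(M,\varrho)$. If the action $\Gamma\curvearrowright M$ is expanding in measure (with respect to the Riemannian measure), then the warped cone $\mathcal{O}_\Gamma(M)$ does not coarsely embed into any $L^p$ space, $1\le p<\infty$.
   Context: Let $d$ be the distance and $\nu$ the measure on $M$ induced by $\varrho$. A homeomorphism $f\colon M\to M$ is \emph{quasi-symmetric} if there is an increasing homeomorphism $\eta\colon[0,\infty)\to[0,\infty)$ with $\frac{d(f(x),f(y))}{d(f(x),f(z))}\le\eta\big(\frac{d(x,y)}{d(x,z)}\big)$ for all $x,y,z$ with $z\ne x\ne y$. A map $f$ has \emph{bounded measure distortion} if there is $\Theta\ge1$ with $\frac1\Theta\nu(A)\le\nu(f(A))\le\Theta\nu(A)$ for all measurable $A$. An action has one of these properties if each group element does. The action is \emph{expanding in measure} if there is $\alpha>0$ with $\nu(S\cdot A)\ge(1+\alpha)\nu(A)$ for every measurable $A\subset M$ with $\nu(A)\le\nu(M)/2$, where $S\cdot A=\bigcup_{s\in S}s\cdot A$. \emph{Warped cone}: the open cone is $\mathcal{O}(M)=M\times[1,\infty)$ with the distance $d_{\mathcal O}$ induced by the Riemannian metric $t^2\varrho+dt^2$; $\Gamma$ acts by $g\cdot(x,t)=(g\cdot x,t)$. The warped cone $\mathcal{O}_\Gamma(M)$ is $\mathcal{O}(M)$ with the warped metric $\delta_\Gamma$, the largest distance such that $\delta_\Gamma(z,w)\le d_{\mathcal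 O}(z,w)$ and $\delta_\Gamma(z,s\cdot z)\le1$ for all $z,w$ and $s\in S$. A map $f\colon(X,d_X)\to(Y,d_Y)$ is a \emph{coarse embedding} if there are increasing unbounded functions $\eta_-,\eta_+\colon[0,\infty)\to[0,\infty)$ with $\eta_-(d_X(x,x'))\le d_Y(f(x),f(x'))\le\eta_+(d_X(x,x'))$ for all $x,x'\in X$. *)

theory Defs
  imports "HOL-Analysis.Analysis" "HOL-Algebra.Group_Action" "HOL-Algebra.Generated_Groups"
begin

section \<open>Smooth manifolds and Riemannian metrics\<close>

(* Meant for open S only: C^(k+1) is differentiability with all directional derivatives C^k. *)
primrec Ck_on ::
  "nat \<Rightarrow> ('a::euclidean_space \<Rightarrow> 'b::real_normed_vector) \<Rightarrow> 'a set \<Rightarrow> bool" where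
  "Ck_on 0 f S \<longleftrightarrow> continuous_on S f"
| "Ck_on (Suc k) f S \<longleftrightarrow>
     (\<forall>x\<in>S. f differentiable (at x)) \<and> (\<forall>v. Ck_on k (\<lambda>x. frechet_derivative f (at x) v) S)"

definition smooth_on ::
  "'a set \<Rightarrow> ('a::euclidean_space \<Rightarrow> 'b::real_normed_vector) \<Rightarrow> bool" where
  "smooth_on S f \<longleftrightarrow> (\<forall>k. Ck_on k f S)"

(* The manifold is the whole type 'm; its dimension CARD('n) is at least 1. *)
type_synonym ('m, 'n) chart = "'m set \<times> ('m \<Rightarrow> real^'n)"

definition chart_inv :: "('m, 'n) chart \<Rightarrow> real^'n \<Rightarrow> 'm" where
  "chart_inv c = inv_into (fst c) (snd c)"

definition smooth_atlas ::
  "('m::{t2_space,second_countable_topology}, 'n::finite) chart set \<Rightarrow> bool" where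
  "smooth_atlas \<A> \<longleftrightarrow>
     (\<Union>c\<in>\<A>. fst c) = UNIV \<and>
     (\<forall>c\<in>\<A>. open (fst c) \<and> open (snd c ` fst c) \<and>
        homeomorphism (fst c) (snd c ` fst c) (snd c) (chart_inv c)) \<and>
     (\<forall>c\<in>\<A>. \<forall>c'\<in>\<A>. smooth_on (snd c ` (fst c \<inter> fst c')) (snd c' \<circ> chart_inv c))"

(* g c p is the Gram matrix at p of the metric tensor in the coordinates of the chart c;
   the last clause is the transformation rule of a (0,2)-tensor. *)
definition riemannian_manifold ::
  "('m::{t2_space,second_countable_topology}, 'n::finite) chart set \<Rightarrow>
   (('m, 'n) chart \<Rightarrow> 'm \<Rightarrow> real^'n^'n) \<Rightarrow> bool" where
  "riemannian_manifold \<A> g \<longleftrightarrow>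
     smooth_atlas \<A> \<and>
     (\<forall>c\<in>\<A>. \<forall>p\<in>fst c. transpose (g c p) = g c p \<and> (\<forall>v. v \<noteq> 0 \<longrightarrow> v \<bullet> (g c p *v v) > 0)) \<and>
     (\<forall>c\<in>\<A>. smooth_on (snd c ` fst c) (g c \<circ> chart_inv c)) \<and>
     (\<forall>c\<in>\<A>. \<forall>c'\<in>\<A>. \<forall>p\<in>fst c \<inter> fst c'. \<forall>v w.
        let D = frechet_derivative (snd c' \<circ> chart_inv c) (at (snd c p))
        in v \<bullet> (g c p *v w) = D v \<bullet> (g c' p *v D w))"

section \<open>Distance and measure of a Riemannian manifold\<close>

definition piecewise_C1_curve ::
  "('m::{t2_space,second_countable_topology}, 'n::finite) chart set \<Rightarrow> (real \<Rightarrow> 'm) \<Rightarrow> bool" where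
  "piecewise_C1_curve \<A> \<gamma> \<longleftrightarrow>
     path \<gamma> \<and>
     (\<forall>c\<in>\<A>. \<forall>a b. 0 \<le> a \<and> a \<le> b \<and> b \<le> 1 \<and> \<gamma> ` {a..b} \<subseteq> fst c \<longrightarrow>
        (snd c \<circ> \<gamma>) piecewise_C1_differentiable_on {a..b})"

(* Norm of the velocity vector. By the transformation rule it does not depend on the chart
   that is chosen around the point. *)
definition speed ::
  "('m, 'n::finite) chart set \<Rightarrow> (('m, 'n) chart \<Rightarrow> 'm \<Rightarrow> real^'n^'n) \<Rightarrow>
   (real \<Rightarrow> 'm) \<Rightarrow> real \<Rightarrow> real" where
  "speed \<A> g \<gamma> t =
     (let c = (SOME c. c \<in> \<A> \<and> \<gamma> t \<in> fst c);
          v = vector_derivative (snd c \<circ> \<gamma>) (at t)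
      in sqrt (v \<bullet> (g c (\<gamma> t) *v v)))"

(* The library's piecewise C1 curves may have unbounded derivative near a break point. The
   length is therefore a nonnegative integral with values in [0,\<infinity>], and such curves do not
   change the infimum. *)
definition curve_length ::
  "('m, 'n::finite) chart set \<Rightarrow> (('m, 'n) chart \<Rightarrow> 'm \<Rightarrow> real^'n^'n) \<Rightarrow>
   (real \<Rightarrow> 'm) \<Rightarrow> ennreal" where
  "curve_length \<A> g \<gamma> = (\<integral>\<^sup>+t\<in>{0..1}. ennreal (speed \<A> g \<gamma> t) \<partial>lborel)"

(* Meant for connected manifolds, where the infimum is finite. *)
definition riemannian_dist ::
  "('m::{t2_space,second_countable_topology}, 'n::finite) chart set \<Rightarrow>
   (('m, 'n) chart \<Rightarrow> 'm \<Rightarrow> real^'n^'n) \<Rightarrow> 'm \<Rightarrow> 'm \<Rightarrow> real" where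
  "riemannian_dist \<A> g x y =
     enn2real (INF \<gamma>\<in>{\<gamma>. piecewise_C1_curve \<A> \<gamma> \<and> \<gamma> 0 = x \<and> \<gamma> 1 = y}. curve_length \<A> g \<gamma>)"

(* The unique Borel measure with density sqrt(det g) in every chart. *)
definition riemannian_measure ::
  "('m::{t2_space,second_countable_topology}, 'n::finite) chart set \<Rightarrow>
   (('m, 'n) chart \<Rightarrow> 'm \<Rightarrow> real^'n^'n) \<Rightarrow> 'm measure" where
  "riemannian_measure \<A> g = (THE \<nu>.
     sets \<nu> = sets borel \<and>
     (\<forall>c\<in>\<A>. \<forall>A\<in>sets borel. A \<subseteq> fst c \<longrightarrow>
        emeasure \<nu> A =
          (\<integral>\<^sup>+x\<in>snd c ` A. ennreal (sqrt (det (g c (chart_inv c x)))) \<partial>lborel)))"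

section \<open>Properties of maps and actions\<close>

definition quasi_symmetric ::
  "('m::topological_space \<Rightarrow> 'm \<Rightarrow> real) \<Rightarrow> ('m \<Rightarrow> 'm) \<Rightarrow> bool" where
  "quasi_symmetric d f \<longleftrightarrow>
     (\<exists>f'. homeomorphism UNIV UNIV f f') \<and>
     (\<exists>\<eta> \<eta>'. homeomorphism {0::real..} {0::real..} \<eta> \<eta>' \<and> strict_mono_on {0..} \<eta> \<and>
        (\<forall>x y z. z \<noteq> x \<and> x \<noteq> y \<longrightarrow> d (f x) (f y) / d (f x) (f z) \<le> \<eta> (d x y / d x z)))"

definition bounded_measure_distortion :: "'m measure \<Rightarrow> ('m \<Rightarrow> 'm) \<Rightarrow> bool" where
  "bounded_measure_distortion \<nu> f \<longleftrightarrow>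
     (\<exists>\<Theta>\<ge>1. \<forall>A\<in>sets \<nu>.
        ennreal (1 / \<Theta>) * emeasure \<nu> A \<le> emeasure \<nu> (f ` A) \<and>
        emeasure \<nu> (f ` A) \<le> ennreal \<Theta> * emeasure \<nu> A)"

definition expanding_in_measure :: "'m measure \<Rightarrow> ('g \<Rightarrow> 'm \<Rightarrow> 'm) \<Rightarrow> 'g set \<Rightarrow> bool" where
  "expanding_in_measure \<nu> \<phi> S \<longleftrightarrow>
     (\<exists>\<alpha>>0. \<forall>A\<in>sets \<nu>. emeasure \<nu> A \<le> emeasure \<nu> (space \<nu>) / 2 \<longrightarrow>
        emeasure \<nu> (\<Union>s\<in>S. \<phi> s ` A) \<ge> ennreal (1 + \<alpha>) * emeasure \<nu> A)"

section \<open>Warped cones\<close>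

definition open_cone :: "('m \<times> real) set" where
  "open_cone = UNIV \<times> {1..}"

(* Length of the curve (\<gamma>,\<tau>) in the cone, for the metric with square norm
   t^2 * |v|^2 + r^2 of a tangent vector (v,r) at (x,t). *)
definition cone_length ::
  "('m, 'n::finite) chart set \<Rightarrow> (('m, 'n) chart \<Rightarrow> 'm \<Rightarrow> real^'n^'n) \<Rightarrow>
   (real \<Rightarrow> 'm) \<Rightarrow> (real \<Rightarrow> real) \<Rightarrow> ennreal" where
  "cone_length \<A> g \<gamma> \<tau> =
     (\<integral>\<^sup>+t\<in>{0..1}. ennreal (sqrt ((\<tau> t)\<^sup>2 * (speed \<A> g \<gamma> t)\<^sup>2 + (vector_derivative \<tau> (at t))\<^sup>2)) \<partial>lborel)"

definition cone_dist ::
  "('m::{t2_space,second_countable_topology}, 'n::finite) chart set \<Rightarrow>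
   (('m, 'n) chart \<Rightarrow> 'm \<Rightarrow> real^'n^'n) \<Rightarrow> 'm \<times> real \<Rightarrow> 'm \<times> real \<Rightarrow> real" where
  "cone_dist \<A> g z w =
     enn2real (INF (\<gamma>, \<tau>)\<in>{(\<gamma>, \<tau>). piecewise_C1_curve \<A> \<gamma> \<and> valid_path \<tau> \<and>
         (\<forall>t\<in>{0..1}. \<tau> t \<ge> 1) \<and> (\<gamma> 0, \<tau> 0) = z \<and> (\<gamma> 1, \<tau> 1) = w}. cone_length \<A> g \<gamma> \<tau>)"

(* The largest distance on X that is at most d and moves no point by more than 1 under any
   s in S. A pointwise supremum of distances is again a distance as long as it is finite. *)
definition warped_dist ::
  "'x set \<Rightarrow> ('x \<Rightarrow> 'x \<Rightarrow> real) \<Rightarrow> ('g \<Rightarrow> 'x \<Rightarrow> 'x) \<Rightarrow> 'g set \<Rightarrow> 'x \<Rightarrow> 'x \<Rightarrow> real" where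
  "warped_dist X d \<phi> S z w =
     (SUP \<rho>\<in>{\<rho>. Metric_space X \<rho> \<and> (\<forall>x\<in>X. \<forall>y\<in>X. \<rho> x y \<le> d x y) \<and>
                (\<forall>x\<in>X. \<forall>s\<in>S. \<rho> x (\<phi> s x) \<le> 1)}. \<rho> z w)"

definition cone_action :: "('g \<Rightarrow> 'm \<Rightarrow> 'm) \<Rightarrow> 'g \<Rightarrow> 'm \<times> real \<Rightarrow> 'm \<times> real" where
  "cone_action \<phi> h = (\<lambda>(x, t). (\<phi> h x, t))"

definition warped_cone_dist ::
  "('m::{t2_space,second_countable_topology}, 'n::finite) chart set \<Rightarrow>
   (('m, 'n) chart \<Rightarrow> 'm \<Rightarrow> real^'n^'n) \<Rightarrow> ('g \<Rightarrow> 'm \<Rightarrow> 'm) \<Rightarrow> 'g set \<Rightarrow>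
   'm \<times> real \<Rightarrow> 'm \<times> real \<Rightarrow> real" where
  "warped_cone_dist \<A> g \<phi> S = warped_dist open_cone (cone_dist \<A> g) (cone_action \<phi>) S"

section \<open>Coarse embeddings and Lp spaces\<close>

definition coarse_embedding ::
  "'x set \<Rightarrow> ('x \<Rightarrow> 'x \<Rightarrow> real) \<Rightarrow> 'y set \<Rightarrow> ('y \<Rightarrow> 'y \<Rightarrow> real) \<Rightarrow> ('x \<Rightarrow> 'y) \<Rightarrow> bool" where
  "coarse_embedding X dX Y dY f \<longleftrightarrow>
     f \<in> X \<rightarrow> Y \<and>
     (\<exists>\<eta>1 \<eta>2 :: real \<Rightarrow> real.
        (\<forall>\<eta>\<in>{\<eta>1, \<eta>2}. \<eta> \<in> {0..} \<rightarrow> {0..} \<and> mono_on {0..} \<eta> \<and> \<not> bdd_above (\<eta> ` {0..})) \<and>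
        (\<forall>x\<in>X. \<forall>x'\<in>X. \<eta>1 (dX x x') \<le> dY (f x) (f x') \<and> dY (f x) (f x') \<le> \<eta>2 (dX x x')))"

definition Lp_functions :: "real \<Rightarrow> 'w measure \<Rightarrow> ('w \<Rightarrow> real) set" where
  "Lp_functions p N = {f \<in> borel_measurable N. integrable N (\<lambda>x. \<bar>f x\<bar> powr p)}"

definition Lp_eq :: "real \<Rightarrow> 'w measure \<Rightarrow> (('w \<Rightarrow> real) \<times> ('w \<Rightarrow> real)) set" where
  "Lp_eq p N = {(f, h). f \<in> Lp_functions p N \<and> h \<in> Lp_functions p N \<and> (AE x in N. f x = h x)}"

definition Lp_space :: "real \<Rightarrow> 'w measure \<Rightarrow> ('w \<Rightarrow> real) set set" where
  "Lp_space p N = Lp_functions p N // Lp_eq p N"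

definition Lp_dist :: "real \<Rightarrow> 'w measure \<Rightarrow> ('w \<Rightarrow> real) set \<Rightarrow> ('w \<Rightarrow> real) set \<Rightarrow> real" where
  "Lp_dist p N F H =
     the_elem (\<Union>f\<in>F. \<Union>h\<in>H. {(\<integral>x. \<bar>f x - h x\<bar> powr p \<partial>N) powr (1 / p)})"

end

(* Fix a level t of the cone. If f is a coarse embedding, it is Lipschitz at scale 1 along the
   generators, and expansion in measure, discretised over a partition of M into pieces of small
   diameter at level t, gives an L^p Poincare inequality with constants independent of t (coarea
   formula applied to the distance from a median, raised to the power p). Hence for some x the
   points y with warped distance at most R from x fill half of the measure of M, R independent of t.
   But such y lie in small balls, shrinking as t grows, around a bounded number of points (the
   points obtained from x by moving and warping at most R times), so their total measure tends
   to 0. Quasi-symmetry enters only through continuity of the action.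

   Lower bounds for warped distances need no Riemannian geodesics: the supremum of |h x - h y| over
   functions h with gradient at most 1 is a metric below the Riemannian one, and it is enough. *)
theory Submission
  imports Defs
begin

text \<open>\<open>riemannian_measure\<close> is a definite description, so nothing is known about
  it before existence and uniqueness are proved; both rest on the invariance of the chart integrals
  under transition maps, which explains the change of variables at the start.
  \<open>cone_dist\<close> is an infimum over curves followed by \<open>enn2real\<close>, which
  sends infinity to 0. A lower bound for it therefore requires a curve of finite length between any
  two points, and connectedness provides one. \<open>warped_dist\<close> is a supremum over metrics:
  upper bounds are immediate, while a lower bound means exhibiting a member of the family. The least
  cost of a chain of moves and warps supplies it. In the Poincare inequality the passage from
  differences of p-th powers to p-th powers of differences is made by absorbing a small multiple of
  b^p into the left side, in place of Hoelder's inequality. The contradiction sets M/2 against M/4,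
  where M is the total mass: M/2 comes from Markov's inequality around a piece with at most average
  displacement, M/4 is the bound for a warped ball at a high level.\<close>

section \<open>Change of variables for Lebesgue measure over an arbitrary finite index type\<close>

text \<open>The library proves change of variables only for vectors whose index type is well-ordered.\<close>

typedef 'a wo = "UNIV :: 'a set" morphisms of_wo to_wo ..

lemmas wo_simps [simp] = of_wo_inverse to_wo_inverse[OF UNIV_I]

lemma bij_to_wo: "bij to_wo"
  by (metis bijI' of_wo_inverse to_wo_inverse UNIV_I)

lemma bij_of_wo: "bij of_wo"
  by (metis bijI' of_wo_inverse to_wo_inverse UNIV_I)

instance wo :: (finite) finite
  by standard (metis bij_to_wo bij_betw_finite finite)

instantiation wo :: (finite) wellorder
begin

text \<open>The order is pulled back from the natural numbers along \<open>to_nat\<close>, which is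
  injective because a finite type is countable.\<close>

definition less_eq_wo :: "'a wo \<Rightarrow> 'a wo \<Rightarrow> bool" where
  "less_eq_wo x y \<longleftrightarrow> to_nat (of_wo x) \<le> to_nat (of_wo y)"

definition less_wo :: "'a wo \<Rightarrow> 'a wo \<Rightarrow> bool" where
  "less_wo x y \<longleftrightarrow> to_nat (of_wo x) < to_nat (of_wo y)"

instance
proof
  fix x y :: "'a wo"
  assume "x \<le> y" "y \<le> x"
  then show "x = y"
    by (simp add: less_eq_wo_def of_wo_inject)
next
  fix P :: "'a wo \<Rightarrow> bool" and a
  assume "\<And>x. (\<And>y. y < x \<Longrightarrow> P y) \<Longrightarrow> P x"
  then show "P a"
    unfolding less_wo_def by (rule measure_induct_rule)
qed (auto simp: less_eq_wo_def less_wo_def)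

end

definition to_wo_vec :: "'a^'n \<Rightarrow> 'a^('n wo)" where
  "to_wo_vec x = (\<chi> j. x $ of_wo j)"

definition of_wo_vec :: "'a^('n wo) \<Rightarrow> 'a^'n" where
  "of_wo_vec y = (\<chi> i. y $ to_wo i)"

lemma wo_vec_inverse [simp]: "of_wo_vec (to_wo_vec x) = x" "to_wo_vec (of_wo_vec y) = y"
  by (simp_all add: to_wo_vec_def of_wo_vec_def vec_eq_iff)

lemma linear_to_wo_vec: "linear (to_wo_vec :: real^'n::finite \<Rightarrow> real^('n wo))"
  by (rule linearI) (auto simp: to_wo_vec_def vec_eq_iff)

lemma linear_of_wo_vec: "linear (of_wo_vec :: real^('n wo) \<Rightarrow> real^'n::finite)"
  by (rule linearI) (auto simp: of_wo_vec_def vec_eq_iff)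

lemma measurable_to_wo_vec [measurable]:
  "(to_wo_vec :: real^'n::finite \<Rightarrow> real^('n wo)) \<in> borel_measurable borel"
  by (intro borel_measurable_continuous_onI linear_continuous_on
        linear_conv_bounded_linear[THEN iffD1] linear_to_wo_vec)

lemma measurable_of_wo_vec [measurable]:
  "(of_wo_vec :: real^('n wo) \<Rightarrow> real^'n::finite) \<in> borel_measurable borel"
  by (intro borel_measurable_continuous_onI linear_continuous_on
        linear_conv_bounded_linear[THEN iffD1] linear_of_wo_vec)

lemma prod_Basis_cart: "(\<Prod>b\<in>Basis. (x :: real^'n::finite) \<bullet> b) = (\<Prod>i\<in>UNIV. x $ i)"
proof -
  have B: "(Basis :: (real^'n) set) = range (\<lambda>i. axis i 1)"
    by (auto simp: Basis_vec_def)
  have "inj (\<lambda>i::'n. axis i (1::real))"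
    by (simp add: inj_on_def axis_eq_axis)
  then show ?thesis
    unfolding B by (subst prod.reindex) (auto simp: inner_axis)
qed

text \<open>Lebesgue measure is determined by its values on boxes, and renaming coordinates turns a
  box into a box with the same side lengths in another order.\<close>

lemma distr_to_wo_vec: "distr lborel borel to_wo_vec = (lborel :: (real^('n::finite wo)) measure)"
proof (rule lborel_eqI[symmetric])
  fix l u :: "real^('n wo)"
  assume "\<And>b. b \<in> Basis \<Longrightarrow> l \<bullet> b \<le> u \<bullet> b"
  then have le: "l $ i \<le> u $ i" for i
    by (metis axis_in_Basis_iff cart_eq_inner_axis inner_real_def mult.right_neutral Basis_real_def
        insertI1)
  have "to_wo_vec -` box l u = box (of_wo_vec l) (of_wo_vec u)"
    by (auto simp: mem_box_cart to_wo_vec_def of_wo_vec_def) (metis of_wo_inverse wo_simps)+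
  then have "emeasure (distr lborel borel to_wo_vec) (box l u)
      = emeasure lborel (box (of_wo_vec l) (of_wo_vec u))"
    by (subst emeasure_distr) auto
  also have "\<dots> = ennreal (\<Prod>b\<in>Basis. (of_wo_vec u - of_wo_vec l) \<bullet> b)"
  proof (rule emeasure_lborel_box)
    fix b :: "real^'n" assume "b \<in> Basis"
    then show "of_wo_vec l \<bullet> b \<le> of_wo_vec u \<bullet> b"
      using le by (auto simp: Basis_vec_def of_wo_vec_def inner_axis)
  qed
  also have "(\<Prod>b\<in>Basis. (of_wo_vec u - of_wo_vec l) \<bullet> b) = (\<Prod>i\<in>UNIV. (u - l) $ to_wo i)"
    by (subst prod_Basis_cart) (simp add: of_wo_vec_def)
  also have "\<dots> = (\<Prod>i\<in>UNIV. (u - l) $ i)"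
    by (rule prod.reindex_bij_betw) (rule bij_to_wo)
  also have "\<dots> = (\<Prod>b\<in>Basis. (u - l) \<bullet> b)"
    by (subst prod_Basis_cart) simp
  finally show "emeasure (distr lborel borel to_wo_vec) (box l u) = ennreal (\<Prod>b\<in>Basis. (u - l) \<bullet> b)" .
qed simp

text \<open>Conjugation by \<open>to_wo\<close> is a sign-preserving bijection between the
  permutations of the two index types, so the Leibniz expansions agree term by term.\<close>

lemma det_to_wo:
  fixes A :: "real^'n::finite^'n"
  shows "det (\<chi> i j. A $ of_wo i $ of_wo j) = det A"
proof -
  let ?m = "map_permutation (UNIV::'n set) to_wo"
  have m: "?m p = to_wo \<circ> p \<circ> of_wo" for p
    unfolding map_permutation_def restrict_id_def using bij_to_wo
    by (auto simp: fun_eq_iff bij_def)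
  have bij: "bij_betw ?m {p. p permutes UNIV} {p. p permutes UNIV}"
  proof (rule bij_betw_byWitness[where f' = "\<lambda>q. of_wo \<circ> q \<circ> to_wo"])
    show "?m ` {p. p permutes UNIV} \<subseteq> {p. p permutes UNIV}"
      using map_permutation_permutes[OF bij_to_wo] by auto
    show "(\<lambda>q. of_wo \<circ> q \<circ> to_wo) ` {p :: 'n wo \<Rightarrow> 'n wo. p permutes UNIV} \<subseteq> {p. p permutes UNIV}"
    proof (rule image_subsetI)
      fix q :: "'n wo \<Rightarrow> 'n wo" assume "q \<in> {p. p permutes UNIV}"
      then have "bij (of_wo \<circ> q \<circ> to_wo)"
        by (intro bij_comp bij_to_wo bij_of_wo) (auto intro: permutes_bij)
      then show "of_wo \<circ> q \<circ> to_wo \<in> {p. p permutes UNIV}"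
        by (auto intro: bij_imp_permutes)
    qed
  qed (auto simp: m fun_eq_iff)
  have "det (\<chi> i j. A $ of_wo i $ of_wo j)
      = (\<Sum>p\<in>{p. p permutes UNIV}. of_int (sign (?m p)) * (\<Prod>i\<in>UNIV. A $ of_wo i $ of_wo (?m p i)))"
    unfolding det_def by (subst sum.reindex_bij_betw[OF bij, symmetric]) simp
  also have "\<dots> = (\<Sum>p\<in>{p. p permutes UNIV}. of_int (sign p) * (\<Prod>i\<in>UNIV. A $ i $ p i))"
  proof (rule sum.cong[OF refl])
    fix p :: "'n \<Rightarrow> 'n" assume p: "p \<in> {p. p permutes UNIV}"
    have "(\<Prod>i\<in>UNIV. A $ of_wo i $ of_wo (?m p i)) = (\<Prod>i\<in>UNIV. A $ i $ p i)"
      by (subst prod.reindex_bij_betw[OF bij_of_wo, symmetric]) (simp add: m)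
    moreover have "sign (?m p) = sign p"
      using p bij_to_wo by (intro sign_map_permutation) (auto simp: bij_def)
    ultimately show "of_int (sign (?m p)) * (\<Prod>i\<in>UNIV. A $ of_wo i $ of_wo (?m p i))
        = of_int (sign p) * (\<Prod>i\<in>UNIV. A $ i $ p i)"
      by simp
  qed
  finally show ?thesis
    by (simp add: det_def)
qed

text \<open>\<open>has_measure_differentiable_image\<close> compares finite values only. It is an
  equivalence, however: if the integral is infinite, the image cannot have finite measure either,
  and this settles the extended-valued equation.\<close>

lemma emeasure_differentiable_image_wo:
  fixes T :: "real^'n::{finite,wellorder} \<Rightarrow> real^'n::_"
  assumes S: "S \<in> sets borel" and TS: "T ` S \<in> sets borel"
    and der: "\<And>x. x \<in> S \<Longrightarrow> (T has_derivative T' x) (at x within S)" and inj: "inj_on T S"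
    and meas: "(\<lambda>x. indicator S x * \<bar>det (matrix (T' x))\<bar>) \<in> borel_measurable borel"
  shows "emeasure lborel (T ` S) = (\<integral>\<^sup>+x\<in>S. ennreal \<bar>det (matrix (T' x))\<bar> \<partial>lborel)" (is "_ = ?I")
proof -
  let ?f = "\<lambda>x. indicator S x * \<bar>det (matrix (T' x))\<bar> :: real"
  have I: "?I = (\<integral>\<^sup>+x. ennreal (?f x) \<partial>lborel)"
    by (intro nn_integral_cong) (auto simp: indicator_def)
  have hi: "((\<lambda>x. \<bar>det (matrix (T' x))\<bar>) has_integral m) S \<longleftrightarrow> (?f has_integral m) UNIV" for m
  proof -
    have "?f = (\<lambda>x. if x \<in> S then \<bar>det (matrix (T' x))\<bar> else 0)"
      by (auto simp: fun_eq_iff)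
    then show ?thesis
      by (simp only: has_integral_restrict_UNIV)
  qed
  have meas': "?f \<in> borel_measurable lebesgue"
    by (rule measurable_completion) (use meas in simp)
  have ii: "(?f has_integral m) UNIV \<longleftrightarrow> ?I = ennreal m \<and> 0 \<le> m" for m
    using has_integral_iff_nn_integral_lebesgue [of ?f m] meas' unfolding I
    by (auto simp: nn_integral_completion)
  have key: "T ` S \<in> lmeasurable \<and> measure lebesgue (T ` S) = m \<longleftrightarrow> ?I = ennreal m \<and> 0 \<le> m" for m
    using has_measure_differentiable_image[of S T T' m] S der inj hi ii by auto
  show ?thesis
  proof (cases ?I)
    case (real m)
    then have "T ` S \<in> lmeasurable" "measure lebesgue (T ` S) = m"
      using key[of m] by auto
    then have "emeasure lebesgue (T ` S) = ennreal m"
      using emeasure_eq_measure2 by blast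
    then show ?thesis
      using real TS by simp
  next
    case top
    have "T ` S \<notin> lmeasurable"
      using key[of "measure lebesgue (T ` S)"] top by auto
    then have "emeasure lborel (T ` S) = \<infinity>"
      using TS by (auto simp: fmeasurable_def less_top[symmetric])
    then show ?thesis
      using top by simp
  qed
qed

text \<open>T is conjugated by the renaming of coordinates, which changes neither Lebesgue measure
  nor the Jacobian determinant.\<close>

lemma emeasure_differentiable_image:
  fixes T :: "real^'n::finite \<Rightarrow> real^'n"
  assumes S: "S \<in> sets borel" and TS: "T ` S \<in> sets borel"
    and der: "\<And>x. x \<in> S \<Longrightarrow> (T has_derivative T' x) (at x)" and inj: "inj_on T S"
    and meas: "(\<lambda>x. indicator S x * \<bar>det (matrix (T' x))\<bar>) \<in> borel_measurable borel"
  shows "emeasure lborel (T ` S) = (\<integral>\<^sup>+x\<in>S. ennreal \<bar>det (matrix (T' x))\<bar> \<partial>lborel)"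
proof -
  let ?R = "to_wo_vec :: real^'n \<Rightarrow> real^('n wo)" and ?Q = "of_wo_vec :: real^('n wo) \<Rightarrow> real^'n"
  define V where "V = ?R \<circ> T \<circ> ?Q"
  define V' where "V' y = ?R \<circ> T' (?Q y) \<circ> ?Q" for y
  have im: "?R ` A = ?Q -` A" for A
    by (auto simp: image_iff) (metis wo_vec_inverse(2))
  have Rb: "?R ` A \<in> sets borel" if "A \<in> sets borel" for A
    unfolding im using measurable_sets[OF measurable_of_wo_vec that] by simp
  have eR: "emeasure lborel (?R ` A) = emeasure lborel A" if "A \<in> sets borel" for A
  proof -
    have "?R -` (?R ` A) = A"
      by (auto simp: image_iff) (metis wo_vec_inverse(1))
    then show ?thesis
      using emeasure_distr[of ?R lborel borel "?R ` A"] Rb[OF that] distr_to_wo_vec[where 'n='n] by simp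
  qed
  have det: "det (matrix (V' (?R x))) = det (matrix (T' x))" for x
  proof -
    have "matrix (V' (?R x)) = (\<chi> i j. matrix (T' x) $ of_wo i $ of_wo j)"
    proof -
      have Q: "?Q (axis j 1) = axis (of_wo j) 1" for j
        by (auto simp: of_wo_vec_def axis_def vec_eq_iff)
      then show ?thesis
        by (simp add: matrix_def V'_def Q to_wo_vec_def[of "T' x _"] vec_eq_iff)
    qed
    then show ?thesis
      by (simp add: det_to_wo)
  qed
  have VS: "V ` (?R ` S) = ?R ` (T ` S)"
    by (auto simp: V_def image_image)
  have "emeasure lborel (T ` S) = emeasure lborel (V ` (?R ` S))"
    using eR[OF TS] VS by simp
  also have "\<dots> = (\<integral>\<^sup>+y\<in>?R ` S. ennreal \<bar>det (matrix (V' y))\<bar> \<partial>lborel)"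
  proof (rule emeasure_differentiable_image_wo)
    show "?R ` S \<in> sets borel" "V ` ?R ` S \<in> sets borel"
      using Rb S TS VS by auto
    show "(V has_derivative V' y) (at y within ?R ` S)" if "y \<in> ?R ` S" for y
    proof -
      have "?Q y \<in> S" using that by auto
      then have "(V has_derivative V' y) (at y)"
        unfolding V_def V'_def
        by (intro diff_chain_at linear_imp_has_derivative linear_of_wo_vec linear_to_wo_vec der)
      then show ?thesis by (rule has_derivative_at_withinI)
    qed
    show "inj_on V (?R ` S)"
      using inj by (auto simp: inj_on_def V_def) (metis wo_vec_inverse(1))
    have "(\<lambda>y. indicator (?R ` S) y * \<bar>det (matrix (V' y))\<bar>)
        = (\<lambda>x. indicator S x * \<bar>det (matrix (T' x))\<bar> :: real) \<circ> ?Q"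
    proof
      fix y
      show "indicator (?R ` S) y * \<bar>det (matrix (V' y))\<bar>
        = ((\<lambda>x. indicator S x * \<bar>det (matrix (T' x))\<bar> :: real) \<circ> ?Q) y"
        using det[of "?Q y"] by (simp add: im indicator_def)
    qed
    then show "(\<lambda>y. indicator (?R ` S) y * \<bar>det (matrix (V' y))\<bar> :: real) \<in> borel_measurable borel"
      using measurable_comp[OF measurable_of_wo_vec meas] by simp
  qed
  also have "\<dots> = (\<integral>\<^sup>+y. ennreal (indicator S (?Q y) * \<bar>det (matrix (T' (?Q y)))\<bar>) \<partial>lborel)"
  proof (intro nn_integral_cong)
    fix y
    show "ennreal \<bar>det (matrix (V' y))\<bar> * indicator (?R ` S) y
        = ennreal (indicator S (?Q y) * \<bar>det (matrix (T' (?Q y)))\<bar>)"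
      using det[of "?Q y"] by (simp add: im indicator_def)
  qed
  also have "\<dots> = (\<integral>\<^sup>+x. ennreal (indicator S x * \<bar>det (matrix (T' x))\<bar>) \<partial>lborel)"
    using meas by (subst distr_to_wo_vec[symmetric], subst nn_integral_distr) simp_all
  also have "\<dots> = (\<integral>\<^sup>+x\<in>S. ennreal \<bar>det (matrix (T' x))\<bar> \<partial>lborel)"
    by (intro nn_integral_cong) (auto simp: indicator_def)
  finally show ?thesis .
qed

text \<open>The segment from the identity to B consists of positive definite, hence invertible,
  matrices. The determinant is continuous on it, never vanishes and equals 1 at the start.\<close>

lemma pos_def_imp_det_pos:
  fixes B :: "real^'n::finite^'n"
  assumes pos: "\<And>v. v \<noteq> 0 \<Longrightarrow> v \<bullet> (B *v v) > 0"
  shows "det B > 0"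
proof -
  let ?P = "\<lambda>t. (1 - t) *\<^sub>R mat 1 + t *\<^sub>R B"
  have nz: "det (?P t) \<noteq> 0" if t: "0 \<le> t" "t \<le> 1" for t :: real
  proof -
    have "inj ((*v) (?P t))"
    proof (rule linear_injective_0[THEN iffD2, rule_format])
      fix v assume v: "?P t *v v = 0"
      show "v = 0"
      proof (rule ccontr)
        assume "v \<noteq> 0"
        have "v \<bullet> (?P t *v v) = (1 - t) * (v \<bullet> v) + t * (v \<bullet> (B *v v))"
          by (simp add: matrix_vector_mult_add_rdistrib scaleR_matrix_vector_assoc[symmetric]
              inner_add_right)
        moreover have "0 < v \<bullet> v" "0 < v \<bullet> (B *v v)"
          using pos \<open>v \<noteq> 0\<close> by auto
        moreover have "0 < (1 - t) * (v \<bullet> v) + t * (v \<bullet> (B *v v))"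
        proof (cases "t = 1")
          case False
          then show ?thesis
            using t calculation by (intro add_pos_nonneg mult_pos_pos mult_nonneg_nonneg) auto
        qed (use calculation in auto)
        ultimately show False
          using v by simp
      qed
    qed simp
    then show ?thesis
      by (simp add: inj_matrix_vector_mult invertible_det_nz[symmetric] invertible_left_inverse
          matrix_left_invertible_injective)
  qed
  have cont: "continuous_on {0..1} (\<lambda>t. det (?P t))"
    unfolding det_def by (intro continuous_intros)
  show ?thesis
  proof (rule ccontr)
    assume "\<not> det B > 0"
    then have "\<exists>t\<ge>0. t \<le> 1 \<and> det (?P t) = 0"
      by (intro IVT2') (use cont in auto)
    then show False
      using nz by blast
  qed
qed

text \<open>The formula for sets, applied to W intersected with preimages under T, says that T
  carries the measure with density |det T'| on W to Lebesgue measure on the image of W. Integrating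
  f against both sides gives the claim. Extending T by 0 off W makes it globally measurable and is
  harmless, since the density vanishes there.\<close>

lemma nn_integral_differentiable_image:
  fixes T :: "real^'n::finite \<Rightarrow> real^'n" and f :: "real^'n \<Rightarrow> ennreal"
  assumes W: "W \<in> sets borel"
    and TB: "\<And>B. B \<in> sets borel \<Longrightarrow> B \<subseteq> W \<Longrightarrow> T ` B \<in> sets borel"
    and der: "\<And>x. x \<in> W \<Longrightarrow> (T has_derivative T' x) (at x)" and inj: "inj_on T W"
    and meas: "(\<lambda>x. indicator W x * \<bar>det (matrix (T' x))\<bar>) \<in> borel_measurable borel"
    and measT: "(\<lambda>x. if x \<in> W then T x else 0) \<in> borel_measurable borel"
    and f: "f \<in> borel_measurable borel"
  shows "(\<integral>\<^sup>+y\<in>T ` W. f y \<partial>lborel) = (\<integral>\<^sup>+x\<in>W. ennreal \<bar>det (matrix (T' x))\<bar> * f (T x) \<partial>lborel)"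
proof -
  let ?J = "\<lambda>x. indicator W x * \<bar>det (matrix (T' x))\<bar> :: real"
  let ?T = "\<lambda>x. if x \<in> W then T x else 0"
  let ?N = "density lborel (\<lambda>x. ennreal (?J x))"
  note [measurable] = W meas measT f
  have TW[measurable]: "T ` W \<in> sets borel"
    using TB W by auto
  have eq: "distr ?N borel ?T = density lborel (indicator (T ` W))"
  proof (rule measure_eqI)
    fix B assume "B \<in> sets (distr ?N borel ?T)"
    then have B[measurable]: "B \<in> sets borel" by simp
    have S: "W \<inter> ?T -` B \<in> sets borel"
      using measurable_sets[OF measT, of B] W by auto
    have im: "T ` (W \<inter> ?T -` B) = B \<inter> T ` W"
      by auto
    have Jm: "(\<lambda>x. indicator (W \<inter> ?T -` B) x * \<bar>det (matrix (T' x))\<bar> :: real) \<in> borel_measurable borel"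
    proof -
      have "(\<lambda>x. indicator (W \<inter> ?T -` B) x * \<bar>det (matrix (T' x))\<bar> :: real)
          = (\<lambda>x. indicator (W \<inter> ?T -` B) x * ?J x)"
        by (auto simp: fun_eq_iff indicator_def)
      then show ?thesis
        using S by simp
    qed
    have "emeasure (distr ?N borel ?T) B = emeasure ?N (?T -` B)"
      by (subst emeasure_distr) simp_all
    also have "\<dots> = (\<integral>\<^sup>+x\<in>?T -` B. ennreal (?J x) \<partial>lborel)"
      using measurable_sets[OF measT, of B] by (subst emeasure_density) simp_all
    also have "\<dots> = (\<integral>\<^sup>+x\<in>W \<inter> ?T -` B. ennreal \<bar>det (matrix (T' x))\<bar> \<partial>lborel)"
      by (intro nn_integral_cong) (auto simp: indicator_def)
    also have "\<dots> = emeasure lborel (T ` (W \<inter> ?T -` B))"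
      by (intro emeasure_differentiable_image[symmetric] S Jm)
         (use der inj TW B im in \<open>auto intro: inj_on_subset\<close>)
    also have "\<dots> = emeasure (density lborel (indicator (T ` W))) B"
      using im by (subst emeasure_density) (auto simp: indicator_inter_arith[symmetric] Int_commute)
    finally show "emeasure (distr ?N borel ?T) B = emeasure (density lborel (indicator (T ` W))) B" .
  qed simp
  have "(\<integral>\<^sup>+y\<in>T ` W. f y \<partial>lborel) = (\<integral>\<^sup>+y. f y \<partial>density lborel (indicator (T ` W)))"
    by (subst nn_integral_density) (auto simp: mult.commute)
  also have "\<dots> = (\<integral>\<^sup>+x. f (?T x) \<partial>?N)"
    unfolding eq[symmetric] by (subst nn_integral_distr) simp_all
  also have "\<dots> = (\<integral>\<^sup>+x. ennreal (?J x) * f (?T x) \<partial>lborel)"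
    by (subst nn_integral_density) simp_all
  also have "\<dots> = (\<integral>\<^sup>+x\<in>W. ennreal \<bar>det (matrix (T' x))\<bar> * f (T x) \<partial>lborel)"
    by (intro nn_integral_cong) (auto simp: indicator_def)
  finally show ?thesis .
qed

text \<open>Serves to glue measures that live on the pieces of a finite partition subordinate to
  charts.\<close>

lemma ex_sum_measure:
  fixes M :: "'i \<Rightarrow> 'a::topological_space measure"
  assumes "finite I" and sM: "\<And>i. i \<in> I \<Longrightarrow> sets (M i) = sets borel"
  shows "\<exists>\<nu>. sets \<nu> = sets (borel :: 'a measure) \<and>
    (\<forall>B\<in>sets borel. emeasure \<nu> B = (\<Sum>i\<in>I. emeasure (M i) B))"
proof (intro exI conjI ballI)
  let ?\<nu> = "measure_of UNIV (sets (borel :: 'a measure)) (\<lambda>B. \<Sum>i\<in>I. emeasure (M i) B)"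
  show "sets ?\<nu> = sets (borel :: 'a measure)"
    by (metis sets.sets_measure_of_eq space_borel)
  fix B :: "'a set" assume "B \<in> sets borel"
  show "emeasure ?\<nu> B = (\<Sum>i\<in>I. emeasure (M i) B)"
  proof (rule emeasure_measure_of_sigma)
    show "sigma_algebra UNIV (sets (borel :: 'a measure))"
      by (metis sets.sigma_algebra_axioms space_borel)
    show "positive (sets (borel :: 'a measure)) (\<lambda>B. \<Sum>i\<in>I. emeasure (M i) B)"
      by (simp add: positive_def)
    show "countably_additive (sets (borel :: 'a measure)) (\<lambda>B. \<Sum>i\<in>I. emeasure (M i) B)"
    proof (rule countably_additiveI)
      fix A :: "nat \<Rightarrow> 'a set"
      assume A: "range A \<subseteq> sets borel" "disjoint_family A" "\<Union> (range A) \<in> sets borel"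
      have "(\<Sum>n. \<Sum>i\<in>I. emeasure (M i) (A n)) = (\<Sum>i\<in>I. \<Sum>n. emeasure (M i) (A n))"
        by (rule suminf_sum) simp
      also have "\<dots> = (\<Sum>i\<in>I. emeasure (M i) (\<Union> (range A)))"
        using A sM by (intro sum.cong suminf_emeasure) auto
      finally show "(\<Sum>n. \<Sum>i\<in>I. emeasure (M i) (A n)) = (\<Sum>i\<in>I. emeasure (M i) (\<Union> (range A)))" .
    qed
  qed fact
qed

section \<open>The Riemannian measure\<close>

locale riemannian =
  fixes \<A> :: "('m::{t2_space,second_countable_topology}, 'n::finite) chart set"
    and g :: "('m, 'n) chart \<Rightarrow> 'm \<Rightarrow> real^'n^'n"
  assumes rm: "riemannian_manifold \<A> g"
begin

abbreviation transition :: "('m, 'n) chart \<Rightarrow> ('m, 'n) chart \<Rightarrow> real^'n \<Rightarrow> real^'n" where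
  "transition c c' \<equiv> snd c' \<circ> chart_inv c"

abbreviation dtransition :: "('m, 'n) chart \<Rightarrow> ('m, 'n) chart \<Rightarrow> real^'n \<Rightarrow> real^'n \<Rightarrow> real^'n" where
  "dtransition c c' x \<equiv> frechet_derivative (transition c c') (at x)"

definition sqnorm :: "('m, 'n) chart \<Rightarrow> 'm \<Rightarrow> real^'n \<Rightarrow> real" where
  "sqnorm c p v = v \<bullet> (g c p *v v)"

lemma atlas: "smooth_atlas \<A>"
  using rm by (simp add: riemannian_manifold_def)

lemma chart_cover: "\<exists>c\<in>\<A>. p \<in> fst c"
  using atlas unfolding smooth_atlas_def by blast

lemma open_chart: "c \<in> \<A> \<Longrightarrow> open (fst c)"
  using atlas unfolding smooth_atlas_def by blast

lemma open_chart_image: "c \<in> \<A> \<Longrightarrow> open (snd c ` fst c)"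
  using atlas unfolding smooth_atlas_def by blast

lemma chart_homeo: "c \<in> \<A> \<Longrightarrow> homeomorphism (fst c) (snd c ` fst c) (snd c) (chart_inv c)"
  using atlas unfolding smooth_atlas_def by blast

lemma chart_inv_snd [simp]: "c \<in> \<A> \<Longrightarrow> p \<in> fst c \<Longrightarrow> chart_inv c (snd c p) = p"
  using chart_homeo by (auto simp: homeomorphism_def)

lemma snd_chart_inv [simp]: "c \<in> \<A> \<Longrightarrow> x \<in> snd c ` fst c \<Longrightarrow> snd c (chart_inv c x) = x"
  using chart_homeo by (auto simp: homeomorphism_def)

lemma chart_inv_in: "c \<in> \<A> \<Longrightarrow> x \<in> snd c ` fst c \<Longrightarrow> chart_inv c x \<in> fst c"
  by auto

lemma continuous_chart: "c \<in> \<A> \<Longrightarrow> continuous_on (fst c) (snd c)"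
  using chart_homeo by (auto simp: homeomorphism_def)

lemma continuous_chart_inv: "c \<in> \<A> \<Longrightarrow> continuous_on (snd c ` fst c) (chart_inv c)"
  using chart_homeo by (auto simp: homeomorphism_def)

lemma inj_on_chart: "c \<in> \<A> \<Longrightarrow> inj_on (snd c) (fst c)"
  by (metis chart_inv_snd inj_onI)

lemma open_chart_subimage:
  assumes c: "c \<in> \<A>" and "open U" "U \<subseteq> fst c"
  shows "open (snd c ` U)"
proof -
  have "snd c ` U = (snd c ` fst c) \<inter> chart_inv c -` U"
    using assms by force
  moreover have "open ((snd c ` fst c) \<inter> chart_inv c -` U)"
    using continuous_on_open_vimage[OF open_chart_image[OF c]] continuous_chart_inv[OF c] \<open>open U\<close>
    by (metis Int_commute)
  ultimately show ?thesis by simp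
qed

lemma open_chart_preimage:
  assumes c: "c \<in> \<A>" and "open U"
  shows "open (fst c \<inter> snd c -` U)"
  using continuous_on_open_vimage[OF open_chart[OF c]] continuous_chart[OF c] \<open>open U\<close>
  by (metis Int_commute)

lemma smooth_transition:
  "c \<in> \<A> \<Longrightarrow> c' \<in> \<A> \<Longrightarrow> smooth_on (snd c ` (fst c \<inter> fst c')) (transition c c')"
  using atlas unfolding smooth_atlas_def by blast

lemma transition_has_derivative:
  assumes "c \<in> \<A>" "c' \<in> \<A>" "x \<in> snd c ` (fst c \<inter> fst c')"
  shows "(transition c c' has_derivative dtransition c c' x) (at x)"
proof -
  have "Ck_on (Suc 0) (transition c c') (snd c ` (fst c \<inter> fst c'))"
    using smooth_transition assms unfolding smooth_on_def by blast
  then have "transition c c' differentiable (at x)"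
    using assms(3) by auto
  then show ?thesis
    by (rule frechet_derivative_works[THEN iffD1])
qed

lemma continuous_dtransition:
  assumes "c \<in> \<A>" "c' \<in> \<A>"
  shows "continuous_on (snd c ` (fst c \<inter> fst c')) (\<lambda>x. dtransition c c' x v)"
proof -
  have "Ck_on (Suc 0) (transition c c') (snd c ` (fst c \<inter> fst c'))"
    using smooth_transition assms unfolding smooth_on_def by blast
  then show ?thesis
    by simp
qed

lemma linear_dtransition:
  assumes "c \<in> \<A>" "c' \<in> \<A>" "x \<in> snd c ` (fst c \<inter> fst c')"
  shows "linear (dtransition c c' x)"
  using transition_has_derivative[OF assms] by (rule has_derivative_linear)

lemma gram_pos: "c \<in> \<A> \<Longrightarrow> p \<in> fst c \<Longrightarrow> v \<noteq> 0 \<Longrightarrow> v \<bullet> (g c p *v v) > 0"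
  using rm unfolding riemannian_manifold_def by blast

lemma continuous_gram:
  assumes "c \<in> \<A>"
  shows "continuous_on (snd c ` fst c) (\<lambda>x. g c (chart_inv c x))"
proof -
  have "smooth_on (snd c ` fst c) (g c \<circ> chart_inv c)"
    using rm assms unfolding riemannian_manifold_def by blast
  then have "Ck_on 0 (g c \<circ> chart_inv c) (snd c ` fst c)"
    unfolding smooth_on_def by blast
  then show ?thesis
    by (simp add: o_def)
qed

lemma gram_transform:
  assumes "c \<in> \<A>" "c' \<in> \<A>" "p \<in> fst c" "p \<in> fst c'"
  shows "v \<bullet> (g c p *v w) =
    dtransition c c' (snd c p) v \<bullet> (g c' p *v dtransition c c' (snd c p) w)"
  using rm assms unfolding riemannian_manifold_def Let_def by blast

lemma sqnorm_transform:
  assumes "c \<in> \<A>" "c' \<in> \<A>" "p \<in> fst c" "p \<in> fst c'"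
  shows "sqnorm c p v = sqnorm c' p (dtransition c c' (snd c p) v)"
  unfolding sqnorm_def by (rule gram_transform[OF assms])

lemma sqnorm_nonneg: "c \<in> \<A> \<Longrightarrow> p \<in> fst c \<Longrightarrow> 0 \<le> sqnorm c p v"
  using gram_pos[of c p v] unfolding sqnorm_def by (cases "v = 0") auto

lemma sqnorm_pos: "c \<in> \<A> \<Longrightarrow> p \<in> fst c \<Longrightarrow> v \<noteq> 0 \<Longrightarrow> 0 < sqnorm c p v"
  using gram_pos[of c p v] unfolding sqnorm_def by auto

lemma sqnorm_scaleR: "sqnorm c p (r *\<^sub>R v) = r\<^sup>2 * sqnorm c p v"
  by (simp add: sqnorm_def power2_eq_square matrix_vector_mult_scaleR)

text \<open>Both sides are homogeneous of degree 1 in v, so it suffices to consider unit vectors. On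
  the compact product of K with the unit sphere the quadratic form is continuous and positive, hence
  bounded above and away from 0.\<close>

lemma sqnorm_bounds:
  assumes c: "c \<in> \<A>" and K: "compact K" "K \<subseteq> snd c ` fst c"
  obtains C where "C > 0"
    "\<And>x v. x \<in> K \<Longrightarrow> sqrt (sqnorm c (chart_inv c x) v) \<le> C * norm v"
    "\<And>x v. x \<in> K \<Longrightarrow> norm v \<le> C * sqrt (sqnorm c (chart_inv c x) v)"
proof (cases "K = {}")
  case True
  then show ?thesis using that[of 1] by simp
next
  case False
  let ?q = "\<lambda>z. sqnorm c (chart_inv c (fst z)) (snd z)"
  let ?S = "K \<times> sphere (0::real^'n) 1"
  have comp: "compact ?S"
    using K by (intro compact_Times compact_sphere)
  have ne: "?S \<noteq> {}"
    using False by (auto intro!: exI[of _ "axis undefined 1"])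
  have cont: "continuous_on ?S ?q"
  proof -
    have "continuous_on ?S (\<lambda>z. g c (chart_inv c (fst z)))"
      by (rule continuous_on_compose2[OF continuous_gram[OF c] continuous_on_fst[OF continuous_on_id]])
         (use K in auto)
    then show ?thesis
      unfolding sqnorm_def matrix_vector_mult_def by (intro continuous_intros)
  qed
  obtain z0 where z0: "z0 \<in> ?S" "\<And>z. z \<in> ?S \<Longrightarrow> ?q z0 \<le> ?q z"
    using continuous_attains_inf[OF comp ne cont] by blast
  obtain z1 where z1: "z1 \<in> ?S" "\<And>z. z \<in> ?S \<Longrightarrow> ?q z \<le> ?q z1"
    using continuous_attains_sup[OF comp ne cont] by blast
  have m: "?q z0 > 0"
    using z0(1) K by (intro sqnorm_pos[OF c]) (auto intro!: chart_inv_in[OF c])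
  have qle: "?q z0 \<le> ?q z1"
    using z0 z1 by blast
  define C where "C = max (sqrt (?q z1)) (1 / sqrt (?q z0))"
  have C: "C > 0" "sqrt (?q z1) \<le> C" "1 / sqrt (?q z0) \<le> C"
    using m qle by (auto simp: C_def less_max_iff_disj)
  have scale: "sqrt (sqnorm c (chart_inv c x) v) = norm v * sqrt (?q (x, v /\<^sub>R norm v))" for x v
    by (cases "v = 0") (simp_all add: sqnorm_scaleR real_sqrt_mult sqnorm_def[of c "chart_inv c x" 0] power_inverse real_sqrt_divide field_simps)
  have in_S: "(x, v /\<^sub>R norm v) \<in> ?S" if "x \<in> K" "v \<noteq> 0" for x v
    using that by simp
  show ?thesis
  proof (rule that[OF C(1)])
    fix x and v :: "real^'n" assume x: "x \<in> K"
    show "sqrt (sqnorm c (chart_inv c x) v) \<le> C * norm v"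
    proof (cases "v = 0")
      case False
      then have "sqrt (?q (x, v /\<^sub>R norm v)) \<le> C"
        using z1(2)[OF in_S[OF x False]] C(2) by (meson order_trans real_sqrt_le_mono)
      then show ?thesis
        by (subst scale, subst mult.commute, intro mult_right_mono) auto
    qed (simp add: sqnorm_def)
    show "norm v \<le> C * sqrt (sqnorm c (chart_inv c x) v)"
    proof (cases "v = 0")
      case False
      have "sqrt (?q z0) \<le> sqrt (?q (x, v /\<^sub>R norm v))"
        using z0(2)[OF in_S[OF x False]] by simp
      then have "1 \<le> C * sqrt (?q (x, v /\<^sub>R norm v))"
        using C m by (smt (verit) divide_le_eq mult_left_mono mult.commute real_sqrt_gt_zero)
      then have "norm v * 1 \<le> norm v * (C * sqrt (?q (x, v /\<^sub>R norm v)))"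
        by (intro mult_left_mono) auto
      then show ?thesis
        by (subst scale) (simp add: mult_ac)
    qed (use C(1) in \<open>simp add: sqnorm_def\<close>)
  qed
qed

section \<open>The volume density and its independence of the chart\<close>

definition vol_density :: "('m, 'n) chart \<Rightarrow> real^'n \<Rightarrow> real" where
  "vol_density c x = sqrt (det (g c (chart_inv c x)))"

definition chart_measure :: "('m, 'n) chart \<Rightarrow> 'm set \<Rightarrow> ennreal" where
  "chart_measure c A = (\<integral>\<^sup>+x\<in>snd c ` A. ennreal (vol_density c x) \<partial>lborel)"

lemma vol_density_pos: "c \<in> \<A> \<Longrightarrow> x \<in> snd c ` fst c \<Longrightarrow> vol_density c x > 0"
  unfolding vol_density_def using gram_pos[of c "chart_inv c x"] chart_inv_in[of c x]
  by (simp add: pos_def_imp_det_pos)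

lemma continuous_vol_density:
  assumes "c \<in> \<A>"
  shows "continuous_on (snd c ` fst c) (vol_density c)"
  unfolding vol_density_def det_def
  by (intro continuous_intros continuous_gram[OF assms])

lemma borel_chart_image:
  assumes c: "c \<in> \<A>" and A: "A \<in> sets borel" "A \<subseteq> fst c"
  shows "snd c ` A \<in> sets borel"
proof -
  let ?V = "snd c ` fst c"
  have "chart_inv c -` A \<inter> ?V \<in> sets (restrict_space borel ?V)"
    using measurable_sets[OF borel_measurable_continuous_on_restrict[OF continuous_chart_inv[OF c]] A(1)]
    by (simp add: space_restrict_space)
  moreover have "?V \<in> sets borel"
    using open_chart_image[OF c] by simp
  moreover have "snd c ` A = chart_inv c -` A \<inter> ?V"
    using A(2) c by force
  ultimately show ?thesis
    by (simp add: sets_restrict_space_iff)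
qed

text \<open>The tensor rule says that the Gram matrices are congruent through the Jacobian matrix,
  so their determinants differ by its squared determinant, and the root turns the square into an
  absolute value.\<close>

lemma vol_density_transform:
  assumes c: "c \<in> \<A>" and c': "c' \<in> \<A>" and x: "x \<in> snd c ` (fst c \<inter> fst c')"
  shows "vol_density c x = \<bar>det (matrix (dtransition c c' x))\<bar> * vol_density c' (transition c c' x)"
proof -
  obtain p where p: "p \<in> fst c" "p \<in> fst c'" "x = snd c p"
    using x by auto
  let ?D = "matrix (dtransition c c' x)"
  have D: "dtransition c c' x v = ?D *v v" for v
    using linear_dtransition[OF c c' x] by (simp add: matrix_works)
  have adj: "v \<bullet> (transpose ?D *v z) = (?D *v v) \<bullet> z" for v z
    by (metis dot_lmul_matrix inner_commute transpose_matrix_vector)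
  have "v \<bullet> (g c p *v w) = v \<bullet> ((transpose ?D ** g c' p ** ?D) *v w)" for v w
    using gram_transform[OF c c' p(1,2), of v w, folded p(3)]
    by (simp only: D matrix_vector_mul_assoc[symmetric] adj)
  then have "g c p *v w = (transpose ?D ** g c' p ** ?D) *v w" for w
    by (metis vector_eq_ldot)
  then have "g c p = transpose ?D ** g c' p ** ?D"
    by (simp add: matrix_eq)
  then have "det (g c p) = (det ?D)\<^sup>2 * det (g c' p)"
    by (simp add: det_mul det_transpose power2_eq_square)
  then show ?thesis
    using p c c' by (simp add: vol_density_def real_sqrt_mult)
qed

text \<open>This is the change of variables along the transition map; its Jacobian factor is exactly
  the one by which the two densities differ.\<close>

lemma chart_measure_unique:
  assumes c: "c \<in> \<A>" and c': "c' \<in> \<A>" and A: "A \<in> sets borel" "A \<subseteq> fst c" "A \<subseteq> fst c'"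
  shows "chart_measure c' A = chart_measure c A"
proof -
  let ?W = "snd c ` (fst c \<inter> fst c')" and ?T = "transition c c'"
  have oW: "open ?W"
    using open_chart_subimage[OF c, of "fst c \<inter> fst c'"] open_chart c c' by blast
  have AW: "snd c ` A \<subseteq> ?W"
    using A by auto
  have bA: "snd c ` A \<in> sets borel"
    using borel_chart_image c A by blast
  have bA': "snd c' ` A \<in> sets borel"
    using borel_chart_image c' A by blast
  have TW: "?T ` snd c ` A = snd c' ` A"
    using A c by force
  have contT: "continuous_on ?W ?T"
    by (rule has_derivative_continuous_on[where f' = "dtransition c c'"])
       (rule has_derivative_at_withinI[OF transition_has_derivative[OF c c']])
  have inj: "inj_on ?T ?W"
    using inj_on_chart[OF c'] c by (auto simp: inj_on_def)
  \<comment> \<open>Direct images of Borel sets need not be Borel in general. Here the set is lifted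
    to the manifold as a preimage under the first chart, and the second chart maps it to a preimage
    under its continuous inverse.\<close>
  have TB: "?T ` B \<in> sets borel" if B: "B \<in> sets borel" "B \<subseteq> snd c ` A" for B
  proof -
    have "chart_inv c ` B = chart_inv c ` B \<inter> fst c"
      using B AW c by force
    have "(\<lambda>p. if p \<in> fst c then snd c p else 0) \<in> borel_measurable borel"
      by (intro borel_measurable_continuous_on_if open_chart[OF c] borel_open continuous_chart[OF c]) auto
    from measurable_sets[OF this B(1)]
    have "(\<lambda>p. if p \<in> fst c then snd c p else 0) -` B \<in> sets borel"
      by simp
    then have "(\<lambda>p. if p \<in> fst c then snd c p else 0) -` B \<inter> A \<in> sets borel"
      using A(1) by blast
    moreover have "chart_inv c ` B = (\<lambda>p. if p \<in> fst c then snd c p else 0) -` B \<inter> A"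
    proof
      show "chart_inv c ` B \<subseteq> (\<lambda>p. if p \<in> fst c then snd c p else 0) -` B \<inter> A"
        using B(2) A c by (force simp: subset_iff)
      show "(\<lambda>p. if p \<in> fst c then snd c p else 0) -` B \<inter> A \<subseteq> chart_inv c ` B"
        using A(2) c by (force simp: image_iff subset_iff)
    qed
    ultimately have "chart_inv c ` B \<in> sets borel"
      by simp
    moreover have "chart_inv c ` B \<subseteq> fst c'"
      using B(2) A c by force
    ultimately have "snd c' ` chart_inv c ` B \<in> sets borel"
      using borel_chart_image[OF c'] by blast
    then show ?thesis
      by (simp add: image_comp)
  qed
  have contD: "continuous_on ?W (\<lambda>x. \<bar>det (matrix (dtransition c c' x))\<bar>)"
    unfolding det_def matrix_def
    by (simp, intro continuous_intros continuous_dtransition[OF c c'])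
  have "(\<lambda>x. if x \<in> ?W then \<bar>det (matrix (dtransition c c' x))\<bar> else 0) \<in> borel_measurable borel"
    by (intro borel_measurable_continuous_on_if contD) (use oW in auto)
  moreover have "(\<lambda>x. indicator (snd c ` A) x * \<bar>det (matrix (dtransition c c' x))\<bar> :: real)
      = (\<lambda>x. indicator (snd c ` A) x * (if x \<in> ?W then \<bar>det (matrix (dtransition c c' x))\<bar> else 0))"
    using AW by (auto simp: fun_eq_iff indicator_def)
  ultimately have meas: "(\<lambda>x. indicator (snd c ` A) x * \<bar>det (matrix (dtransition c c' x))\<bar> :: real)
      \<in> borel_measurable borel"
    using bA by simp
  have "(\<lambda>x. if x \<in> snd c ` A then ?T x else 0) \<in> borel_measurable borel"
    using continuous_on_subset[OF contT AW] bA by (intro borel_measurable_continuous_on_if) auto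
  let ?f = "\<lambda>y. ennreal (if y \<in> snd c' ` fst c' then vol_density c' y else 0)"
  have f: "?f \<in> borel_measurable borel"
    by (intro measurable_compose[OF _ measurable_ennreal] borel_measurable_continuous_on_if
        continuous_vol_density[OF c']) (use open_chart_image[OF c'] in auto)
  have "chart_measure c' A = (\<integral>\<^sup>+y\<in>?T ` snd c ` A. ?f y \<partial>lborel)"
    unfolding chart_measure_def TW using A by (intro nn_integral_cong) (auto simp: indicator_def)
  also have "\<dots> = (\<integral>\<^sup>+x\<in>snd c ` A. ennreal \<bar>det (matrix (dtransition c c' x))\<bar> * ?f (?T x) \<partial>lborel)"
  proof (rule nn_integral_differentiable_image[OF bA TB _ _ meas _ f])
    show "(?T has_derivative dtransition c c' x) (at x)" if "x \<in> snd c ` A" for x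
      using transition_has_derivative[OF c c'] that AW by blast
    show "inj_on ?T (snd c ` A)"
      using inj AW by (rule inj_on_subset)
  qed (assumption | fact)+
  also have "\<dots> = chart_measure c A"
    unfolding chart_measure_def
  proof (intro nn_integral_cong)
    fix x
    show "ennreal \<bar>det (matrix (dtransition c c' x))\<bar> * ?f (?T x) * indicator (snd c ` A) x
        = ennreal (vol_density c x) * indicator (snd c ` A) x"
    proof (cases "x \<in> snd c ` A")
      case True
      then have "?T x \<in> snd c' ` fst c'"
        using A c by (force simp: subset_iff)
      then show ?thesis
        using vol_density_transform[OF c c', of x] AW True by (auto simp: ennreal_mult'[symmetric])
    qed simp
  qed
  finally show ?thesis .
qed

end

section \<open>Existence, uniqueness and size of the measure on a compact manifold\<close>

lemma compact_UNIV_finite_subcover: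
  assumes comp: "compact (UNIV :: 'a::topological_space set)"
    and "\<And>p. open (U p)" "\<And>p. p \<in> U p"
  shows "\<exists>T. finite T \<and> (\<Union>p\<in>T. U p) = (UNIV :: 'a set)"
proof -
  obtain T where "T \<subseteq> UNIV" "finite T" "UNIV \<subseteq> (\<Union>p\<in>T. U p)"
    by (rule compactE_image[OF comp, of UNIV U]) (use assms in auto)
  then show ?thesis by blast
qed

context riemannian
begin

text \<open>The density is restricted to the coordinates of B and pushed forward along the inverse
  chart. The purpose is additivity: \<open>chart_measure\<close> is a plain set function, and this
  exhibits it as a measure.\<close>

lemma ex_chart_measure:
  assumes c: "c \<in> \<A>" and B: "B \<in> sets borel" "B \<subseteq> fst c"
  shows "\<exists>M. sets M = sets borel \<and> (\<forall>A\<in>sets borel. emeasure M A = chart_measure c (A \<inter> B))"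
proof (intro exI conjI ballI)
  let ?V = "snd c ` fst c"
  let ?w = "\<lambda>x. ennreal (if x \<in> ?V then vol_density c x else 0) * indicator (snd c ` B) x"
  \<comment> \<open>The value outside the coordinate image does not matter, because the density
    \<open>?w\<close> vanishes there.\<close>
  let ?h = "\<lambda>x. if x \<in> ?V then chart_inv c x else undefined"
  let ?M = "distr (density lborel ?w) borel ?h"
  have V: "?V \<in> sets borel"
    using open_chart_image[OF c] by simp
  have h[measurable]: "?h \<in> borel_measurable borel"
    by (intro borel_measurable_continuous_on_if V continuous_chart_inv[OF c]) simp
  have w0: "(\<lambda>x. if x \<in> ?V then vol_density c x else 0) \<in> borel_measurable borel"
    by (intro borel_measurable_continuous_on_if V continuous_vol_density[OF c]) simp
  have w[measurable]: "?w \<in> borel_measurable borel"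
    using borel_chart_image[OF c B] w0 by measurable
  show "sets ?M = sets borel"
    by simp
  fix A :: "'m set" assume A: "A \<in> sets borel"
  have hA: "?h -` A \<in> sets borel"
    using measurable_sets[OF h A] by simp
  have "emeasure ?M A = emeasure (density lborel ?w) (?h -` A)"
    using A by (subst emeasure_distr) simp_all
  also have "\<dots> = (\<integral>\<^sup>+x\<in>?h -` A. ?w x \<partial>lborel)"
    using hA by (subst emeasure_density) simp_all
  also have "\<dots> = chart_measure c (A \<inter> B)"
    unfolding chart_measure_def
  proof (intro nn_integral_cong)
    fix x
    show "?w x * indicator (?h -` A) x = ennreal (vol_density c x) * indicator (snd c ` (A \<inter> B)) x"
    proof (cases "x \<in> ?V")
      case True
      then obtain p where p: "p \<in> fst c" "x = snd c p" by blast
      have "snd c p \<in> snd c ` D \<longleftrightarrow> p \<in> D" if "D \<subseteq> fst c" for D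
        using inj_on_image_mem_iff[OF inj_on_chart[OF c] p(1) that] .
      then have "x \<in> snd c ` B \<longleftrightarrow> p \<in> B" "x \<in> snd c ` (A \<inter> B) \<longleftrightarrow> p \<in> A \<and> p \<in> B"
        using B(2) p(2) by (auto simp: le_infI2)
      moreover have "?h x = p"
        using p c by simp
      ultimately show ?thesis
        using True by (auto simp: indicator_def)
    next
      case False
      then have "x \<notin> snd c ` B" "x \<notin> snd c ` (A \<inter> B)"
        using B(2) by auto
      then show ?thesis
        by simp
    qed
  qed
  finally show "emeasure ?M A = chart_measure c (A \<inter> B)" .
qed

definition is_riemannian_measure :: "'m measure \<Rightarrow> bool" where
  "is_riemannian_measure \<nu> \<longleftrightarrow> sets \<nu> = sets borel \<and>
     (\<forall>c\<in>\<A>. \<forall>A\<in>sets borel. A \<subseteq> fst c \<longrightarrow> emeasure \<nu> A = chart_measure c A)"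

text \<open>Compactness leaves finitely many charts, whose domains are cut into a finite Borel
  partition. The chart measures of the pieces add up to a measure, invariance under chart change
  gives the right values in every other chart, and any competitor agrees with it piece by
  piece.\<close>

lemma ex1_riemannian_measure:
  assumes comp: "compact (UNIV :: 'm set)"
  shows "\<exists>!\<nu>. is_riemannian_measure \<nu>"
proof -
  obtain ch where ch: "\<And>p. ch p \<in> \<A>" "\<And>p. p \<in> fst (ch p)"
    using chart_cover by metis
  obtain T where T: "finite T" "(\<Union>p\<in>T. fst (ch p)) = UNIV"
    using compact_UNIV_finite_subcover[OF comp, of "\<lambda>p. fst (ch p)", OF open_chart[OF ch(1)] ch(2)]
    by auto
  define CC where "CC = ch ` T"
  have CC: "CC \<subseteq> \<A>" "finite CC" "(\<Union>c\<in>CC. fst c) = UNIV"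
    using ch T by (auto simp: CC_def)
  obtain cs k where cs: "CC = cs ` {i::nat. i < k}"
    using finite_imp_nat_seg_image_inj_on[OF CC(2)] by auto
  have csA: "cs i \<in> \<A>" if "i < k" for i
    using CC cs that by auto
  \<comment> \<open>\<open>disjointed\<close> acts on infinite sequences, so the list of k charts is
    continued by empty sets.\<close>
  define B where "B = disjointed (\<lambda>i. if i < k then fst (cs i) else {})"
  have Bsub: "B i \<subseteq> fst (cs i)" if "i < k" for i
    using disjointed_subset[of "\<lambda>i. if i < k then fst (cs i) else {}" i] that by (simp add: B_def)
  have Bborel: "B i \<in> sets borel" if "i < k" for i
    unfolding B_def disjointed_def using that open_chart csA by auto
  have disj: "disjoint_family B"
    unfolding B_def by (rule disjoint_family_disjointed)
  have "(\<Union>i\<in>{0..<k}. B i) = (\<Union>i\<in>{0..<k}. if i < k then fst (cs i) else {})"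
    unfolding B_def by (rule finite_UN_disjointed_eq)
  also have "\<dots> = UNIV"
    using CC(3) cs by force
  finally have Bcov: "(\<Union>i<k. B i) = UNIV"
    by (simp add: lessThan_atLeast0)
  have split: "emeasure \<nu> A = (\<Sum>i<k. emeasure \<nu> (A \<inter> B i))"
    if "sets \<nu> = sets borel" "A \<in> sets borel" for \<nu> A
  proof -
    have "(\<Sum>i<k. emeasure \<nu> (A \<inter> B i)) = emeasure \<nu> (\<Union>i<k. A \<inter> B i)"
    proof (rule sum_emeasure)
      show "(\<lambda>i. A \<inter> B i) ` {..<k} \<subseteq> sets \<nu>"
        using that Bborel by auto
      show "disjoint_family_on (\<lambda>i. A \<inter> B i) {..<k}"
        using disj unfolding disjoint_family_on_def by blast
    qed simp
    also have "(\<Union>i<k. A \<inter> B i) = A"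
      using Bcov by blast
    finally show ?thesis ..
  qed
  have "\<forall>i. \<exists>M. i < k \<longrightarrow> sets M = sets borel \<and>
      (\<forall>A\<in>sets borel. emeasure M A = chart_measure (cs i) (A \<inter> B i))"
    using ex_chart_measure[OF csA Bborel Bsub] by meson
  then obtain M where M: "\<And>i. i < k \<Longrightarrow> sets (M i) = sets borel"
      "\<And>i A. i < k \<Longrightarrow> A \<in> sets borel \<Longrightarrow> emeasure (M i) A = chart_measure (cs i) (A \<inter> B i)"
    by metis
  obtain \<nu> where \<nu>: "sets \<nu> = sets (borel :: 'm measure)"
      "\<And>A. A \<in> sets borel \<Longrightarrow> emeasure \<nu> A = (\<Sum>i<k. emeasure (M i) A)"
    using ex_sum_measure[of "{..<k}" M] M(1) by auto
  have single: "emeasure \<nu> A = chart_measure c A"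
    if c: "c \<in> \<A>" and A: "A \<in> sets borel" "A \<subseteq> fst c" for c A
  proof -
    \<comment> \<open>An auxiliary measure for the chart c, needed to add up
      \<open>chart_measure c\<close> over the pieces of A.\<close>
    obtain M' where M': "sets M' = sets borel"
        "\<And>D. D \<in> sets borel \<Longrightarrow> emeasure M' D = chart_measure c (D \<inter> A)"
      using ex_chart_measure[OF c A] by blast
    have "emeasure \<nu> A = (\<Sum>i<k. chart_measure (cs i) (A \<inter> B i))"
      using \<nu>(2)[OF A(1)] M(2) A(1) by simp
    also have "\<dots> = (\<Sum>i<k. chart_measure c (A \<inter> B i))"
    proof (rule sum.cong[OF refl])
      fix i assume "i \<in> {..<k}"
      then show "chart_measure (cs i) (A \<inter> B i) = chart_measure c (A \<inter> B i)"
        using A Bborel[of i] Bsub[of i] csA[of i] by (intro chart_measure_unique c) auto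
    qed
    also have "\<dots> = (\<Sum>i<k. emeasure M' (A \<inter> B i))"
      using M'(2) A(1) Bborel by (intro sum.cong) (auto simp: Int_commute)
    also have "\<dots> = emeasure M' A"
      using split[OF M'(1) A(1)] by simp
    also have "\<dots> = chart_measure c A"
      using M'(2)[OF A(1)] by simp
    finally show ?thesis .
  qed
  show ?thesis
  proof (rule ex1I)
    show "is_riemannian_measure \<nu>"
      unfolding is_riemannian_measure_def using \<nu>(1) single by blast
    fix \<mu> assume \<mu>: "is_riemannian_measure \<mu>"
    show "\<mu> = \<nu>"
    proof (rule measure_eqI)
      show "sets \<mu> = sets \<nu>"
        using \<mu> \<nu>(1) by (simp add: is_riemannian_measure_def)
      fix A assume "A \<in> sets \<mu>"
      then have A: "A \<in> sets borel"
        using \<mu> by (simp add: is_riemannian_measure_def)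
      have "emeasure \<mu> (A \<inter> B i) = emeasure \<nu> (A \<inter> B i)" if "i < k" for i
      proof -
        have "A \<inter> B i \<in> sets borel" "A \<inter> B i \<subseteq> fst (cs i)"
          using A Bborel[OF that] Bsub[OF that] by auto
        then show ?thesis
          using \<mu> single csA[OF that] by (simp add: is_riemannian_measure_def)
      qed
      then show "emeasure \<mu> A = emeasure \<nu> A"
        using split[of \<mu> A] split[of \<nu> A] A \<mu> \<nu>(1) by (simp add: is_riemannian_measure_def)
    qed
  qed
qed

abbreviation "\<nu> \<equiv> riemannian_measure \<A> g"

lemma riemannian_measure:
  assumes comp: "compact (UNIV :: 'm set)"
  shows "is_riemannian_measure \<nu>"
proof -
  have "\<nu> = (THE \<nu>. is_riemannian_measure \<nu>)"
    unfolding riemannian_measure_def is_riemannian_measure_def chart_measure_def vol_density_def ..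
  then show ?thesis
    using theI'[OF ex1_riemannian_measure[OF comp]] by simp
qed

lemma sets_riemannian_measure:
  "compact (UNIV :: 'm set) \<Longrightarrow> sets \<nu> = sets borel"
  using riemannian_measure by (simp add: is_riemannian_measure_def)

text \<open>Near p the density is at most some C on a closed coordinate ball, so a concentric ball
  of radius r has measure at most C times its Euclidean volume, which tends to 0 with r.\<close>

lemma small_nbhd:
  assumes comp: "compact (UNIV :: 'm set)" and \<epsilon>: "\<epsilon> > 0"
  shows "\<exists>U. open U \<and> p \<in> U \<and> emeasure \<nu> U \<le> ennreal \<epsilon>"
proof -
  obtain c where c: "c \<in> \<A>" "p \<in> fst c"
    using chart_cover by blast
  obtain r0 where r0: "r0 > 0" "cball (snd c p) r0 \<subseteq> snd c ` fst c"
    using open_contains_cball[of "snd c ` fst c"] open_chart_image[OF c(1)] c(2) by blast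
  have "continuous_on (cball (snd c p) r0) (vol_density c)"
    by (rule continuous_on_subset[OF continuous_vol_density[OF c(1)] r0(2)])
  then have "bounded (vol_density c ` cball (snd c p) r0)"
    by (intro compact_imp_bounded compact_continuous_image compact_cball)
  then obtain C where C: "C > 0" "\<And>x. x \<in> cball (snd c p) r0 \<Longrightarrow> vol_density c x \<le> C"
    unfolding bounded_pos by (auto simp: abs_le_iff)
  let ?n = "DIM(real^'n)"
  let ?m = "\<lambda>r. C * (unit_ball_vol (real ?n) * r ^ ?n)"
  have lim: "((\<lambda>r. ?m r) \<longlongrightarrow> ?m 0) (at_right 0)"
    by (intro tendsto_intros)
  \<comment> \<open>The power of r vanishes at 0 because the dimension is at least 1.\<close>
  have "?m 0 < \<epsilon>"
    using \<epsilon> by (simp add: power_0_left)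
  with lim have "\<forall>\<^sub>F r in at_right 0. ?m r < \<epsilon>"
    by (rule order_tendstoD(2))
  moreover have "\<forall>\<^sub>F r in at_right 0. r \<in> {0<..<r0}"
    using eventually_at_right_real[OF r0(1)] .
  ultimately have "\<forall>\<^sub>F r in at_right 0. ?m r < \<epsilon> \<and> r \<in> {0<..<r0}"
    by (rule eventually_conj)
  then obtain r where r: "?m r < \<epsilon>" "0 < r" "r < r0"
    using eventually_happens'[OF trivial_limit_at_right_real] by fastforce
  let ?U = "fst c \<inter> snd c -` ball (snd c p) r"
  have oU: "open ?U"
    by (intro open_chart_preimage c open_ball)
  have im: "snd c ` ?U = ball (snd c p) r"
    using r r0(2) by (force simp: subset_iff)
  have "emeasure \<nu> ?U = chart_measure c ?U"
    using riemannian_measure[OF comp] oU c(1) unfolding is_riemannian_measure_def by auto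
  also have "\<dots> \<le> (\<integral>\<^sup>+x. ennreal C * indicator (ball (snd c p) r) x \<partial>lborel)"
    unfolding chart_measure_def im using C(2) r
    by (intro nn_integral_mono) (auto simp: indicator_def ennreal_leI)
  also have "\<dots> = ennreal C * emeasure lborel (ball (snd c p) r)"
    by (rule nn_integral_cmult_indicator) simp
  also have "\<dots> = ennreal (?m r)"
    using C(1) r by (simp add: emeasure_ball ennreal_mult')
  also have "\<dots> \<le> ennreal \<epsilon>"
    using r by (intro ennreal_leI) simp
  finally show ?thesis
    using oU c r by (intro exI[of _ ?U]) auto
qed

lemma riemannian_measure_finite:
  assumes comp: "compact (UNIV :: 'm set)"
  shows "emeasure \<nu> (space \<nu>) < \<infinity>"
proof -
  have sets: "sets \<nu> = sets borel"
    by (rule sets_riemannian_measure[OF comp])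
  have "\<forall>p. \<exists>U. open U \<and> p \<in> U \<and> emeasure \<nu> U \<le> ennreal 1"
    using small_nbhd[OF comp, of 1] by simp
  then obtain U where U: "\<And>p. open (U p)" "\<And>p. p \<in> U p" "\<And>p. emeasure \<nu> (U p) \<le> ennreal 1"
    by metis
  obtain T where T: "finite T" "(\<Union>p\<in>T. U p) = UNIV"
    using compact_UNIV_finite_subcover[OF comp, of U, OF U(1,2)] by auto
  have "emeasure \<nu> (space \<nu>) \<le> emeasure \<nu> (\<Union>p\<in>T. U p)"
    using T U(1) sets by (intro emeasure_mono) auto
  also have "\<dots> \<le> (\<Sum>p\<in>T. emeasure \<nu> (U p))"
    using T U(1) sets by (intro emeasure_subadditive_finite) auto
  also have "\<dots> \<le> (\<Sum>p\<in>T. ennreal 1)"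
    by (intro sum_mono U(3))
  also have "\<dots> < \<infinity>"
    by (simp add: ennreal_of_nat_eq_real_of_nat less_top[symmetric])
  finally show ?thesis .
qed

text \<open>A single chart suffices: the density is strictly positive on a nonempty open set of
  coordinates, and such a set is not negligible.\<close>

lemma riemannian_measure_pos:
  assumes comp: "compact (UNIV :: 'm set)"
  shows "emeasure \<nu> (space \<nu>) > 0"
proof -
  have sets: "sets \<nu> = sets borel"
    by (rule sets_riemannian_measure[OF comp])
  obtain c where c: "c \<in> \<A>" "undefined \<in> fst c"
    using chart_cover by blast
  let ?V = "snd c ` fst c"
  have V: "open ?V" "?V \<noteq> {}" "?V \<in> sets borel"
    using open_chart_image[OF c(1)] c(2) by auto
  have "emeasure \<nu> (fst c) = chart_measure c (fst c)"
    using riemannian_measure[OF comp] open_chart[OF c(1)] c(1)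
    unfolding is_riemannian_measure_def by auto
  also have "chart_measure c (fst c)
      = (\<integral>\<^sup>+x. ennreal (if x \<in> ?V then vol_density c x else 0) \<partial>lborel)"
    unfolding chart_measure_def by (intro nn_integral_cong) (auto simp: indicator_def)
  also have "\<dots> \<noteq> 0"
  proof
    assume "(\<integral>\<^sup>+x. ennreal (if x \<in> ?V then vol_density c x else 0) \<partial>lborel) = 0"
    moreover have "(\<lambda>x. if x \<in> ?V then vol_density c x else 0) \<in> borel_measurable borel"
      by (intro borel_measurable_continuous_on_if V continuous_vol_density[OF c(1)]) simp
    ultimately have "AE x in lborel. ennreal (if x \<in> ?V then vol_density c x else 0) = 0"
      by (subst (asm) nn_integral_0_iff_AE) auto
    then have "AE x in lborel. x \<notin> ?V"
      by eventually_elim (use vol_density_pos[OF c(1)] in \<open>auto simp: ennreal_eq_0_iff split: if_splits\<close>, force)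
    then have "?V \<in> null_sets lborel"
      using V by (simp add: AE_iff_null_sets)
    then show False
      using V open_not_negligible[OF V(1,2)] by (simp add: negligible_iff_null_sets null_sets_completionI)
  qed
  finally have "emeasure \<nu> (fst c) > 0"
    by (simp add: zero_less_iff_neq_zero)
  also have "emeasure \<nu> (fst c) \<le> emeasure \<nu> (space \<nu>)"
    using open_chart[OF c(1)] sets by (intro emeasure_space)
  finally show ?thesis .
qed

end

section \<open>Curves and functions of bounded gradient\<close>

text \<open>The derivative may be unbounded near the exceptional points, so it is only known to be
  gauge integrable, with integral F 1 - F 0. If its absolute value has infinite Lebesgue integral
  there is nothing to prove; otherwise the derivative is Lebesgue integrable, with the same
  integral.\<close>

lemma increment_le_nn_integral:
  fixes F w :: "real \<Rightarrow> real"
  assumes cont: "continuous_on {0..1} F" and K: "finite K"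
    and der: "\<And>t. t \<in> {0<..<1} - K \<Longrightarrow> \<exists>D. (F has_vector_derivative D) (at t) \<and> \<bar>D\<bar> \<le> w t"
  shows "ennreal \<bar>F 1 - F 0\<bar> \<le> (\<integral>\<^sup>+t\<in>{0..1}. ennreal (w t) \<partial>lborel)"
proof -
  define F' where "F' t = vector_derivative F (at t)" for t
  have F': "(F has_vector_derivative F' t) (at t)" "\<bar>F' t\<bar> \<le> w t" if t: "t \<in> {0<..<1} - K" for t
  proof -
    obtain D where "(F has_vector_derivative D) (at t)" "\<bar>D\<bar> \<le> w t"
      using der[OF t] by blast
    then show "(F has_vector_derivative F' t) (at t)" "\<bar>F' t\<bar> \<le> w t"
      unfolding F'_def by (simp_all add: vector_derivative_at)
  qed
  have int: "(F' has_integral (F 1 - F 0)) {0..1}"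
    by (rule fundamental_theorem_of_calculus_interior_strong[OF K _ _ cont]) (use F'(1) in auto)
  let ?k = "\<lambda>t. indicator {0..1} t *\<^sub>R F' t"
  have meas: "?k \<in> borel_measurable lebesgue"
    using has_integral_implies_lebesgue_measurable[OF int] .
  have le: "(\<integral>\<^sup>+t. ennreal (norm (?k t)) \<partial>lebesgue) \<le> (\<integral>\<^sup>+t\<in>{0..1}. ennreal (w t) \<partial>lborel)"
  proof -
    have "AE t in lborel. t \<notin> insert 0 (insert 1 K)"
      using K by (intro AE_not_in finite_imp_null_set_lborel) simp
    then have "AE t in lborel. ennreal (norm (?k t)) \<le> ennreal (w t) * indicator {0..1} t"
      by eventually_elim (use F'(2) in \<open>auto simp: indicator_def intro!: ennreal_leI\<close>)
    then show ?thesis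
      unfolding nn_integral_completion by (rule nn_integral_mono_AE)
  qed
  show ?thesis
  proof (cases "(\<integral>\<^sup>+t. ennreal (norm (?k t)) \<partial>lebesgue) = \<infinity>")
    case True
    then show ?thesis
      using le by (simp add: top_unique)
  next
    case False
    then have integ: "integrable lebesgue ?k"
      using meas by (simp add: integrable_iff_bounded less_top[symmetric])
    have "(?k has_integral (F 1 - F 0)) UNIV"
    proof -
      have "?k = (\<lambda>t. if t \<in> {0..1} then F' t else 0)"
        by (auto simp: fun_eq_iff)
      then show ?thesis
        using int by (simp only: has_integral_restrict_UNIV)
    qed
    then have eq: "F 1 - F 0 = (\<integral>t. ?k t \<partial>lebesgue)"
      using has_integral_integral_lebesgue[OF integ] has_integral_unique by blast
    have "ennreal \<bar>F 1 - F 0\<bar> \<le> (\<integral>\<^sup>+t. ennreal (norm (?k t)) \<partial>lebesgue)"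
      unfolding eq using integral_norm_bound_ennreal[OF integ] by simp
    then show ?thesis
      using le by (rule order_trans)
  qed
qed

text \<open>A chain rule in which the composition is identified only near t, as is natural for a
  curve that stays in a chart domain for a short time.\<close>

lemma has_vector_derivative_comp_local:
  assumes f: "(f has_vector_derivative v) (at t)" and k: "(k has_derivative k') (at (f t))"
    and ev: "\<forall>\<^sub>F s in nhds t. k (f s) = h s"
  shows "(h has_vector_derivative k' v) (at t)"
proof -
  have "((k \<circ> f) has_vector_derivative k' v) (at t)"
    by (rule vector_derivative_diff_chain_within[OF f has_derivative_at_withinI[OF k]])
  moreover have "\<forall>\<^sub>F s in nhds t. s \<in> UNIV \<longrightarrow> (k \<circ> f) s = h s"
    using ev by simp
  moreover have "(k \<circ> f) t = h t"
    using eventually_nhds_x_imp_x[OF ev] by simp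
  ultimately show ?thesis
    by (simp only: has_vector_derivative_cong_ev)
qed

section \<open>Velocity of curves in changing charts\<close>

context riemannian
begin

lemma curve_chart_change:
  assumes c: "c \<in> \<A>" "c' \<in> \<A>" and t: "\<gamma> t \<in> fst c" "\<gamma> t \<in> fst c'"
    and \<gamma>: "isCont \<gamma> t" and v: "((snd c \<circ> \<gamma>) has_vector_derivative v) (at t)"
  shows "((snd c' \<circ> \<gamma>) has_vector_derivative dtransition c c' (snd c (\<gamma> t)) v) (at t)"
proof -
  let ?x = "snd c (\<gamma> t)"
  have D: "(transition c c' has_derivative dtransition c c' ?x) (at ?x)"
    using c t by (intro transition_has_derivative) auto
  have "\<forall>\<^sub>F s in nhds t. \<gamma> s \<in> fst c"
    using \<gamma> open_chart[OF c(1)] t(1)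
    by (simp add: isCont_def eventually_nhds_conv_at topological_tendstoD)
  then have "\<forall>\<^sub>F s in nhds t. transition c c' ((snd c \<circ> \<gamma>) s) = (snd c' \<circ> \<gamma>) s"
    by eventually_elim (simp add: c)
  then show ?thesis
    using has_vector_derivative_comp_local[OF v, of "transition c c'"] D by simp
qed

lemma isCont_path: "path \<gamma> \<Longrightarrow> t \<in> {0<..<1} \<Longrightarrow> isCont \<gamma> t"
  unfolding path_def by (metis continuous_on_interior interior_atLeastAtMost_real)

text \<open>The definition of a curve speaks only of parameter intervals that are mapped into one
  chart, each with its own exceptional set. Compactness of the unit interval leaves finitely many of
  them, and smooth transition maps carry differentiability over to all other charts. The end points
  are included in K because \<open>isCont_path\<close> covers interior parameters only.\<close>

lemma curve_differentiable:
  assumes \<gamma>: "piecewise_C1_curve \<A> \<gamma>"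
  shows "\<exists>K. finite K \<and> 0 \<in> K \<and> 1 \<in> K \<and>
    (\<forall>t\<in>{0..1} - K. \<forall>c\<in>\<A>. \<gamma> t \<in> fst c \<longrightarrow> (snd c \<circ> \<gamma>) differentiable (at t))"
proof -
  have path: "path \<gamma>"
    using \<gamma> by (simp add: piecewise_C1_curve_def)
  have "\<exists>e K c. e > 0 \<and> finite K \<and> c \<in> \<A> \<and> (\<forall>t\<in>{0..1} - K. \<bar>t - s\<bar> < e \<longrightarrow>
      \<gamma> t \<in> fst c \<and> (snd c \<circ> \<gamma>) differentiable (at t))" if s: "s \<in> {0..1}" for s
  proof -
    obtain c where c: "c \<in> \<A>" "\<gamma> s \<in> fst c"
      using chart_cover by blast
    have "openin (top_of_set {0..1}) ({0..1} \<inter> \<gamma> -` fst c)"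
      using path open_chart[OF c(1)] unfolding path_def by (intro continuous_openin_preimage_gen)
    then obtain e where e: "e > 0" "\<And>t. t \<in> {0..1} \<Longrightarrow> dist t s < e \<Longrightarrow> \<gamma> t \<in> fst c"
      using s c(2) unfolding openin_euclidean_subtopology_iff by (metis IntD2 IntI vimage_eq)
    \<comment> \<open>Half of e keeps the closed interval inside the region where the curve lies in
      the chart, and clipping keeps it inside the parameter interval.\<close>
    define a where "a = max 0 (s - e / 2)"
    define b where "b = min 1 (s + e / 2)"
    have ab: "0 \<le> a" "a \<le> b" "b \<le> 1"
      using s e(1) by (auto simp: a_def b_def)
    have sub: "\<gamma> ` {a..b} \<subseteq> fst c"
      using e s by (force simp: a_def b_def dist_real_def abs_le_iff)
    have "(snd c \<circ> \<gamma>) piecewise_C1_differentiable_on {a..b}"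
      using \<gamma> c(1) ab sub unfolding piecewise_C1_curve_def by blast
    then obtain K where K: "finite K" "(snd c \<circ> \<gamma>) C1_differentiable_on ({a..b} - K)"
      unfolding piecewise_C1_differentiable_on_def by blast
    have d: "(snd c \<circ> \<gamma>) differentiable (at t)" if "t \<in> {a..b} - K" for t
      using K(2) that by (auto simp: C1_differentiable_on_eq)
    show ?thesis
    proof (intro exI conjI ballI impI)
      show "e / 2 > 0" "finite K" "c \<in> \<A>"
        using e K c by auto
      fix t assume "t \<in> {0..1} - K" "\<bar>t - s\<bar> < e / 2"
      then have "t \<in> {a..b} - K"
        unfolding a_def b_def by (auto simp: abs_if split: if_splits)
      then show "\<gamma> t \<in> fst c" "(snd c \<circ> \<gamma>) differentiable (at t)"
        using sub d by auto
    qed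
  qed
  then obtain e K c where
    e: "\<And>s. s \<in> {0..1} \<Longrightarrow> e s > (0::real)" and K: "\<And>s. s \<in> {0..1} \<Longrightarrow> finite (K s)"
    and c: "\<And>s. s \<in> {0..1} \<Longrightarrow> c s \<in> \<A>"
    and d: "\<And>s t. s \<in> {0..1} \<Longrightarrow> t \<in> {0..1} - K s \<Longrightarrow> \<bar>t - s\<bar> < e s \<Longrightarrow>
        \<gamma> t \<in> fst (c s) \<and> (snd (c s) \<circ> \<gamma>) differentiable (at t)"
    by metis
  obtain T where T: "T \<subseteq> {0..1}" "finite T" "{0..1} \<subseteq> (\<Union>s\<in>T. ball s (e s))"
  proof (rule compactE_image[of "{0..1::real}" "{0..1}" "\<lambda>s. ball s (e s)"])
    show "{0..1} \<subseteq> (\<Union>s\<in>{0..1}. ball s (e s))"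
      using e by force
  qed auto
  show ?thesis
  proof (intro exI conjI ballI impI)
    show "finite (insert 0 (insert 1 (\<Union>s\<in>T. K s)))"
      using T K by auto
    fix t c' assume t: "t \<in> {0..1} - insert 0 (insert 1 (\<Union>s\<in>T. K s))" and c': "c' \<in> \<A>" "\<gamma> t \<in> fst c'"
    obtain s where s: "s \<in> T" "\<bar>t - s\<bar> < e s"
      using T(3) t by (force simp: dist_real_def abs_minus_commute)
    have cs: "\<gamma> t \<in> fst (c s)" "(snd (c s) \<circ> \<gamma>) differentiable (at t)"
      using d[of s t] s t T(1) by auto
    have "isCont \<gamma> t"
      using t by (intro isCont_path path) auto
    then have "((snd c' \<circ> \<gamma>) has_vector_derivative
        dtransition (c s) c' (snd (c s) (\<gamma> t)) (vector_derivative (snd (c s) \<circ> \<gamma>) (at t))) (at t)"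
      using cs c' c s T(1) by (intro curve_chart_change) (auto simp: vector_derivative_works[symmetric])
    then show "(snd c' \<circ> \<gamma>) differentiable (at t)"
      by (rule differentiableI_vector)
  qed auto
qed

text \<open>\<open>speed\<close> is computed in a chart picked by \<open>SOME\<close>; the
  transformation rule of the metric tensor removes this choice.\<close>

lemma speed_eq:
  assumes c: "c \<in> \<A>" "\<gamma> t \<in> fst c" and \<gamma>: "isCont \<gamma> t"
    and v: "((snd c \<circ> \<gamma>) has_vector_derivative v) (at t)"
  shows "speed \<A> g \<gamma> t = sqrt (sqnorm c (\<gamma> t) v)"
proof -
  define c0 where "c0 = (SOME c. c \<in> \<A> \<and> \<gamma> t \<in> fst c)"
  have c0: "c0 \<in> \<A>" "\<gamma> t \<in> fst c0"
    using someI[of "\<lambda>c. c \<in> \<A> \<and> \<gamma> t \<in> fst c" c] c unfolding c0_def by auto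
  have "vector_derivative (snd c0 \<circ> \<gamma>) (at t) = dtransition c c0 (snd c (\<gamma> t)) v"
    using curve_chart_change[OF c(1) c0(1) c(2) c0(2) \<gamma> v] by (rule vector_derivative_at)
  then have "speed \<A> g \<gamma> t = sqrt (sqnorm c0 (\<gamma> t) (dtransition c c0 (snd c (\<gamma> t)) v))"
    unfolding speed_def Let_def c0_def[symmetric] sqnorm_def by simp
  then show ?thesis
    using sqnorm_transform[OF c(1) c0(1) c(2) c0(2)] by simp
qed

lemma speed_nonneg: "0 \<le> speed \<A> g \<gamma> t"
proof -
  define c0 where "c0 = (SOME c. c \<in> \<A> \<and> \<gamma> t \<in> fst c)"
  obtain c where "c \<in> \<A>" "\<gamma> t \<in> fst c"
    using chart_cover by blast
  then have c0: "c0 \<in> \<A>" "\<gamma> t \<in> fst c0"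
    using someI[of "\<lambda>c. c \<in> \<A> \<and> \<gamma> t \<in> fst c" c] unfolding c0_def by auto
  then show ?thesis
    unfolding speed_def Let_def c0_def[symmetric] sqnorm_def[symmetric]
    by (simp add: sqnorm_nonneg)
qed

text \<open>The bound on h' says that the dual norm of the differential is at most 1, which is the
  condition of Riemannian gradient at most 1 without inverting the metric tensor.\<close>

definition grad_le_1 :: "('m \<Rightarrow> real) \<Rightarrow> bool" where
  "grad_le_1 h \<longleftrightarrow> (\<forall>c\<in>\<A>. \<forall>p\<in>fst c. \<exists>h'. ((h \<circ> chart_inv c) has_derivative h') (at (snd c p)) \<and>
      (\<forall>v. \<bar>h' v\<bar> \<le> sqrt (sqnorm c p v)))"

text \<open>The bound on the values serves the cone: in the derivative of t * h(x) the function h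
  itself becomes the coefficient of dt.\<close>

definition test_functions :: "('m \<Rightarrow> real) set" where
  "test_functions = {h. grad_le_1 h \<and> (\<forall>p. \<bar>h p\<bar> \<le> 1)}"

lemma grad_le_1_continuous:
  assumes "grad_le_1 h"
  shows "continuous_on UNIV h"
proof (rule continuous_at_imp_continuous_on, rule ballI)
  fix p
  obtain c where c: "c \<in> \<A>" "p \<in> fst c"
    using chart_cover by blast
  have "isCont (h \<circ> chart_inv c) (snd c p)"
    using assms c unfolding grad_le_1_def by (metis has_derivative_continuous)
  moreover have "isCont (snd c) p"
    using continuous_chart[OF c(1)] open_chart[OF c(1)] c(2) by (simp add: continuous_on_eq_continuous_at)
  ultimately have "isCont (\<lambda>q. (h \<circ> chart_inv c) (snd c q)) p"
    by (intro isCont_o2[of p "snd c" "h \<circ> chart_inv c"])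
  moreover have "\<forall>\<^sub>F q in nhds p. (h \<circ> chart_inv c) (snd c q) = h q"
    using eventually_nhds_in_open[OF open_chart[OF c(1)] c(2)] by eventually_elim (simp add: c)
  ultimately show "isCont h p"
    by (simp add: isCont_cong)
qed

lemma grad_le_1_along_curve:
  assumes h: "grad_le_1 h" and c: "c \<in> \<A>" "\<gamma> t \<in> fst c" and \<gamma>: "isCont \<gamma> t"
    and v: "((snd c \<circ> \<gamma>) has_vector_derivative v) (at t)"
  shows "\<exists>D. ((h \<circ> \<gamma>) has_vector_derivative D) (at t) \<and> \<bar>D\<bar> \<le> sqrt (sqnorm c (\<gamma> t) v)"
proof -
  let ?x = "snd c (\<gamma> t)"
  obtain h' where h': "((h \<circ> chart_inv c) has_derivative h') (at ?x)"
      "\<And>v. \<bar>h' v\<bar> \<le> sqrt (sqnorm c (\<gamma> t) v)"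
    using h c unfolding grad_le_1_def by blast
  have "\<forall>\<^sub>F s in nhds t. \<gamma> s \<in> fst c"
    using \<gamma> open_chart[OF c(1)] c(2)
    by (simp add: isCont_def eventually_nhds_conv_at topological_tendstoD)
  then have "\<forall>\<^sub>F s in nhds t. (h \<circ> chart_inv c) ((snd c \<circ> \<gamma>) s) = (h \<circ> \<gamma>) s"
    by eventually_elim (simp add: c)
  then have "((h \<circ> \<gamma>) has_vector_derivative h' v) (at t)"
    using has_vector_derivative_comp_local[OF v, of "h \<circ> chart_inv c" h'] h'(1) by simp
  then show ?thesis
    using h'(2) by blast
qed

text \<open>Along the curve the derivative of \<tau> * h consists of \<tau> times the derivative of
  h and of \<tau>' times h. Each is at most the norm of the velocity in the cone, and the
  denominator 2 pays for having two of them.\<close>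

lemma cone_length_lower_bound:
  assumes h: "h \<in> test_functions" and \<gamma>: "piecewise_C1_curve \<A> \<gamma>" and \<tau>: "valid_path \<tau>"
    and \<tau>1: "\<forall>t\<in>{0..1}. \<tau> t \<ge> 1"
  shows "ennreal (\<bar>\<tau> 1 * h (\<gamma> 1) - \<tau> 0 * h (\<gamma> 0)\<bar> / 2) \<le> cone_length \<A> g \<gamma> \<tau>"
proof -
  have g1: "grad_le_1 h" and b1: "\<bar>h p\<bar> \<le> 1" for p
    using h by (auto simp: test_functions_def)
  have path: "path \<gamma>"
    using \<gamma> by (simp add: piecewise_C1_curve_def)
  obtain K where K: "finite K"
    and Kd: "\<forall>t\<in>{0..1} - K. \<forall>c\<in>\<A>. \<gamma> t \<in> fst c \<longrightarrow> (snd c \<circ> \<gamma>) differentiable (at t)"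
    using curve_differentiable[OF \<gamma>] by meson
  obtain K' where K': "finite K'" "\<tau> C1_differentiable_on ({0..1} - K')" and \<tau>c: "continuous_on {0..1} \<tau>"
    using \<tau> unfolding valid_path_def piecewise_C1_differentiable_on_def by blast
  let ?w = "\<lambda>t. sqrt ((\<tau> t)\<^sup>2 * (speed \<A> g \<gamma> t)\<^sup>2 + (vector_derivative \<tau> (at t))\<^sup>2)"
  let ?F = "\<lambda>t. (\<tau> t * h (\<gamma> t)) / 2"
  have "ennreal \<bar>?F 1 - ?F 0\<bar> \<le> (\<integral>\<^sup>+t\<in>{0..1}. ennreal (?w t) \<partial>lborel)"
  proof (rule increment_le_nn_integral)
    show "continuous_on {0..1} ?F"
      using path continuous_on_compose2[OF grad_le_1_continuous[OF g1], of "{0..1}" \<gamma>] \<tau>c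
      by (auto simp: path_def intro!: continuous_intros)
    show "finite (K \<union> K')"
      using K K' by simp
    fix t assume t: "t \<in> {0<..<1} - (K \<union> K')"
    obtain c where c: "c \<in> \<A>" "\<gamma> t \<in> fst c"
      using chart_cover by blast
    let ?v = "vector_derivative (snd c \<circ> \<gamma>) (at t)" and ?\<tau>' = "vector_derivative \<tau> (at t)"
    have v: "((snd c \<circ> \<gamma>) has_vector_derivative ?v) (at t)"
      using Kd t c by (subst vector_derivative_works[symmetric]) auto
    have cont: "isCont \<gamma> t"
      using t by (intro isCont_path path) auto
    obtain D where D: "((h \<circ> \<gamma>) has_vector_derivative D) (at t)" "\<bar>D\<bar> \<le> speed \<A> g \<gamma> t"
      using grad_le_1_along_curve[OF g1 c cont v] speed_eq[OF c cont v] by auto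
    have \<tau>': "(\<tau> has_vector_derivative ?\<tau>') (at t)"
      using K'(2) t by (auto simp: C1_differentiable_on_eq vector_derivative_works[symmetric])
    have "(?F has_vector_derivative (\<tau> t * D + ?\<tau>' * h (\<gamma> t)) / 2) (at t)"
      using D(1) \<tau>' unfolding has_real_derivative_iff_has_vector_derivative[symmetric] o_def
      by (auto intro!: derivative_eq_intros)
    moreover have "\<bar>(\<tau> t * D + ?\<tau>' * h (\<gamma> t)) / 2\<bar> \<le> ?w t"
    proof -
      have \<tau>t: "\<tau> t \<ge> 1"
        using \<tau>1 t by auto
      have "\<bar>\<tau> t * D\<bar> \<le> \<tau> t * speed \<A> g \<gamma> t"
        using \<tau>t D(2) by (simp add: abs_mult)
      also have "\<dots> = sqrt ((\<tau> t)\<^sup>2 * (speed \<A> g \<gamma> t)\<^sup>2)"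
        using \<tau>t speed_nonneg by (simp add: real_sqrt_mult)
      also have "\<dots> \<le> ?w t"
        by (intro real_sqrt_le_mono) simp
      finally have 1: "\<bar>\<tau> t * D\<bar> \<le> ?w t" .
      have "\<bar>?\<tau>' * h (\<gamma> t)\<bar> \<le> \<bar>?\<tau>'\<bar> * 1"
        unfolding abs_mult by (intro mult_left_mono b1) simp
      also have "\<dots> = sqrt (?\<tau>'\<^sup>2)"
        by simp
      also have "\<dots> \<le> ?w t"
        by (intro real_sqrt_le_mono) simp
      finally have 2: "\<bar>?\<tau>' * h (\<gamma> t)\<bar> \<le> ?w t" .
      show ?thesis
        using 1 2 abs_triangle_ineq[of "\<tau> t * D" "?\<tau>' * h (\<gamma> t)"] by (simp add: abs_divide)
    qed
    ultimately show "\<exists>D. (?F has_vector_derivative D) (at t) \<and> \<bar>D\<bar> \<le> ?w t"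
      by blast
  qed
  moreover have "\<bar>?F 1 - ?F 0\<bar> = \<bar>\<tau> 1 * h (\<gamma> 1) - \<tau> 0 * h (\<gamma> 0)\<bar> / 2"
    by (simp add: diff_divide_distrib[symmetric])
  ultimately show ?thesis
    unfolding cone_length_def by simp
qed

lemma one_in_test_functions: "(\<lambda>_. 1) \<in> test_functions"
  unfolding test_functions_def grad_le_1_def
  by (auto intro!: exI[of _ "\<lambda>_. 0"] simp: o_def sqnorm_nonneg)

end

section \<open>Bump functions that separate points\<close>

lemma has_derivative_eq_nhds:
  assumes "(f has_derivative f') (at x)" and ev: "\<forall>\<^sub>F z in nhds x. f z = h z"
  shows "(h has_derivative f') (at x)"
proof (rule has_derivative_transform_eventually[OF assms(1)])
  show "\<forall>\<^sub>F z in at x. f z = h z"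
    using ev by (simp add: eventually_nhds_conv_at)
qed (use eventually_nhds_x_imp_x[OF ev] in auto)

text \<open>Squaring removes the corner at 0, so this is a differentiable cutoff; its derivative at
  0 is 0 because the difference quotient is at most |y|.\<close>

lemma has_derivative_pos_part_sq:
  "((\<lambda>s::real. (max 0 s)\<^sup>2) has_field_derivative 2 * max 0 x) (at x)"
proof -
  consider "x > 0" | "x < 0" | "x = 0" by linarith
  then show ?thesis
  proof cases
    case 1
    have "\<forall>\<^sub>F s in nhds x. (max 0 s)\<^sup>2 = s\<^sup>2"
      using eventually_nhds_in_open[of "{0<..}" x] 1 by (auto elim: eventually_mono)
    moreover have "((\<lambda>s. s\<^sup>2) has_field_derivative 2 * max 0 x) (at x)"
      using 1 by (auto intro!: derivative_eq_intros)
    ultimately show ?thesis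
      by (subst DERIV_cong_ev[OF refl _ refl]) auto
  next
    case 2
    have "\<forall>\<^sub>F s in nhds x. (max 0 s)\<^sup>2 = 0"
      using eventually_nhds_in_open[of "{..<0}" x] 2 by (auto elim: eventually_mono)
    moreover have "((\<lambda>s. 0) has_field_derivative 2 * max 0 x) (at x)"
      using 2 by (auto intro!: derivative_eq_intros)
    ultimately show ?thesis
      by (subst DERIV_cong_ev[OF refl _ refl]) auto
  next
    case 3
    have "((\<lambda>y::real. (max 0 y)\<^sup>2 / y) \<longlongrightarrow> 0) (at 0)"
    proof (rule Lim_null_comparison)
      show "\<forall>\<^sub>F y in at 0. norm ((max 0 y)\<^sup>2 / y) \<le> \<bar>y\<bar>" for y :: real
        by (intro always_eventually allI) (auto simp: max_def power2_eq_square)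
      show "((\<lambda>y::real. \<bar>y\<bar>) \<longlongrightarrow> 0) (at 0)"
        by (intro tendsto_rabs_zero tendsto_ident_at)
    qed
    then show ?thesis
      using 3 by (simp add: has_field_derivative_iff)
  qed
qed

text \<open>Derivatives are two-sided while the functions agree on the interval only, so both end
  points are added to the exceptional set.\<close>

lemma piecewise_C1_differentiable_on_cong:
  fixes f h :: "real \<Rightarrow> 'a::real_normed_vector"
  assumes f: "f piecewise_C1_differentiable_on {a..b}" and eq: "\<And>x. x \<in> {a..b} \<Longrightarrow> f x = h x"
  shows "h piecewise_C1_differentiable_on {a..b}"
proof -
  obtain S where S: "finite S" "f C1_differentiable_on ({a..b} - S)" and cont: "continuous_on {a..b} f"
    using f unfolding piecewise_C1_differentiable_on_def by blast
  obtain D where D: "\<forall>x\<in>{a..b} - S. (f has_vector_derivative D x) (at x)" "continuous_on ({a..b} - S) D"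
    using S(2) unfolding C1_differentiable_on_def by blast
  have "(h has_vector_derivative D x) (at x)" if x: "x \<in> {a..b} - (S \<union> {a, b})" for x
  proof -
    have "\<forall>\<^sub>F s in nhds x. s \<in> UNIV \<longrightarrow> f s = h s"
      using eventually_nhds_in_open[of "{a<..<b}" x] x eq by (auto elim!: eventually_mono)
    then show ?thesis
      using D(1) x eq has_vector_derivative_cong_ev[of UNIV f h x "D x"] by auto
  qed
  moreover have "continuous_on ({a..b} - (S \<union> {a, b})) D"
    using D(2) by (rule continuous_on_subset) auto
  ultimately have "h C1_differentiable_on ({a..b} - (S \<union> {a, b}))"
    unfolding C1_differentiable_on_def by blast
  moreover have "continuous_on {a..b} h"
    using continuous_on_eq[OF cont eq] .
  ultimately show ?thesis
    unfolding piecewise_C1_differentiable_on_def using S(1) by (intro conjI exI[of _ "S \<union> {a, b}"]) auto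
qed

context riemannian
begin

text \<open>A bump in coordinates around p, extended by 0 and scaled down until its gradient and its
  values are at most 1. This makes \<open>d\<^sub>M\<close> definite.\<close>

lemma test_functions_separate:
  assumes "p \<noteq> q"
  shows "\<exists>h\<in>test_functions. h p \<noteq> h q"
proof -
  obtain c where c: "c \<in> \<A>" "p \<in> fst c"
    using chart_cover by blast
  define a where "a = snd c p"
  obtain r0 where r0: "r0 > 0" "cball a r0 \<subseteq> snd c ` fst c"
    using open_contains_cball[of "snd c ` fst c"] open_chart_image[OF c(1)] c(2) unfolding a_def by blast
  \<comment> \<open>The radius is so small that q, if it lies in the chart at all, is not in the
    open ball around p.\<close>
  define r where "r = (if q \<in> fst c then min r0 (norm (snd c q - a)) else r0)"
  have "q \<in> fst c \<Longrightarrow> snd c q \<noteq> a"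
    using inj_on_chart[OF c(1)] c(2) \<open>p \<noteq> q\<close> unfolding a_def inj_on_def by metis
  then have r: "r > 0" "r \<le> r0" "q \<in> fst c \<Longrightarrow> r \<le> norm (snd c q - a)"
    using r0(1) by (auto simp: r_def)
  have cb: "cball a r \<subseteq> snd c ` fst c"
    using r0(2) r(2) by (auto simp: subset_iff)
  obtain C where C: "C > 0"
    "\<And>x v. x \<in> cball a r \<Longrightarrow> norm v \<le> C * sqrt (sqnorm c (chart_inv c x) v)"
    using sqnorm_bounds[OF c(1) compact_cball cb] by metis
  let ?s = "\<lambda>u. r\<^sup>2 - (u - a) \<bullet> (u - a)"
  define \<psi> where "\<psi> u = (max 0 (?s u))\<^sup>2" for u
  define \<psi>' where "\<psi>' u v = 2 * max 0 (?s u) * (- 2 * ((u - a) \<bullet> v))" for u v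
  have der: "(\<psi> has_derivative \<psi>' u) (at u)" for u
  proof -
    have "(?s has_derivative (\<lambda>v. - 2 * ((u - a) \<bullet> v))) (at u)"
      by (auto intro!: derivative_eq_intros simp: inner_commute)
    from has_derivative_compose[OF this has_derivative_pos_part_sq[unfolded has_field_derivative_def]]
    show ?thesis
      unfolding \<psi>_def[abs_def] \<psi>'_def[abs_def] by simp
  qed
  have out: "\<psi> u = 0" if "r \<le> norm (u - a)" for u
  proof -
    have "r\<^sup>2 \<le> (norm (u - a))\<^sup>2"
      using that r(1) by (intro power_mono) auto
    then show ?thesis
      by (simp add: \<psi>_def power2_norm_eq_inner)
  qed
  have \<psi>_bound: "0 \<le> \<psi> u" "\<psi> u \<le> (r\<^sup>2)\<^sup>2" for u
    unfolding \<psi>_def by (rule zero_le_power2) (rule power_mono, auto)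
  have \<psi>'_bound: "\<bar>\<psi>' u v\<bar> \<le> 4 * r\<^sup>2 * r * norm v" if "u \<in> cball a r" for u v
  proof -
    have "\<bar>max 0 (?s u)\<bar> \<le> r\<^sup>2"
      by auto
    moreover have "\<bar>(u - a) \<bullet> v\<bar> \<le> r * norm v"
    proof (rule order_trans[OF Cauchy_Schwarz_ineq2])
      show "norm (u - a) * norm v \<le> r * norm v"
        using that by (intro mult_right_mono) (auto simp: dist_norm norm_minus_commute)
    qed
    ultimately have "\<bar>max 0 (?s u)\<bar> * \<bar>(u - a) \<bullet> v\<bar> \<le> r\<^sup>2 * (r * norm v)"
      using r(1) by (intro mult_mono) auto
    then show ?thesis
      unfolding \<psi>'_def by (simp add: abs_mult mult.assoc)
  qed
  \<comment> \<open>The two summands of the denominator bound the gradient of \<psi>, measured with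
    the constant C, and the values of \<psi>; dividing by their sum normalises both at once.\<close>
  define l where "l = 1 / (4 * r\<^sup>2 * r * C + (r\<^sup>2)\<^sup>2)"
  have den: "4 * r\<^sup>2 * r * C + (r\<^sup>2)\<^sup>2 > 0"
    using r C by (intro add_pos_pos mult_pos_pos) auto
  have l: "l > 0" "l * (4 * r\<^sup>2 * r * C) \<le> 1" "l * (r\<^sup>2)\<^sup>2 \<le> 1"
    unfolding l_def using den r C by (auto simp: divide_le_eq)
  define h where "h x = (if x \<in> fst c then l * \<psi> (snd c x) else 0)" for x
  \<comment> \<open>The image of the closed ball is compact, hence closed in the Hausdorff space. A
    point of it lies in the domain of c, and around any other point h vanishes identically, so
    differentiability is checked in two cases.\<close>
  let ?Q = "chart_inv c ` cball a r"
  have clQ: "closed ?Q"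
    using continuous_on_subset[OF continuous_chart_inv[OF c(1)] cb]
    by (intro compact_imp_closed compact_continuous_image compact_cball)
  have "grad_le_1 h"
    unfolding grad_le_1_def
  proof (intro ballI)
    fix c' x assume c': "c' \<in> \<A>" "x \<in> fst c'"
    let ?y = "snd c' x"
    show "\<exists>h'. ((h \<circ> chart_inv c') has_derivative h') (at ?y) \<and> (\<forall>v. \<bar>h' v\<bar> \<le> sqrt (sqnorm c' x v))"
    proof (cases "x \<in> ?Q")
      case True
      then have xc: "x \<in> fst c" and u: "snd c x \<in> cball a r" "chart_inv c (snd c x) = x"
        using c(1) cb by auto
      have yW: "?y \<in> snd c' ` (fst c' \<inter> fst c)"
        using xc c' by auto
      have "open (snd c' ` (fst c' \<inter> fst c))"
        using open_chart_subimage[OF c'(1), of "fst c' \<inter> fst c"] open_chart c c' by blast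
      from eventually_nhds_in_open[OF this yW]
      have ev: "\<forall>\<^sub>F z in nhds ?y. l * \<psi> (transition c' c z) = (h \<circ> chart_inv c') z"
        by eventually_elim (use c' in \<open>auto simp: h_def\<close>)
      have "(transition c' c has_derivative dtransition c' c ?y) (at ?y)"
        by (rule transition_has_derivative[OF c'(1) c(1) yW])
      then have "((\<lambda>z. l * \<psi> (transition c' c z)) has_derivative
          (\<lambda>v. l * \<psi>' (transition c' c ?y) (dtransition c' c ?y v))) (at ?y)"
        by (intro has_derivative_mult_right has_derivative_compose[OF _ der])
      then have "((h \<circ> chart_inv c') has_derivative
          (\<lambda>v. l * \<psi>' (transition c' c ?y) (dtransition c' c ?y v))) (at ?y)"
        by (rule has_derivative_eq_nhds) (rule ev)
      moreover have "\<bar>l * \<psi>' (transition c' c ?y) (dtransition c' c ?y v)\<bar> \<le> sqrt (sqnorm c' x v)" for v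
      proof -
        let ?w = "dtransition c' c ?y v"
        have "\<bar>l * \<psi>' (snd c x) ?w\<bar> \<le> l * (4 * r\<^sup>2 * r * norm ?w)"
          using \<psi>'_bound[OF u(1), of ?w] l(1) by (simp add: abs_mult)
        also have "\<dots> \<le> l * (4 * r\<^sup>2 * r * (C * sqrt (sqnorm c x ?w)))"
          using C(2)[OF u(1), of ?w] u(2) l(1) r(1) by (intro mult_left_mono) auto
        also have "\<dots> = (l * (4 * r\<^sup>2 * r * C)) * sqrt (sqnorm c x ?w)"
          by (simp add: mult_ac)
        also have "\<dots> \<le> 1 * sqrt (sqnorm c x ?w)"
          using l(2) sqnorm_nonneg[OF c(1) xc] by (intro mult_right_mono) auto
        also have "sqnorm c x ?w = sqnorm c' x v"
          using sqnorm_transform[OF c'(1) c(1) c'(2) xc, of v] by simp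
        finally have le: "\<bar>l * \<psi>' (snd c x) ?w\<bar> \<le> sqrt (sqnorm c' x v)"
          unfolding mult_1 .
        have tx: "transition c' c ?y = snd c x"
          using c' by simp
        show ?thesis
          unfolding tx by (rule le)
      qed
      ultimately show ?thesis
        by blast
    next
      case False
      have "open (snd c' ` (fst c' \<inter> - ?Q))"
        using open_chart_subimage[OF c'(1), of "fst c' \<inter> - ?Q"] open_chart c' clQ by blast
      moreover have "?y \<in> snd c' ` (fst c' \<inter> - ?Q)"
        using False c' by auto
      ultimately have "\<forall>\<^sub>F z in nhds ?y. z \<in> snd c' ` (fst c' \<inter> - ?Q)"
        by (rule eventually_nhds_in_open)
      then have ev: "\<forall>\<^sub>F z in nhds ?y. 0 = (h \<circ> chart_inv c') z"
      proof eventually_elim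
        case (elim z)
        then obtain w where w: "w \<in> fst c'" "w \<notin> ?Q" "z = snd c' w"
          by blast
        have "h w = 0"
        proof (cases "w \<in> fst c")
          case True
          then have "snd c w \<notin> cball a r"
            using w(2) c(1) by (metis chart_inv_snd imageI)
          then show ?thesis
            using out[of "snd c w"] by (simp add: h_def dist_norm norm_minus_commute)
        qed (simp add: h_def)
        then show ?case
          using w c' by simp
      qed
      have "((h \<circ> chart_inv c') has_derivative (\<lambda>v. 0)) (at ?y)"
        by (rule has_derivative_eq_nhds[OF has_derivative_const]) (rule ev)
      then show ?thesis
        using sqnorm_nonneg[OF c'] by (intro exI[of _ "\<lambda>_. 0"]) auto
    qed
  qed
  moreover have "\<bar>h x\<bar> \<le> 1" for x
  proof -
    have "l * \<psi> (snd c x) \<le> l * (r\<^sup>2)\<^sup>2"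
      using l(1) by (intro mult_left_mono) (rule \<psi>_bound(2), simp)
    then have "l * \<psi> (snd c x) \<le> 1"
      using l(3) by (rule order_trans)
    then show ?thesis
      using l(1) \<psi>_bound(1)[of "snd c x"] by (auto simp: h_def abs_mult)
  qed
  moreover have "h p \<noteq> 0"
    using c(2) l(1) r(1) by (simp add: h_def \<psi>_def a_def)
  moreover have "h q = 0"
    using out[of "snd c q"] r(3) by (simp add: h_def)
  ultimately show ?thesis
    by (intro bexI[of _ h]) (auto simp: test_functions_def)
qed

section \<open>Curves of bounded speed\<close>

lemma speed_reparam:
  assumes \<gamma>: "isCont \<gamma> t" "isCont \<gamma>1 (m * t + k)"
    and ev: "\<forall>\<^sub>F s in nhds t. \<gamma>1 (m * s + k) = \<gamma> s"
    and c: "c \<in> \<A>" "\<gamma> t \<in> fst c" and diff: "(snd c \<circ> \<gamma>1) differentiable (at (m * t + k))"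
  shows "speed \<A> g \<gamma> t = \<bar>m\<bar> * speed \<A> g \<gamma>1 (m * t + k)"
proof -
  let ?v = "vector_derivative (snd c \<circ> \<gamma>1) (at (m * t + k))"
  have v: "((snd c \<circ> \<gamma>1) has_vector_derivative ?v) (at (m * t + k))"
    using diff by (simp add: vector_derivative_works[symmetric])
  have eq: "\<gamma>1 (m * t + k) = \<gamma> t"
    using eventually_nhds_x_imp_x[OF ev] .
  have "((\<lambda>s. m * s + k) has_vector_derivative m) (at t)"
    unfolding has_real_derivative_iff_has_vector_derivative[symmetric]
    by (auto intro!: derivative_eq_intros)
  moreover have "\<forall>\<^sub>F s in nhds t. (snd c \<circ> \<gamma>1) (m * s + k) = (snd c \<circ> \<gamma>) s"
    using ev by eventually_elim simp
  ultimately have "((snd c \<circ> \<gamma>) has_vector_derivative m *\<^sub>R ?v) (at t)"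
    using has_vector_derivative_comp_local[of "\<lambda>s. m * s + k" m t "snd c \<circ> \<gamma>1" "\<lambda>s. s *\<^sub>R ?v"]
      v[unfolded has_vector_derivative_def] by blast
  then have "speed \<A> g \<gamma> t = sqrt (sqnorm c (\<gamma> t) (m *\<^sub>R ?v))"
    by (intro speed_eq c \<gamma>)
  moreover have "speed \<A> g \<gamma>1 (m * t + k) = sqrt (sqnorm c (\<gamma> t) ?v)"
    using speed_eq[of c \<gamma>1 "m * t + k", OF c(1) _ \<gamma>(2) v] c(2) eq by simp
  ultimately show ?thesis
    by (simp add: sqnorm_scaleR real_sqrt_mult)
qed

text \<open>A pointwise bound on the speed, instead of a bound on the length, can be multiplied by
  the height under the integral in \<open>cone_length\<close>. A finite exceptional set does not
  affect that integral.\<close>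

definition joinable :: "real \<Rightarrow> 'm \<Rightarrow> 'm \<Rightarrow> bool" where
  "joinable L x y \<longleftrightarrow> (\<exists>\<gamma> K. piecewise_C1_curve \<A> \<gamma> \<and> \<gamma> 0 = x \<and> \<gamma> 1 = y \<and> finite K \<and>
     (\<forall>t\<in>{0..1} - K. speed \<A> g \<gamma> t \<le> L))"

text \<open>Concatenation runs through each half at double speed, which explains the factor
  2.\<close>

lemma joinable_trans:
  assumes "joinable L x y" "joinable L' y z"
  shows "joinable (2 * max L L') x z"
proof -
  obtain \<gamma>1 K1 where \<gamma>1: "piecewise_C1_curve \<A> \<gamma>1" "\<gamma>1 0 = x" "\<gamma>1 1 = y" "finite K1"
      "\<forall>t\<in>{0..1} - K1. speed \<A> g \<gamma>1 t \<le> L"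
    using assms(1) unfolding joinable_def by auto
  obtain \<gamma>2 K2 where \<gamma>2: "piecewise_C1_curve \<A> \<gamma>2" "\<gamma>2 0 = y" "\<gamma>2 1 = z" "finite K2"
      "\<forall>t\<in>{0..1} - K2. speed \<A> g \<gamma>2 t \<le> L'"
    using assms(2) unfolding joinable_def by auto
  have path1: "path \<gamma>1" and path2: "path \<gamma>2"
    using \<gamma>1(1) \<gamma>2(1) by (auto simp: piecewise_C1_curve_def)
  let ?\<gamma> = "\<gamma>1 +++ \<gamma>2"
  have path: "path ?\<gamma>"
    using path1 path2 \<gamma>1(3) \<gamma>2(2) by (intro path_join_imp) (auto simp: pathfinish_def pathstart_def)
  have half1: "?\<gamma> t = \<gamma>1 (2 * t)" if "t \<le> 1/2" for t
    using that by (simp add: joinpaths_def)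
  have half2: "?\<gamma> t = \<gamma>2 (2 * t - 1)" if "t \<ge> 1/2" for t
  proof (cases "t = 1/2")
    case True
    then show ?thesis
      unfolding joinpaths_def True using \<gamma>1(3) \<gamma>2(2) by simp
  qed (use that in \<open>auto simp: joinpaths_def\<close>)
  have pw1: "(snd c \<circ> ?\<gamma>) piecewise_C1_differentiable_on {a..b}"
    if c: "c \<in> \<A>" and ab: "0 \<le> a" "a \<le> b" "b \<le> 1/2" and sub: "?\<gamma> ` {a..b} \<subseteq> fst c" for c a b
  proof (rule piecewise_C1_differentiable_on_cong)
    have im: "(\<lambda>x. 2 * x + 0) ` {a..b} = {2 * a..2 * b}"
      by (simp add: image_mult_atLeastAtMost[of 2])
    have "\<gamma>1 ` {2 * a..2 * b} = ?\<gamma> ` {a..b}"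
      unfolding im[symmetric] image_image using half1 ab by (intro image_cong) auto
    then have "(snd c \<circ> \<gamma>1) piecewise_C1_differentiable_on {2 * a..2 * b}"
      using \<gamma>1(1) c ab sub unfolding piecewise_C1_curve_def by auto
    then show "((snd c \<circ> \<gamma>1) \<circ> (\<lambda>x. 2 *\<^sub>R x + 0)) piecewise_C1_differentiable_on {a..b}"
      unfolding im[symmetric] by (rule piecewise_C1_differentiable_affine)
    show "((snd c \<circ> \<gamma>1) \<circ> (\<lambda>x. 2 *\<^sub>R x + 0)) x = (snd c \<circ> ?\<gamma>) x" if "x \<in> {a..b}" for x
      using that ab half1[of x] by simp
  qed
  have pw2: "(snd c \<circ> ?\<gamma>) piecewise_C1_differentiable_on {a..b}"
    if c: "c \<in> \<A>" and ab: "1/2 \<le> a" "a \<le> b" "b \<le> 1" and sub: "?\<gamma> ` {a..b} \<subseteq> fst c" for c a b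
  proof (rule piecewise_C1_differentiable_on_cong)
    have im: "(\<lambda>x. 2 * x + (-1)) ` {a..b} = {2 * a - 1..2 * b - 1}"
      using image_affinity_atLeastAtMost[of 2 "-1" a b] ab by simp
    have "\<gamma>2 ` {2 * a - 1..2 * b - 1} = ?\<gamma> ` {a..b}"
      unfolding im[symmetric] image_image using half2 ab by (intro image_cong) auto
    then have "(snd c \<circ> \<gamma>2) piecewise_C1_differentiable_on {2 * a - 1..2 * b - 1}"
      using \<gamma>2(1) c ab sub unfolding piecewise_C1_curve_def by auto
    then show "((snd c \<circ> \<gamma>2) \<circ> (\<lambda>x. 2 *\<^sub>R x + (-1))) piecewise_C1_differentiable_on {a..b}"
      unfolding im[symmetric] by (rule piecewise_C1_differentiable_affine)
    show "((snd c \<circ> \<gamma>2) \<circ> (\<lambda>x. 2 *\<^sub>R x + (-1))) x = (snd c \<circ> ?\<gamma>) x" if "x \<in> {a..b}" for x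
      using that ab half2[of x] by simp
  qed
  have curve: "piecewise_C1_curve \<A> ?\<gamma>"
    unfolding piecewise_C1_curve_def
  proof (intro conjI path ballI allI impI; elim conjE)
    fix c a b assume c: "c \<in> \<A>" and ab: "0 \<le> a" "a \<le> b" "b \<le> (1::real)" and sub: "?\<gamma> ` {a..b} \<subseteq> fst c"
    consider "b \<le> 1/2" | "1/2 \<le> a" | "a \<le> 1/2" "1/2 \<le> b" by linarith
    then show "(snd c \<circ> ?\<gamma>) piecewise_C1_differentiable_on {a..b}"
    proof cases
      case 3
      have "(\<lambda>x. if x \<le> 1/2 then (snd c \<circ> ?\<gamma>) x else (snd c \<circ> ?\<gamma>) x) piecewise_C1_differentiable_on {a..b}"
        using c ab 3 sub
        by (intro piecewise_C1_differentiable_cases pw1 pw2) (auto simp: image_subset_iff)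
      then show ?thesis
        by (simp add: o_def)
    qed (use c ab sub pw1 pw2 in auto)
  qed
  obtain K1' where K1': "finite K1'"
      "\<forall>t\<in>{0..1} - K1'. \<forall>c\<in>\<A>. \<gamma>1 t \<in> fst c \<longrightarrow> (snd c \<circ> \<gamma>1) differentiable (at t)"
    using curve_differentiable[OF \<gamma>1(1)] by meson
  obtain K2' where K2': "finite K2'"
      "\<forall>t\<in>{0..1} - K2'. \<forall>c\<in>\<A>. \<gamma>2 t \<in> fst c \<longrightarrow> (snd c \<circ> \<gamma>2) differentiable (at t)"
    using curve_differentiable[OF \<gamma>2(1)] by meson
  \<comment> \<open>Besides the ends and the junction this contains the parameters at which either
    half violates its speed bound or is not differentiable, transported to the parameter of the
    joined path.\<close>
  define K where "K = {0, 1/2, 1} \<union> (\<lambda>s. s / 2) ` (K1 \<union> K1') \<union> (\<lambda>s. (s + 1) / 2) ` (K2 \<union> K2')"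
  have "finite K"
    using \<gamma>1(4) \<gamma>2(4) K1'(1) K2'(1) by (simp add: K_def)
  moreover have "speed \<A> g ?\<gamma> t \<le> 2 * max L L'" if t: "t \<in> {0..1} - K" for t
  proof -
    have t01: "t \<in> {0<..<1}" "t \<noteq> 1/2"
      using t by (auto simp: K_def)
    obtain c where c: "c \<in> \<A>" "?\<gamma> t \<in> fst c"
      using chart_cover by blast
    have cont: "isCont ?\<gamma> t"
      using t01 by (intro isCont_path path)
    consider "t < 1/2" | "t > 1/2" using t01(2) by linarith
    then show ?thesis
    proof cases
      case 1
      have "t = (2 * t) / 2" by simp
      then have nK: "2 * t \<notin> K1 \<union> K1'"
        using t unfolding K_def by (metis DiffD2 UnCI image_eqI)
      have ev: "\<forall>\<^sub>F s in nhds t. \<gamma>1 (2 * s + 0) = ?\<gamma> s"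
        using eventually_nhds_in_open[of "{..<1/2}" t] 1
        by (auto elim!: eventually_mono simp: half1)
      have "speed \<A> g ?\<gamma> t = \<bar>2\<bar> * speed \<A> g \<gamma>1 (2 * t + 0)"
        by (rule speed_reparam[OF cont _ ev c])
           (use 1 t01 nK K1'(2) c half1[of t] in \<open>auto intro!: isCont_path path1\<close>)
      also have "speed \<A> g \<gamma>1 (2 * t + 0) \<le> L"
        using \<gamma>1(5) nK 1 t01 by auto
      finally show ?thesis
        by simp
    next
      case 2
      have "t = ((2 * t - 1) + 1) / 2" by simp
      then have nK: "2 * t - 1 \<notin> K2 \<union> K2'"
        using t unfolding K_def by (metis DiffD2 UnCI image_eqI)
      have ev: "\<forall>\<^sub>F s in nhds t. \<gamma>2 (2 * s + (-1)) = ?\<gamma> s"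
        using eventually_nhds_in_open[of "{1/2<..}" t] 2
        by (auto elim!: eventually_mono simp: half2)
      have "speed \<A> g ?\<gamma> t = \<bar>2\<bar> * speed \<A> g \<gamma>2 (2 * t + (-1))"
        by (rule speed_reparam[OF cont _ ev c])
           (use 2 t01 nK K2'(2) c half2[of t] in \<open>auto intro!: isCont_path path2\<close>)
      also have "speed \<A> g \<gamma>2 (2 * t + (-1)) \<le> L'"
        using \<gamma>2(5) nK 2 t01 by auto
      finally show ?thesis
        by simp
    qed
  qed
  ultimately show ?thesis
    unfolding joinable_def using curve half1[of 0] half2[of 1] \<gamma>1(2) \<gamma>2(3)
    by (intro exI[of _ ?\<gamma>] exI[of _ K]) auto
qed

text \<open>Straight segments in a small coordinate ball do the job, since the Riemannian norm is at
  most C times the Euclidean one there.\<close>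

lemma locally_joinable:
  assumes "\<epsilon> > 0"
  shows "\<exists>U. open U \<and> p \<in> U \<and> (\<forall>x\<in>U. \<forall>y\<in>U. joinable \<epsilon> x y)"
proof -
  obtain c where c: "c \<in> \<A>" "p \<in> fst c"
    using chart_cover by blast
  define a where "a = snd c p"
  obtain r0 where r0: "r0 > 0" "cball a r0 \<subseteq> snd c ` fst c"
    using open_contains_cball[of "snd c ` fst c"] open_chart_image[OF c(1)] c(2) unfolding a_def by blast
  obtain C where C: "C > 0"
    "\<And>x v. x \<in> cball a r0 \<Longrightarrow> sqrt (sqnorm c (chart_inv c x) v) \<le> C * norm v"
    using sqnorm_bounds[OF c(1) compact_cball r0(2)] by metis
  \<comment> \<open>A segment between two points of the ball has constant velocity of Euclidean norm
    at most 2 * r, hence speed at most C * (2 * r).\<close>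
  define r where "r = min r0 (\<epsilon> / (2 * C))"
  have r: "r > 0" "r \<le> r0" "C * (2 * r) \<le> \<epsilon>"
    using r0 C(1) assms by (auto simp: r_def min_def field_simps)
  let ?U = "fst c \<inter> snd c -` ball a r"
  have "joinable \<epsilon> x y" if x: "x \<in> ?U" and y: "y \<in> ?U" for x y
  proof -
    define u where "u = snd c x"
    define w where "w = snd c y - snd c x"
    define l where "l t = u + t *\<^sub>R w" for t
    define \<gamma> where "\<gamma> t = chart_inv c (l t)" for t
    have l: "l t \<in> ball a r" if "t \<in> {0..1}" for t
    proof -
      have "l t = (1 - t) *\<^sub>R snd c x + t *\<^sub>R snd c y"
        by (simp add: l_def u_def w_def algebra_simps)
      then show ?thesis
        using convexD[OF convex_ball, of "snd c x" a r "snd c y" "1 - t" t] x y that by simp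
    qed
    then have lV: "l t \<in> snd c ` fst c" if "t \<in> {0..1}" for t
      using that r0(2) r(2) by (force simp: subset_iff)
    have l_cont: "continuous_on A l" for A
      unfolding l_def[abs_def] by (intro continuous_intros)
    have l_der: "(l has_vector_derivative w) (at t)" for t
      unfolding l_def[abs_def] by (auto intro!: derivative_eq_intros)
    have path: "path \<gamma>"
      unfolding path_def \<gamma>_def[abs_def]
      by (rule continuous_on_compose2[OF continuous_chart_inv[OF c(1)] l_cont]) (use lV in auto)
    have \<gamma>_in: "\<gamma> t \<in> fst c" "snd c (\<gamma> t) = l t" if "t \<in> {0..1}" for t
      using lV[OF that] c(1) by (auto simp: \<gamma>_def)
    have der_c: "((snd c \<circ> \<gamma>) has_vector_derivative w) (at t)" if t: "t \<in> {0<..<1}" for t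
    proof -
      have "\<forall>\<^sub>F s in nhds t. s \<in> {0<..<1}"
        using t by (intro eventually_nhds_in_open) auto
      then have ev: "\<forall>\<^sub>F s in nhds t. s \<in> UNIV \<longrightarrow> l s = (snd c \<circ> \<gamma>) s"
        by eventually_elim (simp add: \<gamma>_in)
      show ?thesis
        by (rule has_vector_derivative_cong_ev[OF ev, THEN iffD1])
           (use \<gamma>_in(2)[of t] t l_der in auto)
    qed
    have der: "((snd c' \<circ> \<gamma>) has_vector_derivative dtransition c c' (l t) w) (at t)"
      if "t \<in> {0<..<1}" "c' \<in> \<A>" "\<gamma> t \<in> fst c'" for t c'
    proof -
      have "((snd c' \<circ> \<gamma>) has_vector_derivative dtransition c c' (snd c (\<gamma> t)) w) (at t)"
        using that \<gamma>_in[of t] by (intro curve_chart_change c isCont_path path der_c) auto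
      then show ?thesis
        using \<gamma>_in(2)[of t] that by simp
    qed
    have "piecewise_C1_curve \<A> \<gamma>"
      unfolding piecewise_C1_curve_def
    proof (intro conjI path ballI allI impI; elim conjE)
      fix c' s t assume c': "c' \<in> \<A>" and st: "0 \<le> s" "s \<le> t" "t \<le> (1::real)"
        and sub: "\<gamma> ` {s..t} \<subseteq> fst c'"
      have "(snd c' \<circ> \<gamma>) C1_differentiable_on ({s..t} - {0, 1})"
        unfolding C1_differentiable_on_def
      proof (intro exI conjI ballI)
        show "((snd c' \<circ> \<gamma>) has_vector_derivative dtransition c c' (l x) w) (at x)"
          if "x \<in> {s..t} - {0, 1}" for x
          using that st c' sub by (intro der) auto
        show "continuous_on ({s..t} - {0, 1}) (\<lambda>x. dtransition c c' (l x) w)"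
        proof (rule continuous_on_compose2[OF continuous_dtransition[OF c(1) c'] l_cont])
          show "l ` ({s..t} - {0, 1}) \<subseteq> snd c ` (fst c \<inter> fst c')"
          proof
            fix z assume "z \<in> l ` ({s..t} - {0, 1})"
            then obtain x where x: "x \<in> {s..t}" "z = l x" by blast
            then have "x \<in> {0..1}" "\<gamma> x \<in> fst c'"
              using st sub by auto
            then show "z \<in> snd c ` (fst c \<inter> fst c')"
              using \<gamma>_in[of x] x(2) by (metis IntI imageI)
          qed
        qed
      qed
      moreover have "continuous_on {s..t} (snd c' \<circ> \<gamma>)"
      proof (rule continuous_on_compose)
        show "continuous_on {s..t} \<gamma>"
          using path unfolding path_def by (rule continuous_on_subset) (use st in auto)
        show "continuous_on (\<gamma> ` {s..t}) (snd c')"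
          using continuous_chart[OF c'] sub by (rule continuous_on_subset)
      qed
      ultimately show "(snd c' \<circ> \<gamma>) piecewise_C1_differentiable_on {s..t}"
        unfolding piecewise_C1_differentiable_on_def by (intro conjI exI[of _ "{0, 1}"]) auto
    qed
    moreover have "speed \<A> g \<gamma> t \<le> \<epsilon>" if t: "t \<in> {0..1} - {0, 1}" for t
    proof -
      have t': "t \<in> {0<..<1}" "t \<in> {0..1}" using t by auto
      have "speed \<A> g \<gamma> t = sqrt (sqnorm c (chart_inv c (l t)) w)"
        using speed_eq[OF c(1) \<gamma>_in(1)[OF t'(2)] isCont_path[OF path t'(1)] der_c[OF t'(1)]]
        by (simp add: \<gamma>_def)
      also have "\<dots> \<le> C * norm w"
        using l[OF t'(2)] r(2) by (intro C(2)) auto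
      also have "norm w \<le> 2 * r"
        using x y norm_triangle_ineq4[of "snd c y - a" "snd c x - a"]
        by (simp add: w_def dist_norm norm_minus_commute)
      then have "C * norm w \<le> C * (2 * r)"
        using C(1) by (intro mult_left_mono) auto
      also have "\<dots> \<le> \<epsilon>"
        by (rule r(3))
      finally show ?thesis .
    qed
    moreover have "\<gamma> 0 = x" "\<gamma> 1 = y"
      using x y c(1) by (auto simp: \<gamma>_def l_def u_def w_def)
    ultimately show ?thesis
      unfolding joinable_def by (intro exI[of _ \<gamma>] exI[of _ "{0, 1}"]) auto
  qed
  moreover have "open ?U"
    by (intro open_chart_preimage c open_ball)
  moreover have "p \<in> ?U"
    using c r by (simp add: a_def)
  ultimately show ?thesis
    by (intro exI[of _ ?U]) auto
qed

text \<open>The set of points reachable from x is open and so is its complement, because nearby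
  points are joinable.\<close>

lemma connected_imp_joinable:
  assumes conn: "connected (UNIV :: 'm set)"
  shows "\<exists>L. joinable L x y"
proof -
  define R where "R = {y. \<exists>L. joinable L x y}"
  obtain U where U: "\<And>p. open (U p)" "\<And>p. p \<in> U p"
      "\<And>p y z. y \<in> U p \<Longrightarrow> z \<in> U p \<Longrightarrow> joinable 1 y z"
    using locally_joinable[of 1] by (metis zero_less_one)
  have "open R"
  proof (subst open_subopen, intro ballI)
    fix p assume "p \<in> R"
    then have "U p \<subseteq> R"
      using U(2,3) joinable_trans unfolding R_def by blast
    then show "\<exists>T. open T \<and> p \<in> T \<and> T \<subseteq> R"
      using U by blast
  qed
  moreover have "open (- R)"
  proof (subst open_subopen, intro ballI)
    fix p assume p: "p \<in> - R"
    have "U p \<subseteq> - R"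
    proof
      fix q assume q: "q \<in> U p"
      show "q \<in> - R"
        using p joinable_trans[OF _ U(3)[OF q U(2)]] unfolding R_def by blast
    qed
    then show "\<exists>T. open T \<and> p \<in> T \<and> T \<subseteq> - R"
      using U by blast
  qed
  moreover have "x \<in> R"
    using U(3)[OF U(2) U(2)] unfolding R_def by blast
  ultimately have "R = UNIV"
    using conn by (metis closed_def connected_clopen empty_iff openin_open_Int closedin_closed_Int Int_UNIV_left open_openin closed_closedin subtopology_UNIV)
  then show ?thesis
    unfolding R_def by blast
qed

lemma cone_length_le:
  assumes sp: "finite K" "\<forall>t\<in>{0..1} - K. speed \<A> g \<gamma> t \<le> L" and "0 \<le> L"
    and \<tau>: "\<And>t. t \<in> {0..1} \<Longrightarrow> 0 \<le> \<tau> t \<and> \<tau> t \<le> B" "\<And>t. (\<tau> has_vector_derivative d) (at t)"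
  shows "cone_length \<A> g \<gamma> \<tau> \<le> ennreal (sqrt (B\<^sup>2 * L\<^sup>2 + d\<^sup>2))"
proof -
  have "AE t in lborel. t \<notin> K"
    using sp(1) by (intro AE_not_in finite_imp_null_set_lborel)
  then have "AE t in lborel. ennreal (sqrt ((\<tau> t)\<^sup>2 * (speed \<A> g \<gamma> t)\<^sup>2 + (vector_derivative \<tau> (at t))\<^sup>2)) * indicator {0..1} t
      \<le> ennreal (sqrt (B\<^sup>2 * L\<^sup>2 + d\<^sup>2)) * indicator {0..1::real} t"
  proof eventually_elim
    case (elim t)
    show ?case
    proof (cases "t \<in> {0..1}")
      case True
      have "(\<tau> t)\<^sup>2 * (speed \<A> g \<gamma> t)\<^sup>2 \<le> B\<^sup>2 * L\<^sup>2"
        using sp(2) elim True \<tau>(1) speed_nonneg by (intro mult_mono power_mono) auto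
      moreover have "vector_derivative \<tau> (at t) = d"
        using \<tau>(2) by (rule vector_derivative_at)
      ultimately show ?thesis
        using True by (auto intro!: ennreal_leI)
    qed simp
  qed
  then have "cone_length \<A> g \<gamma> \<tau> \<le> (\<integral>\<^sup>+t\<in>{0..1::real}. ennreal (sqrt (B\<^sup>2 * L\<^sup>2 + d\<^sup>2)) \<partial>lborel)"
    unfolding cone_length_def by (rule nn_integral_mono_AE)
  also have "\<dots> = ennreal (sqrt (B\<^sup>2 * L\<^sup>2 + d\<^sup>2))"
    by (subst nn_integral_cmult_indicator) auto
  finally show ?thesis .
qed

end

section \<open>Lower bounds for the distances\<close>

definition sup_dist :: "('x \<Rightarrow> real) set \<Rightarrow> 'x \<Rightarrow> 'x \<Rightarrow> real" where
  "sup_dist F x y = (SUP f\<in>F. \<bar>f x - f y\<bar>)"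

text \<open>Pointwise boundedness keeps each supremum in \<open>sup_dist\<close> finite; what
  results is a pseudodistance on the whole type.\<close>

locale bounded_family =
  fixes F :: "('x \<Rightarrow> real) set"
  assumes nonempty: "F \<noteq> {}" and bounded: "\<And>x. \<exists>B. \<forall>f\<in>F. \<bar>f x\<bar> \<le> B"
begin

lemma le_sup_dist: "f \<in> F \<Longrightarrow> \<bar>f x - f y\<bar> \<le> sup_dist F x y"
proof -
  assume f: "f \<in> F"
  obtain B B' where B: "\<forall>f\<in>F. \<bar>f x\<bar> \<le> B" "\<forall>f\<in>F. \<bar>f y\<bar> \<le> B'"
    using bounded by meson
  have "bdd_above ((\<lambda>f. \<bar>f x - f y\<bar>) ` F)"
  proof (rule bdd_aboveI2)
    fix f assume "f \<in> F"
    then have "\<bar>f x\<bar> \<le> B" "\<bar>f y\<bar> \<le> B'"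
      using B by auto
    then show "\<bar>f x - f y\<bar> \<le> B + B'"
      by linarith
  qed
  then show ?thesis
    unfolding sup_dist_def using f by (rule cSUP_upper2) simp
qed

lemma sup_dist_le: "(\<And>f. f \<in> F \<Longrightarrow> \<bar>f x - f y\<bar> \<le> B) \<Longrightarrow> sup_dist F x y \<le> B"
  unfolding sup_dist_def using nonempty by (rule cSUP_least)

lemma sup_dist_nonneg: "0 \<le> sup_dist F x y"
proof -
  obtain f where "f \<in> F" using nonempty by blast
  then show ?thesis
    using le_sup_dist[of f x y] by linarith
qed

lemma sup_dist_same [simp]: "sup_dist F x x = 0"
  using sup_dist_le[of x x 0] sup_dist_nonneg[of x x] by simp

lemma sup_dist_commute: "sup_dist F x y = sup_dist F y x"
  unfolding sup_dist_def by (simp add: abs_minus_commute)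

lemma sup_dist_triangle: "sup_dist F x z \<le> sup_dist F x y + sup_dist F y z"
proof (rule sup_dist_le)
  fix f assume "f \<in> F"
  then show "\<bar>f x - f z\<bar> \<le> sup_dist F x y + sup_dist F y z"
    using le_sup_dist[of f x y] le_sup_dist[of f y z] by linarith
qed

lemma sup_dist_pos: "f \<in> F \<Longrightarrow> f x \<noteq> f y \<Longrightarrow> 0 < sup_dist F x y"
  using le_sup_dist[of f x y] by linarith

end

section \<open>Distances generated by test functions on the manifold and on the cone\<close>

locale compact_riemannian = riemannian +
  assumes comp: "compact (UNIV :: 'a set)" and conn: "connected (UNIV :: 'a set)"
begin

abbreviation d\<^sub>M :: "'a \<Rightarrow> 'a \<Rightarrow> real" where
  "d\<^sub>M \<equiv> sup_dist test_functions"

text \<open>The factor 1/2 is the one from \<open>cone_length_lower_bound\<close>; with it these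
  functions are 1-Lipschitz along curves in the cone.\<close>

definition cone_functions :: "('a \<times> real \<Rightarrow> real) set" where
  "cone_functions = (\<lambda>h z. snd z * h (fst z) / 2) ` test_functions"

abbreviation d\<^sub>C :: "'a \<times> real \<Rightarrow> 'a \<times> real \<Rightarrow> real" where
  "d\<^sub>C \<equiv> sup_dist cone_functions"

sublocale M: bounded_family test_functions
proof
  show "test_functions \<noteq> {}"
    using one_in_test_functions by blast
  show "\<exists>B. \<forall>f\<in>test_functions. \<bar>f x\<bar> \<le> B" for x
    by (rule exI[of _ 1]) (simp add: test_functions_def)
qed

sublocale C: bounded_family cone_functions
proof
  show "cone_functions \<noteq> {}"
    using one_in_test_functions by (auto simp: cone_functions_def)
  show "\<exists>B. \<forall>f\<in>cone_functions. \<bar>f z\<bar> \<le> B" for z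
  proof (intro exI[of _ "\<bar>snd z\<bar>"] ballI)
    fix f assume "f \<in> cone_functions"
    then obtain h where h: "h \<in> test_functions" "f = (\<lambda>z. snd z * h (fst z) / 2)"
      by (auto simp: cone_functions_def)
    then have "\<bar>h (fst z)\<bar> \<le> 1"
      by (simp add: test_functions_def)
    then have "\<bar>snd z\<bar> * \<bar>h (fst z)\<bar> \<le> \<bar>snd z\<bar> * 1"
      by (intro mult_left_mono) auto
    moreover have "\<bar>f z\<bar> = \<bar>snd z\<bar> * \<bar>h (fst z)\<bar> / 2"
      using h(2) by (simp add: abs_mult)
    ultimately show "\<bar>f z\<bar> \<le> \<bar>snd z\<bar>"
      by simp
  qed
qed

lemma d\<^sub>M_pos: "x \<noteq> y \<Longrightarrow> 0 < d\<^sub>M x y"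
  using test_functions_separate[of x y] M.sup_dist_pos by blast

lemma d\<^sub>C_height: "\<bar>snd z - snd w\<bar> \<le> 2 * d\<^sub>C z w"
proof -
  have "(\<lambda>z. snd z * 1 / 2) \<in> cone_functions"
    using one_in_test_functions unfolding cone_functions_def by (intro image_eqI[of _ _ "\<lambda>_. 1"]) auto
  from C.le_sup_dist[OF this, of z w] show ?thesis
    by (simp add: diff_divide_distrib[symmetric])
qed

text \<open>With t and u the heights of z and w, t * (h x - h y) is t * h x - u * h y minus (t - u)
  * h y. Each part costs at most 2 * \<open>d\<^sub>C z w\<close>, the second by the estimate of the
  heights. Thus the base is magnified by the height, up to the factor 4.\<close>

lemma d\<^sub>C_base: "\<bar>snd z\<bar> * d\<^sub>M (fst z) (fst w) \<le> 4 * d\<^sub>C z w"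
proof (cases "snd z = 0")
  case True
  then show ?thesis
    using C.sup_dist_nonneg[of z w] by simp
next
  case False
  have "d\<^sub>M (fst z) (fst w) \<le> 4 * d\<^sub>C z w / \<bar>snd z\<bar>"
  proof (rule M.sup_dist_le)
    fix h assume h: "h \<in> test_functions"
    then have "(\<lambda>z. snd z * h (fst z) / 2) \<in> cone_functions"
      unfolding cone_functions_def by blast
    from C.le_sup_dist[OF this, of z w]
    have 1: "\<bar>snd z * h (fst z) - snd w * h (fst w)\<bar> \<le> 2 * d\<^sub>C z w"
      by (simp add: diff_divide_distrib[symmetric])
    have "\<bar>(snd z - snd w) * h (fst w)\<bar> \<le> \<bar>snd z - snd w\<bar> * 1"
      unfolding abs_mult using h by (intro mult_left_mono) (auto simp: test_functions_def)
    from order_trans[OF this[unfolded mult_1_right] d\<^sub>C_height]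
    have 2: "\<bar>(snd z - snd w) * h (fst w)\<bar> \<le> 2 * d\<^sub>C z w" .
    have "\<bar>snd z\<bar> * \<bar>h (fst z) - h (fst w)\<bar> = \<bar>snd z * (h (fst z) - h (fst w))\<bar>"
      by (simp add: abs_mult)
    also have "\<dots> = \<bar>(snd z * h (fst z) - snd w * h (fst w)) - (snd z - snd w) * h (fst w)\<bar>"
      by (simp add: algebra_simps)
    also have "\<dots> \<le> 2 * d\<^sub>C z w + 2 * d\<^sub>C z w"
      by (rule order_trans[OF abs_triangle_ineq4 add_mono[OF 1 2]])
    also have "\<dots> = 4 * d\<^sub>C z w"
      by simp
    finally show "\<bar>h (fst z) - h (fst w)\<bar> \<le> 4 * d\<^sub>C z w / \<bar>snd z\<bar>"
      using False by (simp add: field_simps)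
  qed
  then show ?thesis
    using False by (simp add: field_simps)
qed

lemma d\<^sub>C_metric: "Metric_space open_cone d\<^sub>C"
proof
  fix z w :: "'a \<times> real" assume z: "z \<in> open_cone" "w \<in> open_cone"
  show "d\<^sub>C z w = 0 \<longleftrightarrow> z = w"
  proof
    assume 0: "d\<^sub>C z w = 0"
    have "snd z = snd w"
      using d\<^sub>C_height[of z w] 0 by simp
    moreover have "d\<^sub>M (fst z) (fst w) \<le> 0"
      using d\<^sub>C_base[of z w] 0 z by (auto simp: open_cone_def mult_le_0_iff)
    then have "fst z = fst w"
      using d\<^sub>M_pos[of "fst z" "fst w"] by fastforce
    ultimately show "z = w"
      by (simp add: prod_eq_iff)
  qed simp
qed (auto simp: C.sup_dist_nonneg C.sup_dist_commute C.sup_dist_triangle)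

lemma d\<^sub>C_le_cone_length:
  assumes "piecewise_C1_curve \<A> \<gamma>" "valid_path \<tau>" "\<forall>t\<in>{0..1}. \<tau> t \<ge> 1"
  shows "ennreal (d\<^sub>C (\<gamma> 0, \<tau> 0) (\<gamma> 1, \<tau> 1)) \<le> cone_length \<A> g \<gamma> \<tau>"
proof (cases "cone_length \<A> g \<gamma> \<tau>")
  case (real l)
  have "d\<^sub>C (\<gamma> 0, \<tau> 0) (\<gamma> 1, \<tau> 1) \<le> l"
  proof (rule C.sup_dist_le)
    fix f assume "f \<in> cone_functions"
    then obtain h where h: "h \<in> test_functions" "f = (\<lambda>z. snd z * h (fst z) / 2)"
      by (auto simp: cone_functions_def)
    have "ennreal (\<bar>\<tau> 1 * h (\<gamma> 1) - \<tau> 0 * h (\<gamma> 0)\<bar> / 2) \<le> ennreal l"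
      using cone_length_lower_bound[OF h(1) assms] real by simp
    then have "\<bar>\<tau> 1 * h (\<gamma> 1) - \<tau> 0 * h (\<gamma> 0)\<bar> / 2 \<le> l"
      using real(1) by simp
    then show "\<bar>f (\<gamma> 0, \<tau> 0) - f (\<gamma> 1, \<tau> 1)\<bar> \<le> l"
      unfolding h(2) by (simp add: abs_minus_commute diff_divide_distrib[symmetric])
  qed
  then show ?thesis
    using real by (simp add: ennreal_leI)
qed simp

abbreviation cone_paths :: "'a \<times> real \<Rightarrow> 'a \<times> real \<Rightarrow> ((real \<Rightarrow> 'a) \<times> (real \<Rightarrow> real)) set" where
  "cone_paths z w \<equiv> {(\<gamma>, \<tau>). piecewise_C1_curve \<A> \<gamma> \<and> valid_path \<tau> \<and>
         (\<forall>t\<in>{0..1}. \<tau> t \<ge> 1) \<and> (\<gamma> 0, \<tau> 0) = z \<and> (\<gamma> 1, \<tau> 1) = w}"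

lemma cone_length_joinable:
  assumes "joinable L x y" "0 \<le> L" "1 \<le> t" "1 \<le> u"
  shows "(INF (\<gamma>, \<tau>)\<in>cone_paths (x, t) (y, u). cone_length \<A> g \<gamma> \<tau>)
    \<le> ennreal (sqrt ((max t u)\<^sup>2 * L\<^sup>2 + (u - t)\<^sup>2))"
proof -
  obtain \<gamma> K where \<gamma>: "piecewise_C1_curve \<A> \<gamma>" "\<gamma> 0 = x" "\<gamma> 1 = y" "finite K"
      "\<forall>t\<in>{0..1} - K. speed \<A> g \<gamma> t \<le> L"
    using assms(1) unfolding joinable_def by auto
  define \<tau> where "\<tau> s = t + s * (u - t)" for s
  have conv: "\<tau> s = (1 - s) * t + s * u" for s
    by (simp add: \<tau>_def algebra_simps)
  have \<tau>1: "1 \<le> \<tau> s" "\<tau> s \<le> max t u" if "s \<in> {0..1}" for s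
  proof -
    have "(1 - s) * 1 + s * 1 \<le> (1 - s) * t + s * u"
      using that assms by (intro add_mono mult_left_mono) auto
    then show "1 \<le> \<tau> s"
      by (simp add: conv)
    have "(1 - s) * t + s * u \<le> (1 - s) * max t u + s * max t u"
      using that by (intro add_mono mult_left_mono) auto
    also have "\<dots> = max t u"
      by (simp add: algebra_simps)
    finally show "\<tau> s \<le> max t u"
      by (simp add: conv)
  qed
  have der: "(\<tau> has_vector_derivative (u - t)) (at s)" for s
    unfolding \<tau>_def[abs_def] has_real_derivative_iff_has_vector_derivative[symmetric]
    by (auto intro!: derivative_eq_intros)
  have "\<tau> C1_differentiable_on {0..1}"
    unfolding C1_differentiable_on_def using der by (intro exI[of _ "\<lambda>_. u - t"]) auto
  then have "valid_path \<tau>"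
    unfolding valid_path_def by (rule C1_differentiable_imp_piecewise)
  then have "(\<gamma>, \<tau>) \<in> cone_paths (x, t) (y, u)"
    using \<gamma> \<tau>1 by (auto simp: \<tau>_def)
  then have "(INF (\<gamma>, \<tau>)\<in>cone_paths (x, t) (y, u). cone_length \<A> g \<gamma> \<tau>) \<le> cone_length \<A> g \<gamma> \<tau>"
    by (rule INF_lower2) simp
  also have "\<dots> \<le> ennreal (sqrt ((max t u)\<^sup>2 * L\<^sup>2 + (u - t)\<^sup>2))"
  proof (rule cone_length_le[OF \<gamma>(4,5) assms(2) _ der])
    show "0 \<le> \<tau> s \<and> \<tau> s \<le> max t u" if "s \<in> {0..1}" for s
      using \<tau>1[OF that] by auto
  qed
  finally show ?thesis .
qed

lemma joinable_mono: "joinable L x y \<Longrightarrow> L \<le> L' \<Longrightarrow> joinable L' x y"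
proof -
  assume j: "joinable L x y" and le: "L \<le> L'"
  obtain \<gamma> K where \<gamma>: "piecewise_C1_curve \<A> \<gamma>" "\<gamma> 0 = x" "\<gamma> 1 = y" "finite K"
      "\<forall>t\<in>{0..1} - K. speed \<A> g \<gamma> t \<le> L"
    using j unfolding joinable_def by auto
  then have "\<forall>t\<in>{0..1} - K. speed \<A> g \<gamma> t \<le> L'"
    using le by force
  then show "joinable L' x y"
    unfolding joinable_def using \<gamma> by blast
qed

text \<open>The bound holds for each curve and thus for the infimum in [0,\<infinity>]. To survive
  \<open>enn2real\<close> the infimum has to be finite, and a curve of bounded speed between the
  base points, with linear height, shows that it is.\<close>

lemma d\<^sub>C_le_cone_dist:
  assumes "z \<in> open_cone" "w \<in> open_cone"
  shows "d\<^sub>C z w \<le> cone_dist \<A> g z w"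
proof -
  obtain x t y u where zw: "z = (x, t)" "w = (y, u)" "1 \<le> t" "1 \<le> u"
    using assms by (auto simp: open_cone_def)
  let ?I = "INF (\<gamma>, \<tau>)\<in>cone_paths z w. cone_length \<A> g \<gamma> \<tau>"
  obtain L where L: "joinable L x y"
    using connected_imp_joinable[OF conn] by blast
  have "joinable (max 0 L) x y"
    by (rule joinable_mono[OF L]) simp
  then have "?I \<le> ennreal (sqrt ((max t u)\<^sup>2 * (max 0 L)\<^sup>2 + (u - t)\<^sup>2))"
    unfolding zw(1,2) by (intro cone_length_joinable zw) simp_all
  then have fin: "?I < \<infinity>"
    by (rule le_less_trans) simp
  have "ennreal (d\<^sub>C z w) \<le> ?I"
    by (rule INF_greatest) (use d\<^sub>C_le_cone_length in auto)
  then have "enn2real (ennreal (d\<^sub>C z w)) \<le> enn2real ?I"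
    using fin by (intro enn2real_mono) simp_all
  then show ?thesis
    using C.sup_dist_nonneg by (simp add: cone_dist_def)
qed

lemma cone_dist_joinable:
  assumes "joinable L x y" "0 \<le> L" "1 \<le> t"
  shows "cone_dist \<A> g (x, t) (y, t) \<le> t * L"
proof -
  have "enn2real (INF (\<gamma>, \<tau>)\<in>cone_paths (x, t) (y, t). cone_length \<A> g \<gamma> \<tau>)
      \<le> enn2real (ennreal (sqrt ((max t t)\<^sup>2 * L\<^sup>2 + (t - t)\<^sup>2)))"
    using cone_length_joinable[OF assms(1,2,3,3)] by (rule enn2real_mono) simp
  also have "\<dots> = t * L"
    using assms by (simp add: real_sqrt_mult)
  finally show ?thesis
    by (simp add: cone_dist_def)
qed

text \<open>Read off at height 1 of the cone, which spares a separate estimate for curves in the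
  manifold.\<close>

lemma d\<^sub>M_joinable:
  assumes "joinable L x y" "0 \<le> L"
  shows "d\<^sub>M x y \<le> 4 * L"
  using d\<^sub>C_base[of "(x, 1)" "(y, 1)"] d\<^sub>C_le_cone_dist[of "(x, 1)" "(y, 1)"]
    cone_dist_joinable[OF assms, of 1] by (simp add: open_cone_def)

section \<open>The topology of the test-function distance and uniform estimates by
  compactness\<close>

lemma open_d\<^sub>M_ball: "open {y. d\<^sub>M x y < r}"
proof (subst open_subopen, intro ballI)
  fix y assume "y \<in> {y. d\<^sub>M x y < r}"
  then have y: "(r - d\<^sub>M x y) / 8 > 0"
    by simp
  obtain U where U: "open U" "y \<in> U" "\<forall>z\<in>U. \<forall>w\<in>U. joinable ((r - d\<^sub>M x y) / 8) z w"
    using locally_joinable[OF y] by blast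
  have "U \<subseteq> {y. d\<^sub>M x y < r}"
  proof
    fix z assume "z \<in> U"
    then have "d\<^sub>M y z \<le> 4 * ((r - d\<^sub>M x y) / 8)"
      using U y by (intro d\<^sub>M_joinable) auto
    then have "d\<^sub>M x z < r"
      using M.sup_dist_triangle[of x z y] y by simp
    then show "z \<in> {y. d\<^sub>M x y < r}" by simp
  qed
  then show "\<exists>T. open T \<and> y \<in> T \<and> T \<subseteq> {y. d\<^sub>M x y < r}"
    using U by blast
qed

text \<open>The complement of U is compact and, since \<open>d\<^sub>M\<close> is definite, covered
  by the increasing open sets of points at distance more than 1/(n+1) from x. One of them contains
  it. Together with \<open>open_d\<^sub>M_ball\<close> this identifies the topology of
  \<open>d\<^sub>M\<close> with that of the manifold.\<close>

lemma d\<^sub>M_ball_subset: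
  assumes "open U" "x \<in> U"
  shows "\<exists>r>0. {y. d\<^sub>M x y < r} \<subseteq> U"
proof (rule ccontr)
  assume no: "\<not> ?thesis"
  have comp': "compact (- U)"
    using compact_Int_closed[OF comp, of "- U"] \<open>open U\<close> by auto
  let ?V = "\<lambda>n::nat. - {y. d\<^sub>M x y \<le> 1 / Suc n}"
  have clV: "open (?V n)" for n
  proof (subst open_subopen, intro ballI)
    fix y assume y: "y \<in> ?V n"
    have "{z. d\<^sub>M y z < d\<^sub>M x y - 1 / Suc n} \<subseteq> ?V n"
    proof
      fix z assume "z \<in> {z. d\<^sub>M y z < d\<^sub>M x y - 1 / Suc n}"
      then show "z \<in> ?V n"
        using M.sup_dist_triangle[of x y z] M.sup_dist_commute[of z y] by simp
    qed
    then show "\<exists>T. open T \<and> y \<in> T \<and> T \<subseteq> ?V n"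
      using open_d\<^sub>M_ball y by (intro exI[of _ "{z. d\<^sub>M y z < d\<^sub>M x y - 1 / Suc n}"]) auto
  qed
  have "- U \<subseteq> (\<Union>n\<in>UNIV. ?V n)"
  proof
    fix y assume "y \<in> - U"
    then have "0 < d\<^sub>M x y"
      using assms(2) by (intro d\<^sub>M_pos) auto
    then obtain n where "inverse (real (Suc n)) < d\<^sub>M x y"
      using reals_Archimedean by blast
    then show "y \<in> (\<Union>n\<in>UNIV. ?V n)"
      by (auto simp: inverse_eq_divide not_le)
  qed
  then obtain T where T: "finite T" "- U \<subseteq> (\<Union>n\<in>T. ?V n)"
    using compactE_image[OF comp', of UNIV ?V] clV by (metis (no_types, lifting))
  \<comment> \<open>Inserting 0 covers the case of an empty T, that is, of U being the whole
    space.\<close>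
  define N where "N = Max (insert 0 T)"
  have "{y. d\<^sub>M x y < 1 / Suc N} \<subseteq> U"
  proof
    fix y assume y: "y \<in> {y. d\<^sub>M x y < 1 / Suc N}"
    show "y \<in> U"
    proof (rule ccontr)
      assume "y \<notin> U"
      then obtain n where "n \<in> T" "y \<in> ?V n"
        using T(2) by blast
      then have n: "n \<in> T" "d\<^sub>M x y > 1 / Suc n"
        by (simp_all add: not_le)
      have "n \<le> N"
        using T(1) n(1) by (simp add: N_def)
      then have "1 / Suc N \<le> 1 / Suc n"
        by (intro divide_left_mono) auto
      then show False
        using y n(2) by simp
    qed
  qed
  then show False
    using no by (metis of_nat_0_less_iff zero_less_Suc zero_less_divide_1_iff)
qed

text \<open>The usual argument: half-radius balls form a finite cover, and the least of the half
  radii leaves room for the triangle inequality. The finite set of centres is independent of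
  x.\<close>

lemma lebesgue_number:
  assumes U: "\<And>p. open (U p)" "\<And>p. p \<in> U p"
  shows "\<exists>\<delta>>0. \<exists>T. finite T \<and> (\<forall>x. \<exists>p\<in>T. {y. d\<^sub>M x y < \<delta>} \<subseteq> U p)"
proof -
  have "\<forall>p. \<exists>r>0. {y. d\<^sub>M p y < r} \<subseteq> U p"
    using d\<^sub>M_ball_subset U by blast
  then obtain r where r: "\<And>p. r p > 0" "\<And>p. {y. d\<^sub>M p y < r p} \<subseteq> U p"
    by metis
  have "p \<in> {y. d\<^sub>M p y < r p / 2}" for p
    using r(1)[of p] by simp
  from compact_UNIV_finite_subcover[OF comp, of "\<lambda>p. {y. d\<^sub>M p y < r p / 2}", OF open_d\<^sub>M_ball this]
  obtain T where T: "finite T" "(\<Union>p\<in>T. {y. d\<^sub>M p y < r p / 2}) = UNIV"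
    by blast
  have "T \<noteq> {}"
    using T(2) by auto
  define \<delta> where "\<delta> = Min ((\<lambda>p. r p / 2) ` T)"
  have \<delta>: "\<delta> > 0" "\<And>p. p \<in> T \<Longrightarrow> \<delta> \<le> r p / 2"
    unfolding \<delta>_def using T(1) \<open>T \<noteq> {}\<close> r(1) by (simp, intro Min_le finite_imageI imageI)
  have "\<exists>p\<in>T. {y. d\<^sub>M x y < \<delta>} \<subseteq> U p" for x
  proof -
    obtain p where p: "p \<in> T" "d\<^sub>M p x < r p / 2"
      using T(2) by blast
    have "{y. d\<^sub>M x y < \<delta>} \<subseteq> {y. d\<^sub>M p y < r p}"
      using \<delta>(2)[OF p(1)] p(2) by (auto intro: le_less_trans[OF M.sup_dist_triangle[of p _ x]])
    then show ?thesis
      using r(2) p(1) by blast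
  qed
  then show ?thesis
    using \<delta>(1) T(1) by blast
qed

lemma uniform_small_balls:
  assumes \<epsilon>: "\<epsilon> > 0"
  shows "\<exists>\<delta>>0. \<forall>x. emeasure \<nu> {y. d\<^sub>M x y < \<delta>} \<le> ennreal \<epsilon>"
proof -
  obtain U where U: "\<And>p. open (U p)" "\<And>p. p \<in> U p" "\<And>p. emeasure \<nu> (U p) \<le> ennreal \<epsilon>"
    using small_nbhd[OF comp \<epsilon>] by metis
  obtain \<delta> T where \<delta>: "\<delta> > 0" "\<And>x. \<exists>p\<in>T. {y. d\<^sub>M x y < \<delta>} \<subseteq> U p"
    using lebesgue_number[of U, OF U(1,2)] by metis
  have "emeasure \<nu> {y. d\<^sub>M x y < \<delta>} \<le> ennreal \<epsilon>" for x
  proof -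
    obtain p where "{y. d\<^sub>M x y < \<delta>} \<subseteq> U p"
      using \<delta>(2) by blast
    then have "emeasure \<nu> {y. d\<^sub>M x y < \<delta>} \<le> emeasure \<nu> (U p)"
      using U(1) sets_riemannian_measure[OF comp] by (intro emeasure_mono) auto
    then show ?thesis
      using U(3) by (rule order_trans)
  qed
  then show ?thesis
    using \<delta>(1) by blast
qed

text \<open>A Lebesgue number of the cover by preimages of balls of radius \<epsilon> / 2 serves as
  the modulus.\<close>

lemma uniformly_continuous_d\<^sub>M:
  assumes f: "continuous_on UNIV f" and \<epsilon>: "\<epsilon> > 0"
  shows "\<exists>\<delta>>0. \<forall>x y. d\<^sub>M x y < \<delta> \<longrightarrow> d\<^sub>M (f x) (f y) < \<epsilon>"
proof -
  let ?U = "\<lambda>p. f -` {y. d\<^sub>M (f p) y < \<epsilon> / 2}"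
  have "open (?U p)" for p
    using open_vimage[OF open_d\<^sub>M_ball f] .
  moreover have "p \<in> ?U p" for p
    using \<epsilon> by simp
  ultimately obtain \<delta> T where \<delta>: "\<delta> > 0" "\<And>x. \<exists>p\<in>T. {y. d\<^sub>M x y < \<delta>} \<subseteq> ?U p"
    using lebesgue_number[of ?U] by metis
  have "d\<^sub>M (f x) (f y) < \<epsilon>" if "d\<^sub>M x y < \<delta>" for x y
  proof -
    obtain p where p: "{y. d\<^sub>M x y < \<delta>} \<subseteq> ?U p"
      using \<delta>(2) by blast
    have "d\<^sub>M (f p) (f x) < \<epsilon> / 2" "d\<^sub>M (f p) (f y) < \<epsilon> / 2"
      using subsetD[OF p, of x] subsetD[OF p, of y] \<delta>(1) that by simp_all
    then show ?thesis
      using M.sup_dist_triangle[of "f x" "f y" "f p"] M.sup_dist_commute[of "f x" "f p"] by linarith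
  qed
  then show ?thesis
    using \<delta>(1) by blast
qed

end

section \<open>A Poincare inequality for weighted expanders\<close>

text \<open>Choose k with 1 - (1 - k)^p < \<epsilon>. If the gap b - a is at least k * b, then b
  itself is at most (b - a) / k; if it is smaller, then a > (1 - k) * b and the difference of the
  powers is below \<epsilon> * b^p.\<close>

lemma powr_diff_le:
  fixes p \<epsilon> :: real
  assumes p: "1 \<le> p" and \<epsilon>: "0 < \<epsilon>"
  shows "\<exists>C\<ge>0. \<forall>a b. 0 \<le> a \<longrightarrow> a \<le> b \<longrightarrow> b powr p - a powr p \<le> C * (b - a) powr p + \<epsilon> * b powr p"
proof -
  have "((\<lambda>k. 1 - (1 - k) powr p) \<longlongrightarrow> 1 - (1 - 0) powr p) (at_right (0::real))"
    by (intro tendsto_intros) auto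
  moreover have "1 - (1 - 0) powr p < \<epsilon>"
    using \<epsilon> by simp
  ultimately have "\<forall>\<^sub>F k in at_right 0. 1 - (1 - k) powr p < \<epsilon>"
    by (rule order_tendstoD(2))
  moreover have "\<forall>\<^sub>F k in at_right 0. k \<in> {0<..<1::real}"
    by (rule eventually_at_right_real) simp
  ultimately have "\<forall>\<^sub>F k in at_right 0. 1 - (1 - k) powr p < \<epsilon> \<and> k \<in> {0<..<1}"
    by (rule eventually_conj)
  then obtain k where k: "1 - (1 - k) powr p < \<epsilon>" "0 < k" "k < 1"
    using eventually_happens'[OF trivial_limit_at_right_real] by force
  have "b powr p - a powr p \<le> (1 / k) powr p * (b - a) powr p + \<epsilon> * b powr p"
    if ab: "0 \<le> a" "a \<le> b" for a b
  proof (cases "k * b \<le> b - a")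
    case True
    have "b \<le> (1 / k) * (b - a)"
      using True k by (simp add: field_simps)
    then have "b powr p \<le> ((1 / k) * (b - a)) powr p"
      using ab p by (intro powr_mono2) auto
    also have "\<dots> = (1 / k) powr p * (b - a) powr p"
      by (rule powr_mult)
    finally have "b powr p \<le> (1 / k) powr p * (b - a) powr p" .
    moreover have "0 \<le> a powr p" "0 \<le> \<epsilon> * b powr p"
      using \<epsilon> by auto
    ultimately show ?thesis
      by linarith
  next
    case False
    then have "(1 - k) * b \<le> a"
      by (simp add: algebra_simps)
    then have "((1 - k) * b) powr p \<le> a powr p"
      using ab k p by (intro powr_mono2) auto
    moreover have "((1 - k) * b) powr p = (1 - k) powr p * b powr p"
      by (rule powr_mult)
    ultimately have "b powr p - a powr p \<le> (1 - (1 - k) powr p) * b powr p"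
      by (simp add: algebra_simps)
    also have "\<dots> \<le> \<epsilon> * b powr p"
      using k by (intro mult_right_mono) auto
    also have "\<dots> \<le> (1 / k) powr p * (b - a) powr p + \<epsilon> * b powr p"
      by simp
    finally show ?thesis .
  qed
  then show ?thesis
    by (intro exI[of _ "(1 / k) powr p"]) auto
qed

lemma abs_diff_powr_le:
  fixes x y p :: real
  assumes "0 \<le> p"
  shows "\<bar>x - y\<bar> powr p \<le> 2 powr p * (\<bar>x\<bar> powr p + \<bar>y\<bar> powr p)"
proof -
  have "\<bar>x - y\<bar> powr p \<le> (2 * max \<bar>x\<bar> \<bar>y\<bar>) powr p"
    using assms by (intro powr_mono2) auto
  also have "\<dots> = 2 powr p * (max \<bar>x\<bar> \<bar>y\<bar>) powr p"
    by (rule powr_mult)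
  also have "\<dots> \<le> 2 powr p * (\<bar>x\<bar> powr p + \<bar>y\<bar> powr p)"
    by (intro mult_left_mono) (auto simp: max_def)
  finally show ?thesis .
qed

text \<open>Take the least value c of a with at most half of the mass strictly above it. If more
  than half lay below c, the largest value below c would, by minimality of c, have more than half
  strictly above it; these two sets are disjoint and together exceed the total mass.\<close>

lemma ex_weighted_median:
  fixes m a :: "'i \<Rightarrow> real"
  assumes I: "finite I" and m: "\<And>i. i \<in> I \<Longrightarrow> 0 \<le> m i"
  shows "\<exists>c. 2 * sum m {i\<in>I. a i > c} \<le> sum m I \<and> 2 * sum m {i\<in>I. a i < c} \<le> sum m I"
proof (cases "I = {}")
  case False
  let ?Q = "{i\<in>I. 2 * sum m {j\<in>I. a j > a i} \<le> sum m I}"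
  obtain k where k: "k \<in> I" "\<And>i. i \<in> I \<Longrightarrow> a i \<le> a k"
    using Max_in[of "a ` I"] Max_ge[of "a ` I"] I False by fastforce
  have "{j\<in>I. a j > a k} = {}"
    using k by (auto simp: not_less)
  then have "2 * sum m {j\<in>I. a j > a k} \<le> sum m I"
    using m by (simp only: sum.empty mult_zero_right sum_nonneg)
  then have "k \<in> ?Q"
    using k by blast
  then have Q: "finite (a ` ?Q)" "a ` ?Q \<noteq> {}"
    using I by auto
  define c where "c = Min (a ` ?Q)"
  obtain i0 where i0: "i0 \<in> ?Q" "c = a i0"
    using Min_in[OF Q] unfolding c_def by auto
  have "2 * sum m {i\<in>I. a i < c} \<le> sum m I"
  proof (rule ccontr)
    assume big: "\<not> ?thesis"
    let ?L = "{i\<in>I. a i < c}"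
    have "?L \<noteq> {}"
      using big m by (metis (no_types, lifting) mult_zero_right sum.empty sum_nonneg)
    then obtain l where l: "l \<in> ?L" "\<And>i. i \<in> ?L \<Longrightarrow> a i \<le> a l"
      using Max_in[of "a ` ?L"] Max_ge[of "a ` ?L"] I by fastforce
    have "l \<notin> ?Q"
      using l(1) Min_le[OF Q(1), of "a l"] unfolding c_def by auto
    then have "2 * sum m {j\<in>I. a j > a l} > sum m I"
      using l(1) by auto
    moreover have "sum m {j\<in>I. a j > a l} + sum m ?L = sum m ({j\<in>I. a j > a l} \<union> ?L)"
    proof (rule sum.union_disjoint[symmetric])
      show "{j\<in>I. a j > a l} \<inter> ?L = {}"
        using l(2) leD by blast
    qed (use I in auto)
    moreover have "\<dots> \<le> sum m I"
      using I m by (intro sum_mono2) auto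
    ultimately show False
      using big by linarith
  qed
  then show ?thesis
    using i0 by blast
qed simp

text \<open>A discrete model of the action: m i is the mass of the piece i and w i j the mass that
  the generators carry from the piece i into the piece j. Expansion becomes a lower bound for the
  flow out of J, bounded distortion a bound for the row sums.\<close>

locale weighted_expander =
  fixes I :: "'i set" and m :: "'i \<Rightarrow> real" and w :: "'i \<Rightarrow> 'i \<Rightarrow> real" and \<alpha> D :: real
  assumes finite_I: "finite I" and m_nonneg: "\<And>i. i \<in> I \<Longrightarrow> 0 \<le> m i"
    and w_nonneg: "\<And>i j. i \<in> I \<Longrightarrow> j \<in> I \<Longrightarrow> 0 \<le> w i j"
    and \<alpha>_pos: "0 < \<alpha>" and D_nonneg: "0 \<le> D"
    and expansion: "\<And>J. J \<subseteq> I \<Longrightarrow> 2 * sum m J \<le> sum m I \<Longrightarrow>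
      \<alpha> * sum m J \<le> (\<Sum>i\<in>J. \<Sum>j\<in>I - J. w i j)"
    and row_sum: "\<And>i. i \<in> I \<Longrightarrow> (\<Sum>j\<in>I. w i j) \<le> D * m i"
begin

text \<open>Induction on the support: subtracting the least positive value from a positive function
  removes one superlevel set, to which the expansion hypothesis applies.\<close>

lemma coarea_inequality:
  assumes "\<And>i. i \<in> I \<Longrightarrow> 0 \<le> b i" "2 * sum m {i\<in>I. b i > 0} \<le> sum m I"
  shows "\<alpha> * (\<Sum>i\<in>I. m i * b i) \<le> (\<Sum>i\<in>I. \<Sum>j\<in>I. w i j * max 0 (b i - b j))"
  using assms
proof (induction "card {i\<in>I. b i > 0}" arbitrary: b rule: less_induct)
  case less
  let ?J = "{i\<in>I. b i > 0}"
  have rhs: "0 \<le> (\<Sum>i\<in>I. \<Sum>j\<in>I. w i j * max 0 (b i - b j))"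
    using w_nonneg by (intro sum_nonneg mult_nonneg_nonneg) auto
  show ?case
  proof (cases "?J = {}")
    case True
    then have "b i = 0" if "i \<in> I" for i
      using that less.prems(1)[OF that] by (auto simp: less_le)
    then show ?thesis
      using rhs by simp
  next
    case False
    define \<beta> where "\<beta> = Min (b ` ?J)"
    have fin: "finite (b ` ?J)" "b ` ?J \<noteq> {}"
      using finite_I False by auto
    obtain k where k: "k \<in> ?J" "\<beta> = b k"
      using Min_in[OF fin] unfolding \<beta>_def by auto
    have \<beta>: "\<beta> > 0" "\<And>i. i \<in> ?J \<Longrightarrow> \<beta> \<le> b i"
      using k Min_le[OF fin(1)] unfolding \<beta>_def by auto
    define b' where "b' i = (if i \<in> ?J then b i - \<beta> else 0)" for i
    have b0: "b i = 0" if "i \<in> I - ?J" for i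
      using that less.prems(1)[of i] by (auto simp: less_le)
    have sub: "{i\<in>I. b' i > 0} \<subseteq> ?J - {k}"
      using k by (auto simp: b'_def split: if_splits)
    have IH: "\<alpha> * (\<Sum>i\<in>I. m i * b' i) \<le> (\<Sum>i\<in>I. \<Sum>j\<in>I. w i j * max 0 (b' i - b' j))"
    proof (rule less.hyps)
      have "{i\<in>I. b' i > 0} \<subset> ?J"
        using sub k(1) by blast
      then show "card {i\<in>I. b' i > 0} < card ?J"
        using finite_I by (intro psubset_card_mono) auto
      show "0 \<le> b' i" if "i \<in> I" for i
        using \<beta>(2)[of i] that by (auto simp: b'_def)
      have "sum m {i\<in>I. b' i > 0} \<le> sum m ?J"
        using finite_I sub m_nonneg by (intro sum_mono2) auto
      then show "2 * sum m {i\<in>I. b' i > 0} \<le> sum m I"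
        using less.prems(2) by linarith
    qed
    have lhs: "(\<Sum>i\<in>I. m i * b i) = (\<Sum>i\<in>I. m i * b' i) + \<beta> * sum m ?J"
    proof -
      have "(\<Sum>i\<in>I. m i * b i) = (\<Sum>i\<in>I. m i * b' i + (if i \<in> ?J then \<beta> * m i else 0))"
        using b0 by (intro sum.cong) (auto simp: b'_def algebra_simps)
      also have "\<dots> = (\<Sum>i\<in>I. m i * b' i) + (\<Sum>i\<in>I. if i \<in> ?J then \<beta> * m i else 0)"
        by (rule sum.distrib)
      also have "(\<Sum>i\<in>I. if i \<in> ?J then \<beta> * m i else 0) = (\<Sum>i\<in>?J. \<beta> * m i)"
        using finite_I by (intro sum.mono_neutral_cong_right) auto
      finally show ?thesis
        by (simp add: sum_distrib_left)
    qed
    \<comment> \<open>Lowering b by \<beta> on its support changes a positive difference only for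
      pairs that lead out of the support. These pairs are exactly what the expansion hypothesis
      counts.\<close>
    have split: "max 0 (b i - b j) = max 0 (b' i - b' j) + (if i \<in> ?J \<and> j \<notin> ?J then \<beta> else 0)"
      if "i \<in> I" "j \<in> I" for i j
      using b0[of i] b0[of j] \<beta>(2)[of i] \<beta>(2)[of j] \<beta>(1) that by (auto simp: b'_def max_def)
    have "(\<Sum>i\<in>I. \<Sum>j\<in>I. w i j * max 0 (b i - b j))
        = (\<Sum>i\<in>I. \<Sum>j\<in>I. w i j * max 0 (b' i - b' j) + (if i \<in> ?J \<and> j \<notin> ?J then \<beta> * w i j else 0))"
      by (intro sum.cong refl) (auto simp: split algebra_simps)
    also have "\<dots> = (\<Sum>i\<in>I. \<Sum>j\<in>I. w i j * max 0 (b' i - b' j))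
        + (\<Sum>i\<in>I. \<Sum>j\<in>I. if i \<in> ?J \<and> j \<notin> ?J then \<beta> * w i j else 0)"
      by (simp add: sum.distrib)
    also have "(\<Sum>i\<in>I. \<Sum>j\<in>I. if i \<in> ?J \<and> j \<notin> ?J then \<beta> * w i j else 0)
        = (\<Sum>i\<in>?J. \<Sum>j\<in>I - ?J. \<beta> * w i j)"
      using finite_I by (intro sum.mono_neutral_cong_right) auto
    also have "\<dots> = \<beta> * (\<Sum>i\<in>?J. \<Sum>j\<in>I - ?J. w i j)"
      by (simp add: sum_distrib_left)
    finally have rhs: "(\<Sum>i\<in>I. \<Sum>j\<in>I. w i j * max 0 (b i - b j))
        = (\<Sum>i\<in>I. \<Sum>j\<in>I. w i j * max 0 (b' i - b' j)) + \<beta> * (\<Sum>i\<in>?J. \<Sum>j\<in>I - ?J. w i j)" .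
    have "\<beta> * (\<alpha> * sum m ?J) \<le> \<beta> * (\<Sum>i\<in>?J. \<Sum>j\<in>I - ?J. w i j)"
      using \<beta>(1) less.prems(2) by (intro mult_left_mono expansion) auto
    then show ?thesis
      using IH unfolding lhs rhs by (simp only: distrib_left mult.left_commute)
  qed
qed

text \<open>The coarea inequality is applied to the p-th power of the positive part. The elementary
  inequality C leaves the error \<alpha> / (2 * (D + 1)) * b i, which after summation against w is
  at most \<alpha> * D / (2 * (D + 1)) times the left sum, by the row sums, and hence is absorbed by
  half of the left side.\<close>

lemma poincare_positive_part:
  assumes "0 \<le> C" and C: "\<And>a b. 0 \<le> a \<Longrightarrow> a \<le> b \<Longrightarrow>
      b powr p - a powr p \<le> C * (b - a) powr p + \<alpha> / (2 * (D + 1)) * b powr p"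
    and p: "1 \<le> p" and med: "2 * sum m {i\<in>I. a i > 0} \<le> sum m I"
  shows "\<alpha> / 2 * (\<Sum>i\<in>I. m i * max 0 (a i) powr p) \<le> C * (\<Sum>i\<in>I. \<Sum>j\<in>I. w i j * \<bar>a i - a j\<bar> powr p)"
proof -
  let ?b = "\<lambda>i. max 0 (a i) powr p" and ?\<epsilon> = "\<alpha> / (2 * (D + 1))"
  have \<epsilon>: "0 \<le> ?\<epsilon>"
    using \<alpha>_pos D_nonneg by simp
  have pt: "max 0 (?b i - ?b j) \<le> C * \<bar>a i - a j\<bar> powr p + ?\<epsilon> * ?b i" for i j
  proof (cases "max 0 (a j) \<le> max 0 (a i)")
    case True
    have "?b i - ?b j \<le> C * (max 0 (a i) - max 0 (a j)) powr p + ?\<epsilon> * ?b i"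
      using True by (intro C) auto
    also have "(max 0 (a i) - max 0 (a j)) powr p \<le> \<bar>a i - a j\<bar> powr p"
      using True p by (intro powr_mono2) auto
    then have "C * (max 0 (a i) - max 0 (a j)) powr p \<le> C * \<bar>a i - a j\<bar> powr p"
      using \<open>0 \<le> C\<close> by (rule mult_left_mono)
    finally have "?b i - ?b j \<le> C * \<bar>a i - a j\<bar> powr p + ?\<epsilon> * ?b i"
      by simp
    moreover have "0 \<le> C * \<bar>a i - a j\<bar> powr p" "0 \<le> ?\<epsilon> * ?b i"
      using \<open>0 \<le> C\<close> \<epsilon> by (simp_all only: mult_nonneg_nonneg powr_ge_zero)
    ultimately show ?thesis
      by simp
  next
    case False
    then have "?b i \<le> ?b j"
      using p by (intro powr_mono2) auto
    moreover have "0 \<le> C * \<bar>a i - a j\<bar> powr p" "0 \<le> ?\<epsilon> * ?b i"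
      using \<open>0 \<le> C\<close> \<epsilon> by (simp_all only: mult_nonneg_nonneg powr_ge_zero)
    ultimately show ?thesis
      by simp
  qed
  have "{i\<in>I. ?b i > 0} = {i\<in>I. a i > 0}"
    by (auto simp: max_def)
  then have "\<alpha> * (\<Sum>i\<in>I. m i * ?b i) \<le> (\<Sum>i\<in>I. \<Sum>j\<in>I. w i j * max 0 (?b i - ?b j))"
    using med by (intro coarea_inequality) auto
  also have "\<dots> \<le> (\<Sum>i\<in>I. \<Sum>j\<in>I. w i j * (C * \<bar>a i - a j\<bar> powr p + ?\<epsilon> * ?b i))"
    using pt w_nonneg by (intro sum_mono mult_left_mono) auto
  also have "\<dots> = C * (\<Sum>i\<in>I. \<Sum>j\<in>I. w i j * \<bar>a i - a j\<bar> powr p)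
      + ?\<epsilon> * (\<Sum>i\<in>I. ?b i * (\<Sum>j\<in>I. w i j))"
    unfolding distrib_left sum.distrib sum_distrib_left
    by (intro arg_cong2[where f = "(+)"] sum.cong refl) (simp_all only: mult_ac)
  also have "(\<Sum>i\<in>I. ?b i * (\<Sum>j\<in>I. w i j)) \<le> (\<Sum>i\<in>I. ?b i * (D * m i))"
    using row_sum by (intro sum_mono mult_left_mono) auto
  then have "?\<epsilon> * (\<Sum>i\<in>I. ?b i * (\<Sum>j\<in>I. w i j)) \<le> ?\<epsilon> * (\<Sum>i\<in>I. ?b i * (D * m i))"
    using \<epsilon> by (rule mult_left_mono)
  also have "\<dots> = ?\<epsilon> * D * (\<Sum>i\<in>I. m i * ?b i)"
    unfolding sum_distrib_left by (intro sum.cong refl) (simp only: mult_ac)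
  also have "\<dots> \<le> \<alpha> / 2 * (\<Sum>i\<in>I. m i * ?b i)"
    using \<alpha>_pos D_nonneg m_nonneg
    by (intro mult_right_mono sum_nonneg) (auto simp: field_simps)
  finally show ?thesis
    by (simp add: field_simps)
qed

end

text \<open>For a median c both a - c and c - a have positive parts supported on at most half of the
  mass, so the estimate applies to each, and their sum controls |a - c|. Differences a i - a j are
  split at c. The order of the quantifiers matters: K depends on \<alpha>, D and p, not on the
  partition.\<close>

lemma poincare_inequality:
  fixes \<alpha> D p :: real
  assumes "0 < \<alpha>" "0 \<le> D" and p: "1 \<le> p"
  shows "\<exists>K\<ge>0. \<forall>(I :: 'i set) m w a. weighted_expander I m w \<alpha> D \<longrightarrow>
    (\<Sum>i\<in>I. \<Sum>j\<in>I. m i * m j * \<bar>a i - a j\<bar> powr p)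
      \<le> K * sum m I * (\<Sum>i\<in>I. \<Sum>j\<in>I. w i j * \<bar>a i - a j\<bar> powr p)"
proof -
  obtain C where C: "0 \<le> C" "\<And>a b. 0 \<le> a \<Longrightarrow> a \<le> b \<Longrightarrow>
      b powr p - a powr p \<le> C * (b - a) powr p + \<alpha> / (2 * (D + 1)) * b powr p"
    using powr_diff_le[OF p, of "\<alpha> / (2 * (D + 1))"] assms(1,2) by auto
  \<comment> \<open>Each of the two positive parts contributes 2 * C / \<alpha>; the factor 2 * 2
    powr p comes from splitting the differences at the median.\<close>
  define K where "K = 2 * 2 powr p * (4 * C / \<alpha>)"
  have "(\<Sum>i\<in>I. \<Sum>j\<in>I. m i * m j * \<bar>a i - a j\<bar> powr p)
      \<le> K * sum m I * (\<Sum>i\<in>I. \<Sum>j\<in>I. w i j * \<bar>a i - a j\<bar> powr p)"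
    if W: "weighted_expander I m w \<alpha> D" for I :: "'i set" and m w a
  proof -
    interpret weighted_expander I m w \<alpha> D by (rule W)
    let ?E = "\<Sum>i\<in>I. \<Sum>j\<in>I. w i j * \<bar>a i - a j\<bar> powr p"
    obtain c where c: "2 * sum m {i\<in>I. a i > c} \<le> sum m I" "2 * sum m {i\<in>I. a i < c} \<le> sum m I"
      using ex_weighted_median[of I m a] finite_I m_nonneg by blast
    let ?X = "\<Sum>i\<in>I. m i * \<bar>a i - c\<bar> powr p"
    have 1: "\<alpha> / 2 * (\<Sum>i\<in>I. m i * max 0 (a i - c) powr p) \<le> C * ?E"
      using poincare_positive_part[OF C p, of "\<lambda>i. a i - c"] c(1) by simp
    have 2: "\<alpha> / 2 * (\<Sum>i\<in>I. m i * max 0 (c - a i) powr p) \<le> C * ?E"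
      using poincare_positive_part[OF C p, of "\<lambda>i. c - a i"] c(2) by (simp add: abs_minus_commute)
    have "?X = (\<Sum>i\<in>I. m i * max 0 (a i - c) powr p) + (\<Sum>i\<in>I. m i * max 0 (c - a i) powr p)"
      unfolding sum.distrib[symmetric] by (intro sum.cong) (auto simp: max_def abs_if)
    then have "\<alpha> / 2 * ?X \<le> 2 * (C * ?E)"
      using 1 2 by (simp add: distrib_left)
    then have X: "?X \<le> (4 * C / \<alpha>) * ?E"
      using \<alpha>_pos by (simp add: field_simps)
    have "(\<Sum>i\<in>I. \<Sum>j\<in>I. m i * m j * \<bar>a i - a j\<bar> powr p)
        \<le> (\<Sum>i\<in>I. \<Sum>j\<in>I. m i * m j * (2 powr p * (\<bar>a i - c\<bar> powr p + \<bar>a j - c\<bar> powr p)))"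
      using m_nonneg p abs_diff_powr_le[of p "a i - c" "a j - c" for i j]
      by (intro sum_mono mult_left_mono) auto
    also have "\<dots> = (\<Sum>i\<in>I. \<Sum>j\<in>I. 2 powr p * (m j * (m i * \<bar>a i - c\<bar> powr p)))
        + (\<Sum>i\<in>I. \<Sum>j\<in>I. 2 powr p * (m i * (m j * \<bar>a j - c\<bar> powr p)))"
      unfolding sum.distrib[symmetric] by (intro sum.cong refl) (simp add: algebra_simps)
    also have "(\<Sum>i\<in>I. \<Sum>j\<in>I. 2 powr p * (m j * (m i * \<bar>a i - c\<bar> powr p))) = 2 powr p * (sum m I * ?X)"
      unfolding sum_product by (subst sum.swap) (simp add: sum_distrib_left)
    also have "(\<Sum>i\<in>I. \<Sum>j\<in>I. 2 powr p * (m i * (m j * \<bar>a j - c\<bar> powr p))) = 2 powr p * (sum m I * ?X)"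
      unfolding sum_product by (simp add: sum_distrib_left)
    also have "2 powr p * (sum m I * ?X) + 2 powr p * (sum m I * ?X) = (2 * 2 powr p * sum m I) * ?X"
      by simp
    also have "\<dots> \<le> (2 * 2 powr p * sum m I) * ((4 * C / \<alpha>) * ?E)"
      using m_nonneg by (intro mult_left_mono X) (auto intro!: mult_nonneg_nonneg sum_nonneg)
    also have "\<dots> = K * sum m I * ?E"
      by (simp add: K_def mult_ac)
    finally show ?thesis .
  qed
  moreover have "0 \<le> K"
    using C(1) assms(1) by (simp add: K_def)
  ultimately show ?thesis
    by blast
qed

section \<open>Warped distances\<close>

definition admissible ::
  "'x set \<Rightarrow> ('x \<Rightarrow> 'x \<Rightarrow> real) \<Rightarrow> ('g \<Rightarrow> 'x \<Rightarrow> 'x) \<Rightarrow> 'g set \<Rightarrow> ('x \<Rightarrow> 'x \<Rightarrow> real) set" where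
  "admissible X d a S = {\<rho>. Metric_space X \<rho> \<and> (\<forall>x\<in>X. \<forall>y\<in>X. \<rho> x y \<le> d x y) \<and>
      (\<forall>x\<in>X. \<forall>s\<in>S. \<rho> x (a s x) \<le> 1)}"

text \<open>The real argument is the accumulated cost. A move may lead to any point of the type,
  also outside the metric space; nonnegativity and symmetry of d0 hold there as well.\<close>

inductive chain :: "('x \<Rightarrow> 'x \<Rightarrow> real) \<Rightarrow> ('g \<Rightarrow> 'x \<Rightarrow> 'x) \<Rightarrow> 'g set \<Rightarrow> 'x \<Rightarrow> real \<Rightarrow> 'x \<Rightarrow> bool"
  for d0 a S z0 where
  start: "chain d0 a S z0 0 z0"
| move: "chain d0 a S z0 r z \<Longrightarrow> chain d0 a S z0 (r + d0 z w) w"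
| warp: "chain d0 a S z0 r z \<Longrightarrow> s \<in> S \<Longrightarrow> chain d0 a S z0 (r + 1) (a s z)"

text \<open>d0 is a metric below d that can be computed with; all lower bounds for the warped
  distance of d are expressed by costs measured in d0.\<close>

locale warped_space =
  fixes X :: "'x set" and d d0 :: "'x \<Rightarrow> 'x \<Rightarrow> real" and a :: "'g \<Rightarrow> 'x \<Rightarrow> 'x" and S :: "'g set"
  assumes d0_metric: "Metric_space X d0"
    and d0_le: "\<And>x y. x \<in> X \<Longrightarrow> y \<in> X \<Longrightarrow> d0 x y \<le> d x y"
    and undo: "\<And>s. s \<in> S \<Longrightarrow> \<exists>s'\<in>S. \<forall>x. a s' (a s x) = x"
begin

definition cost :: "'x \<Rightarrow> 'x \<Rightarrow> real" where
  "cost z0 z = Inf {r. chain d0 a S z0 r z}"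

lemma d0_nonneg: "0 \<le> d0 x y" and d0_commute: "d0 x y = d0 y x"
  using d0_metric by (simp_all add: Metric_space_def)

lemma chain_nonneg: "chain d0 a S z0 r z \<Longrightarrow> 0 \<le> r"
  by (induction rule: chain.induct) (simp_all add: d0_nonneg)

lemma cost_le: "chain d0 a S z0 r z \<Longrightarrow> cost z0 z \<le> r"
  unfolding cost_def using chain_nonneg by (intro cInf_lower bdd_belowI[of _ 0]) auto

lemma ex_chain: "\<exists>r. chain d0 a S z0 r z"
  by (rule exI, rule chain.move, rule chain.start)

lemma cost_greatest: "(\<And>r. chain d0 a S z0 r z \<Longrightarrow> b \<le> r) \<Longrightarrow> b \<le> cost z0 z"
  unfolding cost_def using ex_chain by (intro cInf_greatest) auto

lemma cost_less_imp_chain: "cost z0 z < b \<Longrightarrow> \<exists>r<b. chain d0 a S z0 r z"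
  using cost_greatest[of z0 z b] by (meson not_le)

lemma cost_self: "cost z0 z0 = 0"
  using cost_le[OF chain.start] cost_greatest[OF chain_nonneg] by (intro antisym)

lemma cost_nonneg: "0 \<le> cost z0 z"
  by (rule cost_greatest[OF chain_nonneg])

lemma cost_move: "cost z0 w \<le> cost z0 z + d0 z w"
proof -
  have "cost z0 w - d0 z w \<le> cost z0 z"
    using cost_le[OF chain.move] by (intro cost_greatest) (simp add: algebra_simps)
  then show ?thesis by simp
qed

lemma cost_warp: "s \<in> S \<Longrightarrow> cost z0 (a s z) \<le> cost z0 z + 1"
proof -
  assume s: "s \<in> S"
  have "cost z0 (a s z) - 1 \<le> cost z0 z"
    using cost_le[OF chain.warp[OF _ s]] by (intro cost_greatest) (simp add: algebra_simps)
  then show ?thesis by simp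
qed

lemma cost_diff_move: "\<bar>cost z0 z - cost z0 w\<bar> \<le> d0 z w"
  using cost_move[of z0 w z] cost_move[of z0 z w] d0_commute[of z w] by linarith

lemma cost_diff_warp: "s \<in> S \<Longrightarrow> \<bar>cost z0 z - cost z0 (a s z)\<bar> \<le> 1"
proof -
  assume s: "s \<in> S"
  obtain s' where "s' \<in> S" "a s' (a s z) = z"
    using undo[OF s] by blast
  then have "cost z0 z \<le> cost z0 (a s z) + 1"
    using cost_warp[of s' z0 "a s z"] by simp
  then show ?thesis
    using cost_warp[OF s, of z0 z] by linarith
qed

text \<open>The distance from a point with respect to the largest warped distance is realised by a
  distance that need not be a maximum: capping \<^term>\<open>d0\<close> at 1 makes it admissible, and the
  cost function, being 1-Lipschitz, can be added as a further pseudodistance.\<close>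

lemma cost_admissible:
  "(\<lambda>z w. max (min 1 (d0 z w)) \<bar>cost z0 z - cost z0 w\<bar>) \<in> admissible X d a S"
proof -
  interpret D: Metric_space X d0 by (rule d0_metric)
  let ?\<rho> = "\<lambda>z w. max (min 1 (d0 z w)) \<bar>cost z0 z - cost z0 w\<bar>"
  have "Metric_space X ?\<rho>"
  proof
    fix x y z
    show "?\<rho> x y = ?\<rho> y x"
      using d0_commute[of x y] by (simp add: abs_minus_commute)
    show "(?\<rho> x y = 0) = (x = y)" if "x \<in> X" "y \<in> X"
    proof
      assume "?\<rho> x y = 0"
      then have "d0 x y \<le> 0"
        by (simp add: max_def min_def split: if_splits)
      then show "x = y"
        using d0_nonneg[of x y] D.zero[OF that] by simp
    qed (use D.zero[OF that] in simp)
    show "?\<rho> x z \<le> ?\<rho> x y + ?\<rho> y z" if "x \<in> X" "y \<in> X" "z \<in> X"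
      using D.triangle[OF that] d0_nonneg[of x y] d0_nonneg[of y z] by linarith
  qed (simp add: d0_nonneg le_max_iff_disj)
  moreover have "?\<rho> x y \<le> d x y" if "x \<in> X" "y \<in> X" for x y
    using d0_le[OF that] cost_diff_move[of z0 x y] by linarith
  moreover have "?\<rho> x (a s x) \<le> 1" if "s \<in> S" for x s
    using cost_diff_warp[OF that, of z0 x] by linarith
  ultimately show ?thesis
    unfolding admissible_def by blast
qed

lemma warped_dist_alt: "warped_dist X d a S z w = (SUP \<rho>\<in>admissible X d a S. \<rho> z w)"
  by (simp add: warped_dist_def admissible_def)

lemma warped_dist_ge:
  assumes "\<rho> \<in> admissible X d a S" "z \<in> X" "w \<in> X"
  shows "\<rho> z w \<le> warped_dist X d a S z w"
  unfolding warped_dist_alt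
  by (rule cSUP_upper[OF assms(1)], rule bdd_aboveI2[of _ _ "d z w"])
     (use assms in \<open>auto simp: admissible_def\<close>)

lemma warped_dist_le:
  assumes "\<And>\<rho>. \<rho> \<in> admissible X d a S \<Longrightarrow> \<rho> z w \<le> b"
  shows "warped_dist X d a S z w \<le> b"
  unfolding warped_dist_alt using cost_admissible assms by (intro cSUP_least) blast+

text \<open>Evaluates the metric of \<open>cost_admissible\<close>, built from the cost function of
  z, at the pair z, w. Consequently a small warped distance forces a cheap chain.\<close>

lemma cost_le_warped_dist:
  assumes "z \<in> X" "w \<in> X"
  shows "cost z w \<le> warped_dist X d a S z w"
  using warped_dist_ge[OF cost_admissible[of z] assms] cost_self[of z] cost_nonneg[of z w] by linarith

lemma warped_dist_nonneg: "z \<in> X \<Longrightarrow> w \<in> X \<Longrightarrow> 0 \<le> warped_dist X d a S z w"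
  using cost_le_warped_dist[of z w] cost_nonneg[of z w] by linarith

lemma warped_dist_le_dist: "z \<in> X \<Longrightarrow> w \<in> X \<Longrightarrow> warped_dist X d a S z w \<le> d z w"
  by (rule warped_dist_le) (auto simp: admissible_def)

lemma warped_dist_warp: "z \<in> X \<Longrightarrow> s \<in> S \<Longrightarrow> warped_dist X d a S z (a s z) \<le> 1"
  by (rule warped_dist_le) (auto simp: admissible_def)

lemma warped_dist_triangle:
  assumes "z \<in> X" "w \<in> X" "v \<in> X"
  shows "warped_dist X d a S z v \<le> warped_dist X d a S z w + warped_dist X d a S w v"
proof (rule warped_dist_le)
  fix \<rho> assume \<rho>: "\<rho> \<in> admissible X d a S"
  then interpret Metric_space X \<rho>
    by (simp add: admissible_def)
  show "\<rho> z v \<le> warped_dist X d a S z w + warped_dist X d a S w v"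
    using triangle[OF assms] warped_dist_ge[OF \<rho> assms(1,2)] warped_dist_ge[OF \<rho> assms(2,3)]
    by linarith
qed

end

section \<open>Warped balls at a high level of the cone\<close>

locale warped_cone = compact_riemannian +
  fixes \<phi> :: "'g \<Rightarrow> 'a \<Rightarrow> 'a" and S :: "'g set"
  assumes finite_S: "finite S" and one_S: "\<exists>e\<in>S. \<phi> e = id"
    and inv_S: "\<And>s. s \<in> S \<Longrightarrow> \<exists>s'\<in>S. \<forall>x. \<phi> s' (\<phi> s x) = x"
    and continuous_\<phi>: "\<And>s. s \<in> S \<Longrightarrow> continuous_on UNIV (\<phi> s)"
begin

sublocale W: warped_space open_cone "cone_dist \<A> g" d\<^sub>C "cone_action \<phi>" S
proof (rule warped_space.intro)
  show "Metric_space open_cone d\<^sub>C"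
    by (rule d\<^sub>C_metric)
  show "d\<^sub>C x y \<le> cone_dist \<A> g x y" if "x \<in> open_cone" "y \<in> open_cone" for x y
    using that by (rule d\<^sub>C_le_cone_dist)
  show "\<exists>s'\<in>S. \<forall>x :: 'a \<times> real. cone_action \<phi> s' (cone_action \<phi> s x) = x" if "s \<in> S" for s
    using inv_S[OF that] by (auto simp: cone_action_def)
qed

primrec orbit_ball :: "nat \<Rightarrow> 'a \<Rightarrow> 'a set" where
  "orbit_ball 0 x = {x}"
| "orbit_ball (Suc k) x = (\<Union>s\<in>S. \<phi> s ` orbit_ball k x)"

lemma finite_orbit_ball: "finite (orbit_ball k x)"
  by (induction k) (simp_all add: finite_S)

lemma card_orbit_ball: "card (orbit_ball k x) \<le> card S ^ k"
proof (induction k)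
  case (Suc k)
  have "card (orbit_ball (Suc k) x) \<le> (\<Sum>s\<in>S. card (\<phi> s ` orbit_ball k x))"
    by (simp add: card_UN_le finite_S)
  also have "\<dots> \<le> (\<Sum>s\<in>S. card S ^ k)"
    by (intro sum_mono order_trans[OF card_image_le[OF finite_orbit_ball] Suc])
  finally show ?case
    by simp
qed simp

lemma orbit_ball_mono: "k \<le> l \<Longrightarrow> orbit_ball k x \<subseteq> orbit_ball l x"
proof (induction l rule: dec_induct)
  case (step l)
  have "orbit_ball l x \<subseteq> orbit_ball (Suc l) x"
    using one_S by force
  then show ?case
    using step by blast
qed simp

text \<open>The moduli are chosen backwards: the last one is \<delta>, and each earlier one is so
  small that every generator maps that precision into half of the next. The other half is reserved
  for the drift caused by moves.\<close>

lemma ex_moduli: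
  assumes "\<delta> > 0"
  shows "\<exists>e :: nat \<Rightarrow> real. (\<forall>k. 0 < e k) \<and> (\<forall>k\<le>n. e k \<le> \<delta> \<and> e 0 \<le> e k) \<and>
    (\<forall>k<n. \<forall>s\<in>S. \<forall>x y. d\<^sub>M x y < e k \<longrightarrow> d\<^sub>M (\<phi> s x) (\<phi> s y) < e (Suc k) / 2)"
  using assms
proof (induction n arbitrary: \<delta>)
  case 0
  then show ?case
    by (intro exI[of _ "\<lambda>_. \<delta>"]) auto
next
  case (Suc n)
  have "\<forall>s\<in>S. \<exists>\<delta>'>0. \<forall>x y. d\<^sub>M x y < \<delta>' \<longrightarrow> d\<^sub>M (\<phi> s x) (\<phi> s y) < \<delta> / 2"
    using Suc.prems by (intro ballI uniformly_continuous_d\<^sub>M continuous_\<phi>) simp_all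
  then obtain m where m: "\<And>s. s \<in> S \<Longrightarrow> 0 < m s"
      "\<And>s x y. s \<in> S \<Longrightarrow> d\<^sub>M x y < m s \<Longrightarrow> d\<^sub>M (\<phi> s x) (\<phi> s y) < \<delta> / 2"
    by metis
  define \<delta>' where "\<delta>' = Min (insert \<delta> (m ` S))"
  have \<delta>': "\<delta>' > 0" "\<delta>' \<le> \<delta>" "\<And>s. s \<in> S \<Longrightarrow> \<delta>' \<le> m s"
    using finite_S m(1) Suc.prems by (auto simp: \<delta>'_def)
  obtain e :: "nat \<Rightarrow> real" where E: "(\<forall>k. 0 < e k) \<and> (\<forall>k\<le>n. e k \<le> \<delta>' \<and> e 0 \<le> e k) \<and>
      (\<forall>k<n. \<forall>s\<in>S. \<forall>x y. d\<^sub>M x y < e k \<longrightarrow> d\<^sub>M (\<phi> s x) (\<phi> s y) < e (Suc k) / 2)"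
    by (rule exE[OF Suc.IH[OF \<delta>'(1)]])
  have e: "0 < e k" "k \<le> n \<Longrightarrow> e k \<le> \<delta>'" "k \<le> n \<Longrightarrow> e 0 \<le> e k"
      "k < n \<Longrightarrow> s \<in> S \<Longrightarrow> d\<^sub>M x y < e k \<Longrightarrow> d\<^sub>M (\<phi> s x) (\<phi> s y) < e (Suc k) / 2" for k s x y
    using E by simp_all
  show ?case
  proof (intro exI[of _ "e(Suc n := \<delta>)"] conjI allI impI ballI)
    fix k s x y assume k: "k < Suc n" and s: "s \<in> S" and xy: "d\<^sub>M x y < (e(Suc n := \<delta>)) k"
    show "d\<^sub>M (\<phi> s x) (\<phi> s y) < (e(Suc n := \<delta>)) (Suc k) / 2"
    proof (cases "k = n")
      case True
      then have "d\<^sub>M x y < m s"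
        using xy e(2)[of n] \<delta>'(3)[OF s] by simp
      then show ?thesis
        using m(2)[OF s] True by simp
    next
      case False
      then show ?thesis
        using k e(4)[of k s x y] s xy by simp
    qed
  next
    fix k assume k: "k \<le> Suc n"
    show "(e(Suc n := \<delta>)) k \<le> \<delta>"
      using k e(2)[of k] \<delta>'(2) by (cases "k = Suc n") auto
    show "(e(Suc n := \<delta>)) 0 \<le> (e(Suc n := \<delta>)) k"
      using k e(2)[of 0] e(3)[of k] \<delta>'(2) by (cases "k = Suc n") auto
  qed (use e(1) Suc.prems in auto)
qed

text \<open>A chain of cost at most R contains at most n warps, and at a high level its moves hardly
  displace the base point. Hence its end stays near the image of x under the same generators; the
  moduli e k keep the error under control after k warps.\<close>

lemma chain_near_orbit:
  assumes e: "\<And>k. 0 < e k" "\<And>k. k \<le> n \<Longrightarrow> e 0 \<le> e k"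
      "\<And>k s x y. k < n \<Longrightarrow> s \<in> S \<Longrightarrow> d\<^sub>M x y < e k \<Longrightarrow> d\<^sub>M (\<phi> s x) (\<phi> s y) < e (Suc k) / 2"
    and R: "0 \<le> R" "R \<le> n" and t: "2 * R < t" "4 * R / (t - 2 * R) < e 0 / 2"
    and ch: "chain d\<^sub>C (cone_action \<phi>) S (x, t) r z" "r \<le> R"
  shows "\<exists>k q. k \<le> n \<and> q \<in> orbit_ball k x \<and> d\<^sub>M q (fst z) < e k"
proof -
  \<comment> \<open>By \<open>d\<^sub>C_base\<close>, a move from height at least t - 2 * R shifts
    the base by at most this factor times its cost. By \<open>d\<^sub>C_height\<close> a chain of
    cost at most R never sinks below that height.\<close>
  let ?\<theta> = "4 / (t - 2 * R)"
  have small: "?\<theta> * \<mu> < e k / 2" if "\<mu> \<le> R" "k \<le> n" for \<mu> k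
  proof -
    have "?\<theta> * \<mu> \<le> ?\<theta> * R"
      using that t by (intro mult_left_mono) auto
    then show ?thesis
      using t(2) e(2)[OF that(2)] by simp
  qed
  \<comment> \<open>In this invariant k counts the warps and \<mu> is the total cost of the moves.
    The term e k / 2 is the error inherited from the last warp, the other term the drift. A warp
    turns the whole error into less than e (Suc k) / 2, and the drift term, being nonnegative, is
    kept, so that \<mu> is never reset.\<close>
  have "\<exists>k q \<mu>. 0 \<le> \<mu> \<and> real k + \<mu> \<le> r \<and> q \<in> orbit_ball k x \<and>
      d\<^sub>M q (fst z) \<le> e k / 2 + ?\<theta> * \<mu> \<and> \<bar>snd z - t\<bar> \<le> 2 * r"
    using ch
  proof (induction rule: chain.induct)
    case start
    then show ?case
      using e(1)[of 0] by (intro exI[of _ 0] exI[of _ x]) simp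
  next
    case (move r z w)
    have dzw: "0 \<le> d\<^sub>C z w"
      by (rule C.sup_dist_nonneg)
    obtain k q \<mu> where IH: "0 \<le> \<mu>" "real k + \<mu> \<le> r" "q \<in> orbit_ball k x"
        "d\<^sub>M q (fst z) \<le> e k / 2 + ?\<theta> * \<mu>" "\<bar>snd z - t\<bar> \<le> 2 * r"
      using move dzw by fastforce
    have z: "t - 2 * R \<le> snd z" "0 < snd z"
      using IH(5) move.prems dzw t(1) by linarith+
    have "d\<^sub>M (fst z) (fst w) \<le> 4 * d\<^sub>C z w / snd z"
      using d\<^sub>C_base[of z w] z by (simp add: field_simps)
    also have "\<dots> \<le> 4 * d\<^sub>C z w / (t - 2 * R)"
      using z t(1) dzw by (intro divide_left_mono) auto
    finally have "d\<^sub>M q (fst w) \<le> e k / 2 + ?\<theta> * (\<mu> + d\<^sub>C z w)"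
      using IH(4) M.sup_dist_triangle[of q "fst w" "fst z"] by (simp add: distrib_left add_divide_distrib)
    moreover have "\<bar>snd w - t\<bar> \<le> 2 * (r + d\<^sub>C z w)"
    proof -
      have "\<bar>snd w - t\<bar> \<le> \<bar>snd z - t\<bar> + \<bar>snd z - snd w\<bar>"
        by linarith
      also have "\<dots> \<le> 2 * r + 2 * d\<^sub>C z w"
        by (intro add_mono IH(5) d\<^sub>C_height)
      finally show ?thesis
        by (simp add: distrib_left)
    qed
    ultimately show ?case
      using IH dzw by (intro exI[of _ k] exI[of _ q] exI[of _ "\<mu> + d\<^sub>C z w"]) auto
  next
    case (warp r z s)
    obtain k q \<mu> where IH: "0 \<le> \<mu>" "real k + \<mu> \<le> r" "q \<in> orbit_ball k x"
        "d\<^sub>M q (fst z) \<le> e k / 2 + ?\<theta> * \<mu>" "\<bar>snd z - t\<bar> \<le> 2 * r"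
      using warp by fastforce
    \<comment> \<open>After the warp the cost r + 1 is still at most R, so one more warp fits below
      n and the modulus at k applies.\<close>
    have k: "k < n" "\<mu> \<le> R"
      using IH(1,2) warp.prems R by linarith+
    then have "d\<^sub>M q (fst z) < e k"
      using IH(4) small[of \<mu> k] by linarith
    then have "d\<^sub>M (\<phi> s q) (\<phi> s (fst z)) < e (Suc k) / 2"
      using e(3) k(1) warp.hyps by blast
    moreover have "0 \<le> ?\<theta> * \<mu>"
      using IH(1) t(1) by simp
    moreover have "fst (cone_action \<phi> s z) = \<phi> s (fst z)" "snd (cone_action \<phi> s z) = snd z"
      by (simp_all add: cone_action_def split: prod.split)
    moreover have "\<phi> s q \<in> orbit_ball (Suc k) x"
      using IH(3) warp.hyps by auto
    ultimately show ?case
      using IH by (intro exI[of _ "Suc k"] exI[of _ "\<phi> s q"] exI[of _ \<mu>]) auto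
  qed
  then obtain k q \<mu> where q: "0 \<le> \<mu>" "real k + \<mu> \<le> r" "q \<in> orbit_ball k x"
      "d\<^sub>M q (fst z) \<le> e k / 2 + ?\<theta> * \<mu>"
    by blast
  have "\<mu> \<le> R" "k \<le> n"
    using q(1,2) ch(2) R by linarith+
  then show ?thesis
    using q small[of \<mu> k] by (intro exI[of _ k] exI[of _ q]) auto
qed

text \<open>At most |S|^n orbit points occur, so balls of measure at most \<epsilon> / |S|^n around
  them suffice. The level t serves all x at once. The enclosing set B is measurable, which has not
  been shown for the warped ball itself.\<close>

lemma warped_balls_small:
  assumes \<epsilon>: "\<epsilon> > 0" and R: "0 \<le> R"
  shows "\<exists>t\<ge>1. \<forall>x. \<exists>B\<in>sets \<nu>. {y. warped_cone_dist \<A> g \<phi> S (x, t) (y, t) < R} \<subseteq> B \<and>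
    emeasure \<nu> B \<le> ennreal \<epsilon>"
proof -
  obtain n :: nat where n: "R \<le> n"
    using real_arch_simple by blast
  define c where "c = real (card S ^ n)"
  have "S \<noteq> {}"
    using one_S by blast
  then have c: "c > 0"
    using finite_S by (simp add: c_def card_gt_0_iff)
  obtain \<delta> where \<delta>: "\<delta> > 0" "\<And>x. emeasure \<nu> {y. d\<^sub>M x y < \<delta>} \<le> ennreal (\<epsilon> / c)"
    using uniform_small_balls[of "\<epsilon> / c"] \<epsilon> c by auto
  obtain e :: "nat \<Rightarrow> real" where E: "(\<forall>k. 0 < e k) \<and> (\<forall>k\<le>n. e k \<le> \<delta> \<and> e 0 \<le> e k) \<and>
      (\<forall>k<n. \<forall>s\<in>S. \<forall>x y. d\<^sub>M x y < e k \<longrightarrow> d\<^sub>M (\<phi> s x) (\<phi> s y) < e (Suc k) / 2)"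
    by (rule exE[OF ex_moduli[OF \<delta>(1)]])
  have e: "0 < e k" "k \<le> n \<Longrightarrow> e k \<le> \<delta>" "k \<le> n \<Longrightarrow> e 0 \<le> e k"
      "k < n \<Longrightarrow> s \<in> S \<Longrightarrow> d\<^sub>M x y < e k \<Longrightarrow> d\<^sub>M (\<phi> s x) (\<phi> s y) < e (Suc k) / 2" for k s x y
    using E by simp_all
  \<comment> \<open>The summand 8 * R / e 0 brings 4 * R / (t - 2 * R) down to e 0 / 2, and the
    final 1 makes the inequality strict.\<close>
  define t where "t = 2 * R + 8 * R / e 0 + 1"
  have t: "1 \<le> t" "2 * R < t" "4 * R / (t - 2 * R) < e 0 / 2"
  proof -
    have "0 \<le> 8 * R / e 0"
      using R e(1)[of 0] by simp
    then show "1 \<le> t" "2 * R < t"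
      using R by (auto simp: t_def)
    then show "4 * R / (t - 2 * R) < e 0 / 2"
      using e(1)[of 0] by (simp add: t_def field_simps)
  qed
  have "\<exists>B\<in>sets \<nu>. {y. warped_cone_dist \<A> g \<phi> S (x, t) (y, t) < R} \<subseteq> B \<and> emeasure \<nu> B \<le> ennreal \<epsilon>" for x
  proof (intro bexI conjI)
    let ?B = "\<Union>q\<in>orbit_ball n x. {y. d\<^sub>M q y < \<delta>}"
    have ball: "{y. d\<^sub>M q y < \<delta>} \<in> sets \<nu>" for q
      using open_d\<^sub>M_ball sets_riemannian_measure[OF comp] by simp
    then show "?B \<in> sets \<nu>"
      using finite_orbit_ball by (intro sets.finite_UN) auto
    show "{y. warped_cone_dist \<A> g \<phi> S (x, t) (y, t) < R} \<subseteq> ?B"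
    proof
      fix y assume "y \<in> {y. warped_cone_dist \<A> g \<phi> S (x, t) (y, t) < R}"
      then have "W.cost (x, t) (y, t) < R"
        using W.cost_le_warped_dist[of "(x, t)" "(y, t)"] t(1)
        by (simp add: open_cone_def warped_cone_dist_def)
      then obtain r where r: "r < R" "chain d\<^sub>C (cone_action \<phi>) S (x, t) r (y, t)"
        using W.cost_less_imp_chain by blast
      obtain k q where "k \<le> n" "q \<in> orbit_ball k x" "d\<^sub>M q (fst (y, t)) < e k"
        using chain_near_orbit[OF e(1,3,4) R n t(2,3) r(2) less_imp_le[OF r(1)]] by blast
      then show "y \<in> ?B"
        using e(2)[of k] orbit_ball_mono[of k n x] by fastforce
    qed
    have "emeasure \<nu> ?B \<le> (\<Sum>q\<in>orbit_ball n x. emeasure \<nu> {y. d\<^sub>M q y < \<delta>})"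
      using ball finite_orbit_ball by (intro emeasure_subadditive_finite) auto
    also have "\<dots> \<le> (\<Sum>q\<in>orbit_ball n x. ennreal (\<epsilon> / c))"
      by (intro sum_mono \<delta>(2))
    also have "\<dots> = ennreal (real (card (orbit_ball n x)) * (\<epsilon> / c))"
      unfolding sum_constant ennreal_of_nat_eq_real_of_nat
      using \<epsilon> c by (subst ennreal_mult[symmetric]) auto
    also have "\<dots> \<le> ennreal (c * (\<epsilon> / c))"
      using \<epsilon> c card_orbit_ball[of n x] unfolding c_def
      by (intro ennreal_leI mult_right_mono of_nat_mono) auto
    finally show "emeasure \<nu> ?B \<le> ennreal \<epsilon>"
      using c by simp
  qed
  then show ?thesis
    using t(1) by blast
qed

end

section \<open>Maps into Lp spaces\<close>

lemma Lp_eq_refl: "F \<in> Lp_functions p N \<Longrightarrow> (F, F) \<in> Lp_eq p N"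
  by (simp add: Lp_eq_def)

lemma Lp_space_rep:
  assumes "\<Phi> \<in> Lp_space p N"
  shows "\<exists>F. F \<in> \<Phi>"
  using assms Lp_eq_refl unfolding Lp_space_def quotient_def by fastforce

lemma Lp_space_functions:
  assumes "\<Phi> \<in> Lp_space p N" "F \<in> \<Phi>"
  shows "F \<in> Lp_functions p N"
  using assms by (auto simp: Lp_space_def quotient_def Lp_eq_def)

lemma Lp_space_AE_eq:
  assumes "\<Phi> \<in> Lp_space p N" "F \<in> \<Phi>" "F' \<in> \<Phi>"
  shows "AE x in N. F x = F' x"
proof -
  obtain F0 where "AE x in N. F0 x = F x" "AE x in N. F0 x = F' x"
    using assms by (auto simp: Lp_space_def quotient_def Lp_eq_def)
  then show ?thesis
    by eventually_elim simp
qed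

text \<open>\<open>Lp_dist\<close> is a \<open>the_elem\<close> over all representatives; it has a
  meaningful value because changing them on null sets leaves the integral unchanged.\<close>

lemma Lp_dist_eq:
  assumes \<Phi>: "\<Phi> \<in> Lp_space p N" "F \<in> \<Phi>" and \<Psi>: "\<Psi> \<in> Lp_space p N" "H \<in> \<Psi>"
  shows "Lp_dist p N \<Phi> \<Psi> = (\<integral>x. \<bar>F x - H x\<bar> powr p \<partial>N) powr (1 / p)"
proof -
  let ?I = "\<lambda>F H. (\<integral>x. \<bar>F x - H x\<bar> powr p \<partial>N) powr (1 / p)"
  have "?I F' H' = ?I F H" if "F' \<in> \<Phi>" "H' \<in> \<Psi>" for F' H'
  proof -
    have [measurable]: "F \<in> borel_measurable N" "F' \<in> borel_measurable N"
        "H \<in> borel_measurable N" "H' \<in> borel_measurable N"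
      using Lp_space_functions \<Phi> \<Psi> that unfolding Lp_functions_def by blast+
    have "AE x in N. F' x = F x" "AE x in N. H' x = H x"
      using Lp_space_AE_eq \<Phi> \<Psi> that by blast+
    then have "AE x in N. \<bar>F' x - H' x\<bar> powr p = \<bar>F x - H x\<bar> powr p"
      by eventually_elim simp
    then have "(\<integral>x. \<bar>F' x - H' x\<bar> powr p \<partial>N) = (\<integral>x. \<bar>F x - H x\<bar> powr p \<partial>N)"
      by (intro integral_cong_AE) measurable
    then show ?thesis by simp
  qed
  then have "(\<Union>f\<in>\<Phi>. \<Union>h\<in>\<Psi>. {?I f h}) = {?I F H}"
    using \<Phi>(2) \<Psi>(2) by blast
  then show ?thesis
    unfolding Lp_dist_def by simp
qed

lemma integrable_Lp_diff:
  assumes "F \<in> Lp_functions p N" "H \<in> Lp_functions p N" "0 \<le> p"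
  shows "integrable N (\<lambda>x. \<bar>F x - H x\<bar> powr p)"
proof (rule Bochner_Integration.integrable_bound)
  have [measurable]: "F \<in> borel_measurable N" "H \<in> borel_measurable N"
    using assms unfolding Lp_functions_def by blast+
  show "integrable N (\<lambda>x. 2 powr p * (\<bar>F x\<bar> powr p + \<bar>H x\<bar> powr p))"
    using assms unfolding Lp_functions_def by auto
  show "(\<lambda>x. \<bar>F x - H x\<bar> powr p) \<in> borel_measurable N"
    by measurable
  show "AE x in N. norm (\<bar>F x - H x\<bar> powr p) \<le> norm (2 powr p * (\<bar>F x\<bar> powr p + \<bar>H x\<bar> powr p))"
    using abs_diff_powr_le[OF assms(3)] by (intro AE_I2) (simp add: abs_mult)
qed

text \<open>Only finitely many functions occur, so integrating the scalar inequality over \<^term>\<open>N\<close>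
  needs no Fubini theorem, and hence no \<open>\<sigma>\<close>-finiteness.\<close>

lemma poincare_inequality_Lp:
  fixes F :: "'i \<Rightarrow> 'w \<Rightarrow> real"
  assumes K: "\<And>a. (\<Sum>i\<in>I. \<Sum>j\<in>I. m i * m j * \<bar>a i - a j\<bar> powr p)
      \<le> K * (\<Sum>i\<in>I. \<Sum>j\<in>I. w i j * \<bar>a i - a j\<bar> powr p)"
    and F: "\<And>i. i \<in> I \<Longrightarrow> F i \<in> Lp_functions p N" and p: "0 \<le> p"
  shows "(\<Sum>i\<in>I. \<Sum>j\<in>I. m i * m j * (\<integral>x. \<bar>F i x - F j x\<bar> powr p \<partial>N))
      \<le> K * (\<Sum>i\<in>I. \<Sum>j\<in>I. w i j * (\<integral>x. \<bar>F i x - F j x\<bar> powr p \<partial>N))"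
proof -
  have int: "integrable N (\<lambda>x. \<bar>F i x - F j x\<bar> powr p)" if "i \<in> I" "j \<in> I" for i j
    using F that p by (intro integrable_Lp_diff)
  have lin: "(\<Sum>i\<in>I. \<Sum>j\<in>I. c i j * (\<integral>x. \<bar>F i x - F j x\<bar> powr p \<partial>N))
      = (\<integral>x. (\<Sum>i\<in>I. \<Sum>j\<in>I. c i j * \<bar>F i x - F j x\<bar> powr p) \<partial>N)" for c :: "'i \<Rightarrow> 'i \<Rightarrow> real"
    using int by (simp add: Bochner_Integration.integral_sum Bochner_Integration.integrable_sum)
  have integ: "integrable N (\<lambda>x. \<Sum>i\<in>I. \<Sum>j\<in>I. c i j * \<bar>F i x - F j x\<bar> powr p)" for c :: "'i \<Rightarrow> 'i \<Rightarrow> real"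
    using int by (intro Bochner_Integration.integrable_sum integrable_mult_right) auto
  have "(\<integral>x. (\<Sum>i\<in>I. \<Sum>j\<in>I. m i * m j * \<bar>F i x - F j x\<bar> powr p) \<partial>N)
      \<le> (\<integral>x. K * (\<Sum>i\<in>I. \<Sum>j\<in>I. w i j * \<bar>F i x - F j x\<bar> powr p) \<partial>N)"
    by (intro integral_mono integ integrable_mult_right K)
  then show ?thesis
    unfolding lin by simp
qed

section \<open>Discretisation of the action at one level, and the contradiction\<close>

context warped_cone
begin

text \<open>Points joined with speed 1 / t have cone distance at most t * (1 / t) = 1 at level t,
  and finitely many sets of such points cover M. Both orders of the arguments are recorded, as the
  triangle inequality is later used along a path that enters and leaves the centres x i.\<close>

lemma level_partition:
  assumes t: "1 \<le> t"
  shows "\<exists>(n :: nat) P x. (\<forall>i. P i \<in> sets \<nu>) \<and> disjoint_family P \<and> (\<Union>i<n. P i) = UNIV \<and>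
    (\<forall>i<n. \<forall>y\<in>P i. warped_cone_dist \<A> g \<phi> S (x i, t) (y, t) \<le> 1 \<and>
       warped_cone_dist \<A> g \<phi> S (y, t) (x i, t) \<le> 1)"
proof -
  have close: "warped_cone_dist \<A> g \<phi> S (y, t) (z, t) \<le> 1" if "joinable (1 / t) y z" for y z
  proof -
    have "warped_cone_dist \<A> g \<phi> S (y, t) (z, t) \<le> cone_dist \<A> g (y, t) (z, t)"
      unfolding warped_cone_dist_def using t by (intro W.warped_dist_le_dist) (auto simp: open_cone_def)
    also have "\<dots> \<le> t * (1 / t)"
      using t by (intro cone_dist_joinable that) auto
    finally show ?thesis
      using t by simp
  qed
  obtain U where U: "\<And>p. open (U p)" "\<And>p. p \<in> U p"
      "\<And>p y z. y \<in> U p \<Longrightarrow> z \<in> U p \<Longrightarrow> joinable (1 / t) y z"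
    using locally_joinable[of "1 / t"] t by (metis zero_less_divide_1_iff zero_less_one order_less_le_trans)
  obtain T where T: "finite T" "(\<Union>p\<in>T. U p) = UNIV"
    using compact_UNIV_finite_subcover[OF comp, of U, OF U(1,2)] by blast
  obtain x and n :: nat where x: "T = x ` {i. i < n}"
    using finite_imp_nat_seg_image_inj_on[OF T(1)] by auto
  define P where "P = disjointed (\<lambda>i. U (x i))"
  have "P i \<subseteq> U (x i)" for i
    unfolding P_def by (rule disjointed_subset)
  then have near: "joinable (1 / t) (x i) y" "joinable (1 / t) y (x i)" if "y \<in> P i" for i y
    using U(2,3) that by blast+
  have "range P \<subseteq> sets \<nu>"
    unfolding P_def using U(1) sets_riemannian_measure[OF comp]
    by (intro sets.range_disjointed_sets) auto
  moreover have "disjoint_family P"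
    unfolding P_def by (rule disjoint_family_disjointed)
  moreover have "(\<Union>i<n. P i) = UNIV"
  proof -
    have "(\<Union>i\<in>{0..<n}. P i) = (\<Union>i\<in>{0..<n}. U (x i))"
      unfolding P_def by (rule finite_UN_disjointed_eq)
    also have "\<dots> = UNIV"
      using T(2) unfolding x by force
    finally show ?thesis
      by (simp add: lessThan_atLeast0)
  qed
  ultimately show ?thesis
    using close near by (intro exI[of _ n] exI[of _ P] exI[of _ x]) auto
qed

text \<open>For a union A of pieces, the generators map A into A together with the parts of the
  images that land in other pieces. Expansion gives (1 + \<alpha>) times the mass of A, so these
  parts carry at least \<alpha> times it, and subadditivity bounds them by the flow w. The row sums
  are bounded because the pieces partition each image.\<close>

lemma weighted_expander_partition:
  assumes exp: "0 < \<alpha>" "\<And>A. A \<in> sets \<nu> \<Longrightarrow> emeasure \<nu> A \<le> emeasure \<nu> (space \<nu>) / 2 \<Longrightarrow>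
      ennreal (1 + \<alpha>) * emeasure \<nu> A \<le> emeasure \<nu> (\<Union>s\<in>S. \<phi> s ` A)"
    and \<Theta>: "\<And>s. s \<in> S \<Longrightarrow> 0 \<le> \<Theta> s"
      "\<And>s A. s \<in> S \<Longrightarrow> A \<in> sets \<nu> \<Longrightarrow> emeasure \<nu> (\<phi> s ` A) \<le> ennreal (\<Theta> s) * emeasure \<nu> A"
    and P: "\<And>i. P i \<in> sets \<nu>" "disjoint_family P" "(\<Union>i<n. P i) = UNIV"
  shows "weighted_expander {..<n::nat} (\<lambda>i. measure \<nu> (P i))
    (\<lambda>i j. \<Sum>s\<in>S. measure \<nu> (\<phi> s ` P i \<inter> P j)) \<alpha> (\<Sum>s\<in>S. \<Theta> s)"
proof -
  interpret fm: finite_measure \<nu>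
    by (rule finite_measureI) (use riemannian_measure_finite[OF comp] in simp)
  have sets: "sets \<nu> = sets borel"
    by (rule sets_riemannian_measure[OF comp])
  then have space: "space \<nu> = UNIV"
    by (metis sets_eq_imp_space_eq space_borel)
  \<comment> \<open>The image under a generator is the preimage under its inverse, which is also
    given by an element of S and continuous.\<close>
  have img: "\<phi> s ` A \<in> sets \<nu>" if s: "s \<in> S" and A: "A \<in> sets \<nu>" for s A
  proof -
    obtain s' where s': "s' \<in> S" "\<And>x. \<phi> s' (\<phi> s x) = x"
      using inv_S[OF s] by blast
    obtain s'' where s'': "\<And>x. \<phi> s'' (\<phi> s' x) = x"
      using inv_S[OF s'(1)] by blast
    have right: "\<phi> s (\<phi> s' x) = x" for x
      by (metis s'(2) s'')
    have "\<phi> s ` A = \<phi> s' -` A"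
      using s'(2) right by (auto simp: image_iff) (metis)
    moreover have "\<phi> s' \<in> borel_measurable borel"
      using continuous_\<phi>[OF s'(1)] by (rule borel_measurable_continuous_onI)
    ultimately show ?thesis
      using measurable_sets[of "\<phi> s'" borel borel A] A sets by simp
  qed
  have disj: "disjoint_family_on P I" for I
    using P(2) by (auto simp: disjoint_family_on_def)
  have sum_P: "measure \<nu> (\<Union>i\<in>J. P i) = (\<Sum>i\<in>J. measure \<nu> (P i))" if "finite J" for J
    using that P(1) disj by (intro fm.finite_measure_finite_Union) auto
  show ?thesis
  proof
    show "(\<Sum>s\<in>S. measure \<nu> (\<phi> s ` P i \<inter> P j)) \<ge> 0" for i j
      by (intro sum_nonneg) simp
    show "0 \<le> (\<Sum>s\<in>S. \<Theta> s)"
      by (intro sum_nonneg \<Theta>(1))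
  next
    fix J assume J: "J \<subseteq> {..<n}"
      and half: "2 * (\<Sum>i\<in>J. measure \<nu> (P i)) \<le> (\<Sum>i<n. measure \<nu> (P i))"
    have finJ: "finite J"
      using J finite_subset by blast
    let ?A = "\<Union>i\<in>J. P i"
    \<comment> \<open>The part of the images of \<open>?A\<close> that falls into pieces with index
      outside J.\<close>
    let ?B = "\<Union>s\<in>S. \<Union>i\<in>J. \<Union>j\<in>{..<n} - J. \<phi> s ` P i \<inter> P j"
    have A: "?A \<in> sets \<nu>"
      using finJ P(1) by auto
    have SA: "(\<Union>s\<in>S. \<phi> s ` ?A) \<in> sets \<nu>"
      using img[OF _ A] finite_S by (intro sets.finite_UN)
    have B: "?B \<in> sets \<nu>"
      using img P(1) finite_S finJ by (intro sets.finite_UN sets.Int) auto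
    have "measure \<nu> ?A \<le> measure \<nu> (space \<nu>) / 2"
      using half sum_P[OF finJ] sum_P[of "{..<n}"] P(3) space by simp
    then have "emeasure \<nu> ?A \<le> emeasure \<nu> (space \<nu>) / 2"
      unfolding fm.emeasure_eq_measure
      using divide_ennreal[of "measure \<nu> (space \<nu>)" 2] by (simp add: ennreal_leI)
    then have "ennreal (1 + \<alpha>) * emeasure \<nu> ?A \<le> emeasure \<nu> (\<Union>s\<in>S. \<phi> s ` ?A)"
      by (rule exp(2)[OF A])
    then have "ennreal ((1 + \<alpha>) * measure \<nu> ?A) \<le> ennreal (measure \<nu> (\<Union>s\<in>S. \<phi> s ` ?A))"
      unfolding fm.emeasure_eq_measure using exp(1) by (simp add: ennreal_mult)
    then have "(1 + \<alpha>) * measure \<nu> ?A \<le> measure \<nu> (\<Union>s\<in>S. \<phi> s ` ?A)"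
      by simp
    also have "\<dots> \<le> measure \<nu> (?A \<union> ?B)"
    proof (rule fm.finite_measure_mono)
      show "(\<Union>s\<in>S. \<phi> s ` ?A) \<subseteq> ?A \<union> ?B"
      proof
        fix z assume "z \<in> (\<Union>s\<in>S. \<phi> s ` ?A)"
        then obtain s i where si: "s \<in> S" "i \<in> J" "z \<in> \<phi> s ` P i"
          by blast
        obtain j where "j < n" "z \<in> P j"
          using P(3) by blast
        then show "z \<in> ?A \<union> ?B"
          using si by (cases "j \<in> J") blast+
      qed
      show "?A \<union> ?B \<in> sets \<nu>"
        using A B by blast
    qed
    also have "\<dots> \<le> measure \<nu> ?A + measure \<nu> ?B"
      using A B by (rule measure_Un_le)
    also have "measure \<nu> ?B \<le> (\<Sum>s\<in>S. \<Sum>i\<in>J. \<Sum>j\<in>{..<n} - J. measure \<nu> (\<phi> s ` P i \<inter> P j))"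
      using img P(1) finite_S finJ
      by (intro order_trans[OF fm.finite_measure_subadditive_finite] sum_mono order_refl
          sets.finite_UN sets.Int image_subsetI) auto
    also have "\<dots> = (\<Sum>i\<in>J. \<Sum>s\<in>S. \<Sum>j\<in>{..<n} - J. measure \<nu> (\<phi> s ` P i \<inter> P j))"
      by (rule sum.swap)
    also have "\<dots> = (\<Sum>i\<in>J. \<Sum>j\<in>{..<n} - J. \<Sum>s\<in>S. measure \<nu> (\<phi> s ` P i \<inter> P j))"
      by (intro sum.cong refl sum.swap)
    finally show "\<alpha> * (\<Sum>i\<in>J. measure \<nu> (P i))
        \<le> (\<Sum>i\<in>J. \<Sum>j\<in>{..<n} - J. \<Sum>s\<in>S. measure \<nu> (\<phi> s ` P i \<inter> P j))"
      using sum_P[OF finJ] by (simp add: algebra_simps)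
  next
    fix i :: nat assume "i \<in> {..<n}"
    have "(\<Sum>j<n. \<Sum>s\<in>S. measure \<nu> (\<phi> s ` P i \<inter> P j)) = (\<Sum>s\<in>S. \<Sum>j<n. measure \<nu> (\<phi> s ` P i \<inter> P j))"
      by (rule sum.swap)
    also have "\<dots> \<le> (\<Sum>s\<in>S. \<Theta> s * measure \<nu> (P i))"
    proof (rule sum_mono)
      fix s assume s: "s \<in> S"
      have "(\<Sum>j<n. measure \<nu> (\<phi> s ` P i \<inter> P j)) = measure \<nu> (\<Union>j<n. \<phi> s ` P i \<inter> P j)"
      proof (rule fm.finite_measure_finite_Union[symmetric])
        show "disjoint_family_on (\<lambda>j. \<phi> s ` P i \<inter> P j) {..<n}"
          using disj[of "{..<n}"] unfolding disjoint_family_on_def by blast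
      qed (use img[OF s P(1)] P(1) in auto)
      also have "(\<Union>j<n. \<phi> s ` P i \<inter> P j) = \<phi> s ` P i"
        using P(3) by blast
      also have "ennreal (measure \<nu> (\<phi> s ` P i)) \<le> ennreal (\<Theta> s * measure \<nu> (P i))"
        using \<Theta>(2)[OF s P(1), of i] \<Theta>(1)[OF s] unfolding fm.emeasure_eq_measure by (simp add: ennreal_mult)
      then have "measure \<nu> (\<phi> s ` P i) \<le> \<Theta> s * measure \<nu> (P i)"
        using \<Theta>(1)[OF s] by simp
      finally show "(\<Sum>j<n. measure \<nu> (\<phi> s ` P i \<inter> P j)) \<le> \<Theta> s * measure \<nu> (P i)" .
    qed
    finally show "(\<Sum>j<n. \<Sum>s\<in>S. measure \<nu> (\<phi> s ` P i \<inter> P j)) \<le> (\<Sum>s\<in>S. \<Theta> s) * measure \<nu> (P i)"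
      by (simp add: sum_distrib_right)
  qed (use exp(1) in auto)
qed

text \<open>All constants from K to R0 are fixed before the level t, which is possible because the
  Poincare constant is independent of the partition. Only then is t taken so high that warped balls
  of radius R0 + 1 carry at most a quarter of the mass.\<close>

lemma no_coarse_embedding_Lp:
  fixes N :: "'w measure"
  assumes exp: "0 < \<alpha>" "\<And>A. A \<in> sets \<nu> \<Longrightarrow> emeasure \<nu> A \<le> emeasure \<nu> (space \<nu>) / 2 \<Longrightarrow>
      ennreal (1 + \<alpha>) * emeasure \<nu> A \<le> emeasure \<nu> (\<Union>s\<in>S. \<phi> s ` A)"
    and \<Theta>: "\<And>s. s \<in> S \<Longrightarrow> 0 \<le> \<Theta> s"
      "\<And>s A. s \<in> S \<Longrightarrow> A \<in> sets \<nu> \<Longrightarrow> emeasure \<nu> (\<phi> s ` A) \<le> ennreal (\<Theta> s) * emeasure \<nu> A"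
    and p: "1 \<le> p"
    and f: "f \<in> open_cone \<rightarrow> Lp_space p N"
    and \<eta>1: "mono_on {0..} \<eta>1" "\<not> bdd_above (\<eta>1 ` {0..})"
    and \<eta>2: "mono_on {0..} \<eta>2"
    and lower: "\<And>z w. z \<in> open_cone \<Longrightarrow> w \<in> open_cone \<Longrightarrow>
      \<eta>1 (warped_cone_dist \<A> g \<phi> S z w) \<le> Lp_dist p N (f z) (f w)"
    and upper: "\<And>z w. z \<in> open_cone \<Longrightarrow> w \<in> open_cone \<Longrightarrow>
      Lp_dist p N (f z) (f w) \<le> \<eta>2 (warped_cone_dist \<A> g \<phi> S z w)"
  shows False
proof -
  interpret fm: finite_measure \<nu>
    by (rule finite_measureI) (use riemannian_measure_finite[OF comp] in simp)
  have sets: "sets \<nu> = sets borel"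
    by (rule sets_riemannian_measure[OF comp])
  then have space: "space \<nu> = UNIV"
    by (metis sets_eq_imp_space_eq space_borel)
  let ?\<delta> = "warped_cone_dist \<A> g \<phi> S"
  define M where "M = measure \<nu> UNIV"
  have M: "M > 0"
    using riemannian_measure_pos[OF comp] unfolding M_def space fm.emeasure_eq_measure by simp
  define D where "D = (\<Sum>s\<in>S. \<Theta> s)"
  have D: "0 \<le> D"
    unfolding D_def by (intro sum_nonneg \<Theta>(1))
  obtain K where "0 \<le> K \<and> (\<forall>(I :: nat set) m w a. weighted_expander I m w \<alpha> D \<longrightarrow>
    (\<Sum>i\<in>I. \<Sum>j\<in>I. m i * m j * \<bar>a i - a j\<bar> powr p)
      \<le> K * sum m I * (\<Sum>i\<in>I. \<Sum>j\<in>I. w i j * \<bar>a i - a j\<bar> powr p))"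
    by (rule exE[OF poincare_inequality[OF exp(1) D p]])
  then have K: "0 \<le> K" "weighted_expander I m w \<alpha> D \<Longrightarrow>
    (\<Sum>i\<in>I. \<Sum>j\<in>I. m i * m j * \<bar>a i - a j\<bar> powr p)
      \<le> K * sum m I * (\<Sum>i\<in>I. \<Sum>j\<in>I. w i j * \<bar>a i - a j\<bar> powr p)" for I :: "nat set" and m w a
    by simp_all
  \<comment> \<open>The number 3 bounds the warped distance between the centres of two pieces linked
    by a generator: one step from the first centre to a point y, one for the generator, one to the
    second centre. E bounds the p-th power of the distance of their images.\<close>
  define E where "E = max 0 (\<eta>2 3) powr p"
  \<comment> \<open>K * D * E bounds the average of the p-th power distance over pairs of pieces;
    adding 1 makes Q positive and the bound strict.\<close>
  define Q where "Q = K * D * E + 1"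
  have E: "0 \<le> E" and Q: "0 < Q" "K * D * E < Q"
    using K(1) D by (simp_all add: E_def Q_def add_nonneg_pos)
  \<comment> \<open>Points whose images are at p-th power distance at most 2 * Q must have warped
    distance below R0; the factor 2 is the one used in Markov's inequality.\<close>
  obtain R0 where R0: "0 \<le> R0" "(2 * Q) powr (1 / p) < \<eta>1 R0"
    using \<eta>1(2) unfolding bdd_above_def by (auto simp: not_le)
  \<comment> \<open>The extra 1 in the radius passes from the centre of a piece to all of its
    points.\<close>
  obtain t where t: "1 \<le> t" and small: "\<And>x. \<exists>B\<in>sets \<nu>. {y. ?\<delta> (x, t) (y, t) < R0 + 1} \<subseteq> B \<and>
      emeasure \<nu> B \<le> ennreal (M / 4)"
    using warped_balls_small[of "M / 4" "R0 + 1"] M R0(1) by auto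
  have in_cone: "(y, t) \<in> open_cone" for y
    using t by (simp add: open_cone_def)
  have tri: "?\<delta> (u, t) (v, t) \<le> ?\<delta> (u, t) (y, t) + ?\<delta> (y, t) (v, t)" for u v y
    unfolding warped_cone_dist_def by (intro W.warped_dist_triangle in_cone)
  have nonneg: "0 \<le> ?\<delta> (u, t) (v, t)" for u v
    unfolding warped_cone_dist_def by (intro W.warped_dist_nonneg in_cone)
  obtain n :: nat and P x where P: "\<And>i. P i \<in> sets \<nu>" "disjoint_family P" "(\<Union>i<n. P i) = UNIV"
    and near: "\<And>i y. i < n \<Longrightarrow> y \<in> P i \<Longrightarrow> ?\<delta> (x i, t) (y, t) \<le> 1"
      "\<And>i y. i < n \<Longrightarrow> y \<in> P i \<Longrightarrow> ?\<delta> (y, t) (x i, t) \<le> 1"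
    using level_partition[OF t] by metis
  let ?m = "\<lambda>i. measure \<nu> (P i)"
  let ?w = "\<lambda>i j. \<Sum>s\<in>S. measure \<nu> (\<phi> s ` P i \<inter> P j)"
  interpret we: weighted_expander "{..<n}" ?m ?w \<alpha> D
    unfolding D_def by (rule weighted_expander_partition[OF exp \<Theta> P])
  have sum_P: "measure \<nu> (\<Union>i\<in>J. P i) = sum ?m J" if "finite J" for J
    using that P(1,2)
    by (intro fm.finite_measure_finite_Union) (auto simp: disjoint_family_on_def)
  have sum_m: "sum ?m {..<n} = M"
    using sum_P[of "{..<n}"] P(3) by (simp add: M_def)
  have fL: "f (x i, t) \<in> Lp_space p N" for i
    by (rule funcset_mem[OF f in_cone])
  obtain F where F: "\<And>i. F i \<in> f (x i, t)"
    using Lp_space_rep[OF fL] by metis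
  let ?I = "\<lambda>i j. \<integral>\<omega>. \<bar>F i \<omega> - F j \<omega>\<bar> powr p \<partial>N"
  have I0: "0 \<le> ?I i j" for i j
    by (intro integral_nonneg_AE AE_I2) simp
  have dist_eq: "Lp_dist p N (f (x i, t)) (f (x j, t)) = ?I i j powr (1 / p)" for i j
    by (rule Lp_dist_eq[OF fL F fL F])
  have poinc: "(\<Sum>i<n. \<Sum>j<n. ?m i * ?m j * ?I i j) \<le> K * M * (\<Sum>i<n. \<Sum>j<n. ?w i j * ?I i j)"
  proof (rule poincare_inequality_Lp)
    show "(\<Sum>i<n. \<Sum>j<n. ?m i * ?m j * \<bar>a i - a j\<bar> powr p)
        \<le> K * M * (\<Sum>i<n. \<Sum>j<n. ?w i j * \<bar>a i - a j\<bar> powr p)" for a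
      using K(2)[OF we.weighted_expander_axioms, of a] sum_m by simp
    show "F i \<in> Lp_functions p N" for i
      using Lp_space_functions[OF fL F] .
  qed (use p in simp)
  \<comment> \<open>A nonzero weight provides a generator and a point y of the piece i that it moves
    into the piece j, so the two centres are at warped distance at most 3. A zero weight makes both
    sides vanish.\<close>
  have edge: "?w i j * ?I i j \<le> ?w i j * E" if ij: "i < n" "j < n" for i j
  proof (cases "?w i j = 0")
    case False
    then obtain s where s: "s \<in> S" "measure \<nu> (\<phi> s ` P i \<inter> P j) \<noteq> 0"
      by (meson sum.neutral)
    then have "\<phi> s ` P i \<inter> P j \<noteq> {}"
      by auto
    then obtain y where y: "y \<in> P i" "\<phi> s y \<in> P j"
      by blast
    have "?\<delta> (y, t) (\<phi> s y, t) \<le> 1"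
      using W.warped_dist_warp[OF in_cone s(1), of y] by (simp add: warped_cone_dist_def cone_action_def)
    then have "?\<delta> (x i, t) (x j, t) \<le> 3"
      using near(1)[OF ij(1) y(1)] near(2)[OF ij(2) y(2)] tri[of "x i" "x j" y] tri[of y "x j" "\<phi> s y"]
      by linarith
    then have "\<eta>2 (?\<delta> (x i, t) (x j, t)) \<le> \<eta>2 3"
      using nonneg by (intro mono_onD[OF \<eta>2]) auto
    then have "?I i j powr (1 / p) \<le> max 0 (\<eta>2 3)"
      using upper[OF in_cone in_cone, of "x i" "x j"] dist_eq[of i j] by linarith
    then have "(?I i j powr (1 / p)) powr p \<le> E"
      unfolding E_def using p by (intro powr_mono2) auto
    then have "?I i j \<le> E"
      using I0[of i j] p by (simp add: powr_powr)
    then show ?thesis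
      by (intro mult_left_mono sum_nonneg) auto
  qed simp
  have "(\<Sum>i<n. \<Sum>j<n. ?w i j * ?I i j) \<le> (\<Sum>i<n. \<Sum>j<n. ?w i j * E)"
    using edge by (intro sum_mono) auto
  also have "\<dots> = E * (\<Sum>i<n. \<Sum>j<n. ?w i j)"
    by (simp add: sum_distrib_left sum_distrib_right mult.commute)
  also have "\<dots> \<le> E * (\<Sum>i<n. D * ?m i)"
    using E by (intro mult_left_mono sum_mono we.row_sum) auto
  also have "\<dots> = E * (D * M)"
    by (simp add: sum_distrib_left[symmetric] sum_m)
  finally have "K * M * (\<Sum>i<n. \<Sum>j<n. ?w i j * ?I i j) \<le> K * M * (E * (D * M))"
    using K(1) M by (intro mult_left_mono) auto
  with poinc have "(\<Sum>i<n. \<Sum>j<n. ?m i * ?m j * ?I i j) \<le> K * M * (E * (D * M))"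
    by (rule order_trans)
  also have "\<dots> = (K * D * E) * (M * M)"
    by (simp only: mult_ac)
  also have "\<dots> < Q * (M * M)"
    using Q(2) M by (intro mult_strict_right_mono) auto
  finally have total: "(\<Sum>i<n. ?m i * (\<Sum>j<n. ?m j * ?I i j)) < Q * (M * M)"
    by (simp add: sum_distrib_left mult.assoc)
  \<comment> \<open>Some piece has at most average displacement: otherwise weighting all rows by
    their masses would contradict \<open>total\<close>.\<close>
  have "\<exists>i<n. (\<Sum>j<n. ?m j * ?I i j) \<le> Q * M"
  proof (rule ccontr)
    assume "\<not> ?thesis"
    then have "(\<Sum>i<n. ?m i * (Q * M)) \<le> (\<Sum>i<n. ?m i * (\<Sum>j<n. ?m j * ?I i j))"
      by (intro sum_mono mult_left_mono) (auto simp: not_le less_imp_le)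
    also have "(\<Sum>i<n. ?m i * (Q * M)) = Q * (M * M)"
      unfolding sum_distrib_right[symmetric] sum_m by simp
    finally show False
      using total by simp
  qed
  then obtain i where i: "i < n" "(\<Sum>j<n. ?m j * ?I i j) \<le> Q * M"
    by blast
  \<comment> \<open>Markov's inequality: the pieces whose p-th power distance from the piece i
    exceeds 2 * Q carry at most half of the mass. The remaining ones lie in the warped ball around x
    i.\<close>
  define J where "J = {j\<in>{..<n}. ?I i j > 2 * Q}"
  have J: "finite J" "J \<subseteq> {..<n}"
    by (auto simp: J_def)
  have "sum ?m J * (2 * Q) = (\<Sum>j\<in>J. ?m j * (2 * Q))"
    by (simp add: sum_distrib_right)
  also have "\<dots> \<le> (\<Sum>j\<in>J. ?m j * ?I i j)"
    by (intro sum_mono mult_left_mono) (auto simp: J_def)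
  also have "\<dots> \<le> (\<Sum>j<n. ?m j * ?I i j)"
    using J(2) I0 by (intro sum_mono2) auto
  also have "\<dots> \<le> Q * M"
    by (rule i(2))
  finally have "sum ?m J \<le> M / 2"
    using Q(1) by (simp add: field_simps)
  then have big: "M / 2 \<le> sum ?m ({..<n} - J)"
    using sum_diff[of "{..<n}" J ?m] J(2) sum_m by simp
  obtain B where B: "B \<in> sets \<nu>" "{y. ?\<delta> (x i, t) (y, t) < R0 + 1} \<subseteq> B" "emeasure \<nu> B \<le> ennreal (M / 4)"
    using small by blast
  have "(\<Union>j\<in>{..<n} - J. P j) \<subseteq> B"
  proof
    fix y assume "y \<in> (\<Union>j\<in>{..<n} - J. P j)"
    then obtain j where j: "j < n" "j \<notin> J" "y \<in> P j"
      by blast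
    then have "?I i j \<le> 2 * Q"
      by (simp add: J_def)
    then have "?I i j powr (1 / p) \<le> (2 * Q) powr (1 / p)"
      using I0 p by (intro powr_mono2) auto
    then have less: "\<eta>1 (?\<delta> (x i, t) (x j, t)) < \<eta>1 R0"
      using lower[OF in_cone in_cone, of "x i" "x j"] dist_eq[of i j] R0(2) by linarith
    have "?\<delta> (x i, t) (x j, t) < R0"
    proof (rule ccontr)
      assume "\<not> ?thesis"
      then have "\<eta>1 R0 \<le> \<eta>1 (?\<delta> (x i, t) (x j, t))"
        using R0(1) nonneg by (intro mono_onD[OF \<eta>1(1)]) auto
      then show False
        using less by simp
    qed
    then have "?\<delta> (x i, t) (y, t) < R0 + 1"
      using tri[of "x i" y "x j"] near(1)[OF j(1,3)] by linarith
    then show "y \<in> B"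
      using B(2) by blast
  qed
  then have "measure \<nu> (\<Union>j\<in>{..<n} - J. P j) \<le> measure \<nu> B"
    using B(1) by (rule fm.finite_measure_mono)
  also have "\<dots> \<le> M / 4"
    using B(3) M unfolding fm.emeasure_eq_measure by simp
  finally show False
    using big sum_P[of "{..<n} - J"] M by simp
qed

end

section \<open>From the group action to the data of its generators\<close>

theorem corollary6p7:
  fixes G :: "('g, 'b) monoid_scheme"
    and S :: "'g set"
    and \<A> :: "('m::{t2_space,second_countable_topology}, 'n::finite) chart set"
    and g :: "('m, 'n) chart \<Rightarrow> 'm \<Rightarrow> real^'n^'n"
    and \<phi> :: "'g \<Rightarrow> 'm \<Rightarrow> 'm"
    and N :: "'w measure"
    and p :: real
  assumes "group G"
    and "finite S" and "S \<subseteq> carrier G" and "generate G S = carrier G"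
    and "\<forall>s\<in>S. inv\<^bsub>G\<^esub> s \<in> S" and "\<one>\<^bsub>G\<^esub> \<in> S"
    and "riemannian_manifold \<A> g"
    and "compact (UNIV :: 'm set)" and "connected (UNIV :: 'm set)"
    and "group_action G (UNIV :: 'm set) \<phi>"
    and "\<forall>h\<in>carrier G. quasi_symmetric (riemannian_dist \<A> g) (\<phi> h)"
    and "\<forall>h\<in>carrier G. bounded_measure_distortion (riemannian_measure \<A> g) (\<phi> h)"
    and "expanding_in_measure (riemannian_measure \<A> g) \<phi> S"
    and "1 \<le> p"
  shows "\<not> (\<exists>f. coarse_embedding open_cone (warped_cone_dist \<A> g \<phi> S)
                  (Lp_space p N) (Lp_dist p N) f)"
proof
  assume "\<exists>f. coarse_embedding open_cone (warped_cone_dist \<A> g \<phi> S) (Lp_space p N) (Lp_dist p N) f"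
  then obtain f \<eta>1 \<eta>2 where f: "f \<in> open_cone \<rightarrow> Lp_space p N"
    and \<eta>: "\<forall>\<eta>\<in>{\<eta>1, \<eta>2}. \<eta> \<in> {0..} \<rightarrow> {0..} \<and> mono_on {0..} \<eta> \<and> \<not> bdd_above (\<eta> ` {0::real..})"
    and bounds: "\<forall>z\<in>open_cone. \<forall>w\<in>open_cone.
      \<eta>1 (warped_cone_dist \<A> g \<phi> S z w) \<le> Lp_dist p N (f z) (f w) \<and>
      Lp_dist p N (f z) (f w) \<le> \<eta>2 (warped_cone_dist \<A> g \<phi> S z w)"
    unfolding coarse_embedding_def by (elim exE conjE) (rule that; assumption)
  interpret act: group_action G "UNIV :: 'm set" \<phi>
    by fact
  interpret warped_cone \<A> g \<phi> S
  proof unfold_locales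
    have "\<phi> \<one>\<^bsub>G\<^esub> = id"
      using act.id_eq_one by (auto simp: fun_eq_iff)
    then show "\<exists>e\<in>S. \<phi> e = id"
      using \<open>\<one>\<^bsub>G\<^esub> \<in> S\<close> by blast
    show "\<exists>s'\<in>S. \<forall>x. \<phi> s' (\<phi> s x) = x" if "s \<in> S" for s
      using that \<open>S \<subseteq> carrier G\<close> \<open>\<forall>s\<in>S. inv\<^bsub>G\<^esub> s \<in> S\<close> act.orbit_sym_aux
      by (intro bexI[of _ "inv\<^bsub>G\<^esub> s"]) auto
    show "continuous_on UNIV (\<phi> s)" if "s \<in> S" for s
    proof -
      have "quasi_symmetric (riemannian_dist \<A> g) (\<phi> s)"
        using assms(11) that \<open>S \<subseteq> carrier G\<close> by blast
      then show ?thesis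
        unfolding quasi_symmetric_def by (auto simp: homeomorphism_def)
    qed
  qed (use assms in auto)
  obtain \<alpha> where \<alpha>: "0 < \<alpha>" "\<forall>A\<in>sets \<nu>. emeasure \<nu> A \<le> emeasure \<nu> (space \<nu>) / 2 \<longrightarrow>
      ennreal (1 + \<alpha>) * emeasure \<nu> A \<le> emeasure \<nu> (\<Union>s\<in>S. \<phi> s ` A)"
    using assms(13) unfolding expanding_in_measure_def by blast
  have "\<exists>\<theta>\<ge>0. \<forall>A\<in>sets \<nu>. emeasure \<nu> (\<phi> s ` A) \<le> ennreal \<theta> * emeasure \<nu> A" if "s \<in> S" for s
  proof -
    have "bounded_measure_distortion \<nu> (\<phi> s)"
      using assms(12) that \<open>S \<subseteq> carrier G\<close> by blast
    then obtain \<theta> where "\<theta> \<ge> 1" "\<forall>A\<in>sets \<nu>. emeasure \<nu> (\<phi> s ` A) \<le> ennreal \<theta> * emeasure \<nu> A"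
      unfolding bounded_measure_distortion_def by blast
    then show ?thesis
      by (intro exI[of _ \<theta>]) simp
  qed
  then obtain \<Theta> where \<Theta>: "\<And>s. s \<in> S \<Longrightarrow> 0 \<le> \<Theta> s"
      "\<And>s A. s \<in> S \<Longrightarrow> A \<in> sets \<nu> \<Longrightarrow> emeasure \<nu> (\<phi> s ` A) \<le> ennreal (\<Theta> s) * emeasure \<nu> A"
    by metis
  show False
    by (rule no_coarse_embedding_Lp[of \<alpha> \<Theta> p f N \<eta>1 \<eta>2]) (use \<alpha> \<Theta> f \<eta> bounds \<open>1 \<le> p\<close> in auto)
qed

end
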